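(* Let $\sigma_1\in\mathbb C^{p\times p}$ be self-adjoint and invertible, let $w\in\mathbb C_+$, $\xi,\eta\in\mathbb C^{1\times p}$, and assume that $$\mathbb X=\frac{\xi\sigma_1\xi^*-\eta\sigma_1\eta^*}{w+w^*}>0 .$$ Let $$\Theta(\lambda)=\begin{bmatrix}\Theta_{11}&\Theta_{12}\\ \Theta_{21}&\Theta_{22}\end{bmatrix}=\begin{bmatrix}I_p+\dfrac{\eta^*\eta\sigma_1}{\mathbb X(\lambda+w^* )}&\dfrac{\eta^*\xi\sigma_1}{\mathbb X(\lambda+w^* )}\\[2mm] -\dfrac{\xi^*\eta\sigma_1}{\mathbb X(\lambda+w^* )}&I_p-\dfrac{\xi^*\xi\sigma_1}{\mathbb X(\lambda+w^* )}\end{bmatrix}.$$ Let $S_0\in\mathcal{RS}$ with minimal realization $$S_0(\lambda)=I_p-B_0^*\mathbb X_0^{-1}(\lambda I-A_0)^{-1}B_0\sigma_1 .$$ Then $S=T_\Theta(S_0)\in\mathcal{RS}$, and a minimal realization of $S$ is given by $$S(\lambda)=I_p-B_S^*\mathbb X_S^{-1}(\lambda I-A_S)^{-1}B_S\sigma_1,$$ where $$B_S=\begin{bmatrix}B_0\\ \eta-\xi\end{bmatrix},\qquad \mathbb X_S=\begin{bmatrix}\mathbb X_0&0\\0&\mathbb X\end{bmatrix},\qquad A_S=\begin{bmatrix}A_0&\dfrac{B_0\sigma_1\xi^*}{\mathbb X}\\[2mm] -\eta\sigma_1B_0^*\mathbb X_0^{-1}&-w^*-\dfrac{\eta\sigma_1(\eta^*-\xi^*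 )}{\mathbb X}\end{bmatrix}.$$
   Context: $\mathbb C_+$ is the open right half plane and $w^*$ denotes the complex conjugate of $w$. $\mathcal{RS}$ is the class of rational $\mathbb C^{p\times p}$-valued functions $S$ with $S(\infty)=I_p$ that are $\sigma_1$-inner: $S(\lambda)^*\sigma_1S(\lambda)\le\sigma_1$ at all points of analyticity in $\mathbb C_+$ and $S(\lambda)^*\sigma_1S(\lambda)=\sigma_1$ at all points of the imaginary axis where $S$ is defined. The linear fractional transformation is $T_\Theta(W)=(\Theta_{11}+W\Theta_{21})^{-1}(\Theta_{12}+W\Theta_{22})$. In realizations of the form $I_p-B^*\mathbb X^{-1}(\lambda I-A)^{-1}B\sigma_1$ of functions in $\mathcal{RS}$, $\mathbb X$ is a positive (Gram) matrix and the Lyapunov equation $A\mathbb X+\mathbb XA^*+B\sigma_1B^*=0$ holds. Minimal means that the size of the matrix $A$ is the smallest possible among realizations of the function. *)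

theory Defs
  imports
    Complex_Main
    "HOL-Computational_Algebra.Polynomial_Factorial"
    "HOL-Computational_Algebra.Field_as_Ring"
    "Jordan_Normal_Form.Gauss_Jordan_Elimination"
    "Jordan_Normal_Form.Schur_Decomposition"
begin

section \<open>Rational matrix functions\<close>

text \<open>A scalar rational function of \<open>\<lambda>\<close> is an element of the field of fractions of the
  polynomial ring, so equality of rational functions is equality in that field and removable
  singularities do not arise: the library function \<open>quot_of_fract\<close> returns a coprime
  numerator/denominator pair, and the poles are exactly the zeros of that denominator.\<close>

type_synonym ratfun = "complex poly fract"

definition rat_analytic_at :: "ratfun \<Rightarrow> complex \<Rightarrow> bool" where
  "rat_analytic_at r z \<longleftrightarrow> poly (snd (quot_of_fract r)) z \<noteq> 0"

definition rat_eval :: "ratfun \<Rightarrow> complex \<Rightarrow> complex" where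
  "rat_eval r z = poly (fst (quot_of_fract r)) z / poly (snd (quot_of_fract r)) z"

definition rat_const :: "complex \<Rightarrow> ratfun" where
  "rat_const c = to_fract [:c:]"

text \<open>The independent variable \<open>\<lambda>\<close>.\<close>

definition rat_var :: ratfun where
  "rat_var = to_fract [:0, 1:]"

definition analytic_mat_at :: "ratfun mat \<Rightarrow> complex \<Rightarrow> bool" where
  "analytic_mat_at S z \<longleftrightarrow> (\<forall>i < dim_row S. \<forall>j < dim_col S. rat_analytic_at (S $$ (i, j)) z)"

definition eval_mat :: "ratfun mat \<Rightarrow> complex \<Rightarrow> complex mat" where
  "eval_mat S z = map_mat (\<lambda>r. rat_eval r z) S"

definition const_mat :: "complex mat \<Rightarrow> ratfun mat" where
  "const_mat M = map_mat rat_const M"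

text \<open>The value at infinity, as an entrywise limit.\<close>

definition value_at_infinity :: "ratfun mat \<Rightarrow> complex mat \<Rightarrow> bool" where
  "value_at_infinity S D \<longleftrightarrow> dim_row S = dim_row D \<and> dim_col S = dim_col D \<and>
     (\<forall>i < dim_row D. \<forall>j < dim_col D. (rat_eval (S $$ (i, j)) \<longlongrightarrow> D $$ (i, j)) at_infinity)"

section \<open>Matrix inverse and positivity\<close>

text \<open>Unspecified for singular matrices.\<close>

definition mat_inv :: "'a :: field mat \<Rightarrow> 'a mat" where
  "mat_inv A = the (mat_inverse A)"

text \<open>In the order on \<open>complex\<close> used here, \<open>0 \<le> z\<close> means that \<open>z\<close> is real and nonnegative,
  so both notions below entail that the matrix is self-adjoint.\<close>

definition positive_definite :: "complex mat \<Rightarrow> bool" where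
  "positive_definite M \<longleftrightarrow> square_mat M \<and>
     (\<forall>v \<in> carrier_vec (dim_row M). v \<noteq> 0\<^sub>v (dim_row M) \<longrightarrow> 0 < (M *\<^sub>v v) \<bullet>c v)"

definition positive_semidefinite :: "complex mat \<Rightarrow> bool" where
  "positive_semidefinite M \<longleftrightarrow> square_mat M \<and>
     (\<forall>v \<in> carrier_vec (dim_row M). 0 \<le> (M *\<^sub>v v) \<bullet>c v)"

definition loewner_le :: "complex mat \<Rightarrow> complex mat \<Rightarrow> bool" where
  "loewner_le A B \<longleftrightarrow> positive_semidefinite (B - A)"

section \<open>The class RS of rational inner functions\<close>

definition RS :: "nat \<Rightarrow> complex mat \<Rightarrow> ratfun mat set" where
  "RS p \<sigma> = {S \<in> carrier_mat p p.
     value_at_infinity S (1\<^sub>m p) \<and>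
     (\<forall>z. Re z > 0 \<and> analytic_mat_at S z \<longrightarrow>
        loewner_le (mat_adjoint (eval_mat S z) * \<sigma> * eval_mat S z) \<sigma>) \<and>
     (\<forall>z. Re z = 0 \<and> analytic_mat_at S z \<longrightarrow>
        mat_adjoint (eval_mat S z) * \<sigma> * eval_mat S z = \<sigma>)}"

section \<open>Realizations\<close>

text \<open>The resolvent \<open>(\<lambda>I - A)\<^sup>-\<^sup>1\<close> as a rational matrix function; \<open>\<lambda>I - A\<close> is invertible over
  the field of rational functions for every constant \<open>A\<close>.\<close>

definition resolvent :: "nat \<Rightarrow> complex mat \<Rightarrow> ratfun mat" where
  "resolvent n A = mat_inv (rat_var \<cdot>\<^sub>m 1\<^sub>m n - const_mat A)"

text \<open>\<open>S(\<lambda>) = D + C(\<lambda>I - A)\<^sup>-\<^sup>1B\<close> with \<open>A\<close> of size \<open>n\<close>, without any structural requirement.\<close>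

definition realization ::
  "nat \<Rightarrow> ratfun mat \<Rightarrow> nat \<Rightarrow> complex mat \<Rightarrow> complex mat \<Rightarrow> complex mat \<Rightarrow> complex mat \<Rightarrow> bool" where
  "realization p S n A B C D \<longleftrightarrow>
     A \<in> carrier_mat n n \<and> B \<in> carrier_mat n p \<and> C \<in> carrier_mat p n \<and> D \<in> carrier_mat p p \<and>
     S = const_mat D + const_mat C * resolvent n A * const_mat B"

text \<open>\<open>S(\<lambda>) = I - B\<^sup>* X\<^sup>-\<^sup>1 (\<lambda>I - A)\<^sup>-\<^sup>1 B \<sigma>\<close>, with \<open>X > 0\<close> solving the Lyapunov equation.\<close>

definition RS_realization ::
  "nat \<Rightarrow> complex mat \<Rightarrow> ratfun mat \<Rightarrow> nat \<Rightarrow> complex mat \<Rightarrow> complex mat \<Rightarrow> complex mat \<Rightarrow> bool" where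
  "RS_realization p \<sigma> S n A B X \<longleftrightarrow>
     A \<in> carrier_mat n n \<and> B \<in> carrier_mat n p \<and> X \<in> carrier_mat n n \<and>
     positive_definite X \<and>
     A * X + X * mat_adjoint A + B * \<sigma> * mat_adjoint B = 0\<^sub>m n n \<and>
     S = 1\<^sub>m p - const_mat (mat_adjoint B * mat_inv X) * resolvent n A * const_mat (B * \<sigma>)"

text \<open>The competitors for minimality are all state space realizations of \<open>S\<close>, not only those of
  the structured form.\<close>

definition minimal_RS_realization ::
  "nat \<Rightarrow> complex mat \<Rightarrow> ratfun mat \<Rightarrow> nat \<Rightarrow> complex mat \<Rightarrow> complex mat \<Rightarrow> complex mat \<Rightarrow> bool" where
  "minimal_RS_realization p \<sigma> S n A B X \<longleftrightarrow>
     RS_realization p \<sigma> S n A B X \<and>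
     (\<forall>m A' B' C' D'. realization p S m A' B' C' D' \<longrightarrow> n \<le> m)"

section \<open>Linear fractional transformations\<close>

definition lft_denom :: "nat \<Rightarrow> ratfun mat \<Rightarrow> ratfun mat \<Rightarrow> ratfun mat" where
  "lft_denom p \<Theta> W = (case split_block \<Theta> p p of (\<Theta>11, \<Theta>12, \<Theta>21, \<Theta>22) \<Rightarrow> \<Theta>11 + W * \<Theta>21)"

definition lft_numer :: "nat \<Rightarrow> ratfun mat \<Rightarrow> ratfun mat \<Rightarrow> ratfun mat" where
  "lft_numer p \<Theta> W = (case split_block \<Theta> p p of (\<Theta>11, \<Theta>12, \<Theta>21, \<Theta>22) \<Rightarrow> \<Theta>12 + W * \<Theta>22)"

text \<open>\<open>T\<^sub>\<Theta>(W)\<close> is meaningful only where the matrix to be inverted is not identically singular.\<close>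

definition lft_defined :: "nat \<Rightarrow> ratfun mat \<Rightarrow> ratfun mat \<Rightarrow> bool" where
  "lft_defined p \<Theta> W \<longleftrightarrow> invertible_mat (lft_denom p \<Theta> W)"

definition lft :: "nat \<Rightarrow> ratfun mat \<Rightarrow> ratfun mat \<Rightarrow> ratfun mat" where
  "lft p \<Theta> W = mat_inv (lft_denom p \<Theta> W) * lft_numer p \<Theta> W"

end

theory Submission
  imports Defs
begin

text \<open>Why the theorem is true. Everything is read off from the triple \<open>(A\<^sub>S, B\<^sub>S, X\<^sub>S)\<close>.

\<^emph>\<open>The transfer function.\<close> Write \<open>y = (\<lambda>I - A\<^sub>S)\<^sup>-\<^sup>1 B\<^sub>S \<sigma>\<close> with blocks \<open>y\<^sub>0, y\<^sub>1\<close>, put \<open>Y = y\<^sub>1 / X\<close> and let \<open>T\<close> be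
the function realized by the triple. The first block row of the state equation says
\<open>y\<^sub>0 = (\<lambda>I - A\<^sub>0)\<^sup>-\<^sup>1 B\<^sub>0 \<sigma> (I + \<xi>\<^sup>* Y)\<close>, hence \<open>T = S\<^sub>0 - (\<eta>\<^sup>* - S\<^sub>0 \<xi>\<^sup>*) Y\<close>; the last row says
\<open>(\<lambda> + w\<^sup>*) y\<^sub>1 = \<eta> \<sigma> T - \<xi> \<sigma>\<close>. Eliminating \<open>Y\<close> gives
\<open>(\<Theta>\<^sub>1\<^sub>1 + S\<^sub>0 \<Theta>\<^sub>2\<^sub>1) T = \<Theta>\<^sub>1\<^sub>2 + S\<^sub>0 \<Theta>\<^sub>2\<^sub>2\<close>. The matrix on the left is the identity plus a rank one term \<open>d f\<close>
whose scalar \<open>f d\<close> tends to \<open>0\<close> at infinity, so it is invertible and \<open>T\<close> is the linear fractional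
transform (\<open>lft_state_space\<close>).

\<^emph>\<open>The inner property.\<close> The Lyapunov equation for \<open>X\<^sub>S\<close> holds block by block; its corner is the
definition of \<open>X\<close> (\<open>lyapunov\<close>). For any realization with positive \<open>X\<close> satisfying the Lyapunov
equation, \<open>\<sigma> - S(z)\<^sup>* \<sigma> S(z)\<close> equals \<open>2 Re z\<close> times a positive semidefinite matrix wherever the
resolvent is finite (\<open>inner_defect_identity\<close>). A point where only the resolvent has a pole is
approached along the vertical line through it (\<open>RS_realization_imp_RS\<close>).

\<^emph>\<open>Minimality.\<close> A realization without unobservable eigenvector and without uncontrollable left
eigenvector is minimal (\<open>controllable_observable_imp_minimal\<close>), and an uncontrollable left
eigenvector lets one remove a state (\<open>uncontrollable_mode_reduces_realization\<close>). When the Lyapunov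
equation holds with \<open>X > 0\<close>, the map \<open>u \<mapsto> X u\<close> carries uncontrollable eigenvectors to unobservable
ones, and the eigenvalues of such modes are purely imaginary. Suppose \<open>u = (a, b)\<close> satisfies
\<open>A\<^sub>S\<^sup>* u = \<mu> u\<close> and \<open>B\<^sub>S\<^sup>* u = 0\<close>. The second equation turns the last row of the first one into
\<open>\<mu> b = w\<^sup>* b\<close>. As \<open>Re \<mu> = 0 < Re w\<close>, this forces \<open>b = 0\<close>, and then \<open>a\<close> is an uncontrollable mode of
\<open>(A\<^sub>0, B\<^sub>0)\<close>, which the minimality of \<open>S\<^sub>0\<close> excludes (\<open>AS_controllable\<close>).\<close>

section \<open>Evaluation of scalar rational functions\<close>

text \<open>Poles and values are defined through the coprime representative. A common zero of numerator and
denominator of that representative would contradict coprimality, so any representative whose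
denominator does not vanish at \<open>z\<close> may be used instead. This makes evaluation compatible with the
field operations.\<close>

lemma rat_analytic_eval_Fract:
  assumes "poly b z \<noteq> 0"
  shows "rat_analytic_at (Fract a b) z" "rat_eval (Fract a b) z = poly a z / poly b z"
proof -
  define q where "q = quot_of_fract (Fract a b)"
  have b0: "b \<noteq> 0" using assms by auto
  have q0: "snd q \<noteq> 0" by (simp add: q_def)
  have "Fract (fst q) (snd q) = Fract a b" by (simp add: q_def)
  then have eq: "fst q * b = a * snd q" using b0 q0 by (simp add: eq_fract)
  have cop: "coprime (fst q) (snd q)" by (simp add: q_def coprime_quot_of_fract)
  have nz: "poly (snd q) z \<noteq> 0"
  proof
    assume z: "poly (snd q) z = 0"
    have "poly (fst q) z * poly b z = poly a z * poly (snd q) z"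
      using arg_cong[OF eq, of "\<lambda>p. poly p z"] by simp
    then have "poly (fst q) z = 0" using z assms by simp
    then have "[:-z, 1:] dvd fst q" "[:-z, 1:] dvd snd q" using z by (auto simp: poly_eq_0_iff_dvd)
    then have "is_unit [:-z, 1:]" using cop by (meson coprime_common_divisor)
    then show False by (auto simp: is_unit_iff_degree)
  qed
  then show "rat_analytic_at (Fract a b) z" by (simp add: rat_analytic_at_def q_def)
  have "poly (fst q) z * poly b z = poly a z * poly (snd q) z"
    using arg_cong[OF eq, of "\<lambda>p. poly p z"] by simp
  then show "rat_eval (Fract a b) z = poly a z / poly b z"
    using nz assms unfolding rat_eval_def q_def[symmetric] by (simp add: field_simps)
qed

lemma ratfun_cases:
  assumes "rat_analytic_at r z"
  obtains a b where "r = Fract a b" "poly b z \<noteq> 0" "b \<noteq> 0" "rat_eval r z = poly a z / poly b z"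
proof -
  have "r = Fract (fst (quot_of_fract r)) (snd (quot_of_fract r))" by simp
  moreover have "poly (snd (quot_of_fract r)) z \<noteq> 0" using assms by (simp add: rat_analytic_at_def)
  ultimately show thesis using that rat_eval_def by (metis snd_quot_of_fract_nonzero)
qed

lemma rat_eval_add:
  assumes "rat_analytic_at r z" "rat_analytic_at s z"
  shows "rat_analytic_at (r + s) z" "rat_eval (r + s) z = rat_eval r z + rat_eval s z"
proof -
  obtain a b where r: "r = Fract a b" "poly b z \<noteq> 0" "b \<noteq> 0" "rat_eval r z = poly a z / poly b z"
    using ratfun_cases[OF assms(1)] .
  obtain c d where s: "s = Fract c d" "poly d z \<noteq> 0" "d \<noteq> 0" "rat_eval s z = poly c z / poly d z"
    using ratfun_cases[OF assms(2)] .
  have *: "r + s = Fract (a * d + c * b) (b * d)" using r s by simp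
  have "poly (b * d) z \<noteq> 0" using r s by simp
  from rat_analytic_eval_Fract[OF this, of "a * d + c * b", folded *]
  show "rat_analytic_at (r + s) z" "rat_eval (r + s) z = rat_eval r z + rat_eval s z"
    using r(2) s(2) unfolding r(4) s(4) by (simp_all add: add_frac_eq)
qed

lemma rat_eval_mult:
  assumes "rat_analytic_at r z" "rat_analytic_at s z"
  shows "rat_analytic_at (r * s) z" "rat_eval (r * s) z = rat_eval r z * rat_eval s z"
proof -
  obtain a b where r: "r = Fract a b" "poly b z \<noteq> 0" "b \<noteq> 0" "rat_eval r z = poly a z / poly b z"
    using ratfun_cases[OF assms(1)] .
  obtain c d where s: "s = Fract c d" "poly d z \<noteq> 0" "d \<noteq> 0" "rat_eval s z = poly c z / poly d z"
    using ratfun_cases[OF assms(2)] .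
  have *: "r * s = Fract (a * c) (b * d)" using r s by simp
  have "poly (b * d) z \<noteq> 0" using r s by simp
  from rat_analytic_eval_Fract[OF this, of "a * c", folded *]
  show "rat_analytic_at (r * s) z" "rat_eval (r * s) z = rat_eval r z * rat_eval s z"
    unfolding r(4) s(4) by auto
qed

lemma rat_eval_const [simp]: "rat_analytic_at (rat_const k) z" "rat_eval (rat_const k) z = k"
  by (auto simp: rat_analytic_at_def rat_eval_def rat_const_def)

lemma rat_eval_var [simp]: "rat_analytic_at rat_var z" "rat_eval rat_var z = z"
  by (auto simp: rat_analytic_at_def rat_eval_def rat_var_def)

lemma rat_const_hom [simp]:
  "rat_const 0 = 0" "rat_const 1 = 1"
  "rat_const (a + b) = rat_const a + rat_const b"
  "rat_const (a - b) = rat_const a - rat_const b"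
  "rat_const (- a) = - rat_const a"
  "rat_const (a * b) = rat_const a * rat_const b"
  unfolding rat_const_def
  by (simp_all flip: to_fract_add to_fract_diff to_fract_uminus to_fract_mult one_pCons)

lemma rat_const_eq_0_iff [simp]: "rat_const a = 0 \<longleftrightarrow> a = 0"
  by (simp add: rat_const_def)

lemma rat_const_sum: "rat_const (sum f I) = (\<Sum>i\<in>I. rat_const (f i))"
  by (induction I rule: infinite_finite_induct) auto

lemma rat_eval_0 [simp]: "rat_analytic_at 0 z" "rat_eval 0 z = 0"
  using rat_eval_const[of 0 z] by (simp_all del: rat_eval_const)

lemma rat_eval_1 [simp]: "rat_analytic_at 1 z" "rat_eval 1 z = 1"
  using rat_eval_const[of 1 z] by (simp_all del: rat_eval_const)

lemma rat_eval_uminus: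
  assumes "rat_analytic_at r z"
  shows "rat_analytic_at (- r) z" "rat_eval (- r) z = - rat_eval r z"
  using rat_eval_mult[OF rat_eval_const(1)[of "-1" z] assms] rat_eval_const(2)[of "-1" z] by (simp_all del: rat_eval_const)

lemma rat_eval_diff:
  assumes "rat_analytic_at r z" "rat_analytic_at s z"
  shows "rat_analytic_at (r - s) z" "rat_eval (r - s) z = rat_eval r z - rat_eval s z"
  using rat_eval_add[OF assms(1) rat_eval_uminus(1)[OF assms(2)]] rat_eval_uminus(2)[OF assms(2)] by simp_all

lemma rat_eval_sum:
  assumes "\<And>i. i \<in> I \<Longrightarrow> rat_analytic_at (f i) z"
  shows "rat_analytic_at (sum f I) z \<and> rat_eval (sum f I) z = (\<Sum>i\<in>I. rat_eval (f i) z)"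
  using assms by (induction I rule: infinite_finite_induct) (auto simp: rat_eval_add)

lemma finite_rat_poles: "finite {z. \<not> rat_analytic_at r z}"
  unfolding rat_analytic_at_def by (simp add: poly_roots_finite)

lemma tendsto_rat_eval:
  assumes "rat_analytic_at r z" "(g \<longlongrightarrow> z) F"
  shows "((\<lambda>k. rat_eval r (g k)) \<longlongrightarrow> rat_eval r z) F"
  using assms unfolding rat_analytic_at_def rat_eval_def by (auto intro!: tendsto_intros)

section \<open>Evaluation of rational matrix functions\<close>

lemma eval_mat_dim [simp]:
  "dim_row (eval_mat S z) = dim_row S" "dim_col (eval_mat S z) = dim_col S"
  "eval_mat S z \<in> carrier_mat n m \<longleftrightarrow> S \<in> carrier_mat n m"
  by (auto simp: eval_mat_def)

lemma const_mat_dim [simp]: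
  "dim_row (const_mat M) = dim_row M" "dim_col (const_mat M) = dim_col M"
  "const_mat M \<in> carrier_mat n m \<longleftrightarrow> M \<in> carrier_mat n m"
  by (auto simp: const_mat_def)

lemma eval_mat_index [simp]:
  "i < dim_row S \<Longrightarrow> j < dim_col S \<Longrightarrow> eval_mat S z $$ (i, j) = rat_eval (S $$ (i, j)) z"
  by (simp add: eval_mat_def)

lemma const_mat_index [simp]:
  "i < dim_row M \<Longrightarrow> j < dim_col M \<Longrightarrow> const_mat M $$ (i, j) = rat_const (M $$ (i, j))"
  by (simp add: const_mat_def)

lemma eval_const_mat [simp]: "analytic_mat_at (const_mat M) z" "eval_mat (const_mat M) z = M"
  by (auto simp: analytic_mat_at_def intro!: eq_matI)

lemma eval_one_mat [simp]: "analytic_mat_at (1\<^sub>m n) z" "eval_mat (1\<^sub>m n) z = 1\<^sub>m n"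
  by (auto simp: analytic_mat_at_def intro!: eq_matI)

lemma eval_add_mat:
  assumes "analytic_mat_at A z" "analytic_mat_at B z"
    and "dim_row A = dim_row B" "dim_col A = dim_col B"
  shows "analytic_mat_at (A + B) z" "eval_mat (A + B) z = eval_mat A z + eval_mat B z"
  using assms by (auto simp: analytic_mat_at_def rat_eval_add intro!: eq_matI)

lemma eval_minus_mat:
  assumes "analytic_mat_at A z" "analytic_mat_at B z"
    and "dim_row A = dim_row B" "dim_col A = dim_col B"
  shows "analytic_mat_at (A - B) z" "eval_mat (A - B) z = eval_mat A z - eval_mat B z"
  using assms by (auto simp: analytic_mat_at_def rat_eval_diff intro!: eq_matI)

lemma eval_smult_mat:
  assumes "rat_analytic_at r z" "analytic_mat_at A z"
  shows "analytic_mat_at (r \<cdot>\<^sub>m A) z" "eval_mat (r \<cdot>\<^sub>m A) z = rat_eval r z \<cdot>\<^sub>m eval_mat A z"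
  using assms by (auto simp: analytic_mat_at_def rat_eval_mult intro!: eq_matI)

lemma eval_mult_mat:
  assumes "analytic_mat_at A z" "analytic_mat_at B z" and "dim_col A = dim_row B"
  shows "analytic_mat_at (A * B) z" "eval_mat (A * B) z = eval_mat A z * eval_mat B z"
proof -
  have *: "rat_analytic_at ((A * B) $$ (i, j)) z \<and>
      rat_eval ((A * B) $$ (i, j)) z = (eval_mat A z * eval_mat B z) $$ (i, j)"
    if ij: "i < dim_row A" "j < dim_col B" for i j
  proof -
    have an: "rat_analytic_at (A $$ (i, k) * B $$ (k, j)) z \<and>
        rat_eval (A $$ (i, k) * B $$ (k, j)) z = rat_eval (A $$ (i, k)) z * rat_eval (B $$ (k, j)) z"
      if "k \<in> {0..<dim_row B}" for k
      using assms ij that by (auto simp: analytic_mat_at_def rat_eval_mult)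
    show ?thesis using ij assms(3) an rat_eval_sum[of "{0..<dim_row B}" "\<lambda>k. A $$ (i, k) * B $$ (k, j)" z]
      by (simp add: scalar_prod_def)
  qed
  then show "analytic_mat_at (A * B) z" by (simp add: analytic_mat_at_def)
  show "eval_mat (A * B) z = eval_mat A z * eval_mat B z"
    using * by (intro eq_matI) (simp_all del: index_mult_mat(1))
qed

lemma finite_mat_poles: "finite {z. \<not> analytic_mat_at S z}"
proof -
  have "{z. \<not> analytic_mat_at S z} =
      (\<Union>i\<in>{..<dim_row S}. \<Union>j\<in>{..<dim_col S}. {z. \<not> rat_analytic_at (S $$ (i, j)) z})"
    by (auto simp: analytic_mat_at_def)
  then show ?thesis by (simp add: finite_rat_poles)
qed

lemma eventually_at_infinity_not_in_finite:
  fixes F :: "complex set"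
  assumes "finite F" shows "\<forall>\<^sub>F z in at_infinity. z \<notin> F"
proof -
  have "norm z \<le> Max (insert 0 (norm ` F))" if "z \<in> F" for z
    using assms that by (intro Max_ge) auto
  then show ?thesis
    by (force simp: eventually_at_infinity intro!: exI[of _ "Max (insert 0 (norm ` F)) + 1"])
qed

lemma eventually_analytic_mat: "\<forall>\<^sub>F z in at_infinity. analytic_mat_at S z"
  using eventually_at_infinity_not_in_finite[OF finite_mat_poles[of S]] by simp

section \<open>Matrix algebra with dimension side conditions\<close>

text \<open>These versions of the ring laws have side conditions on dimensions rather than membership in a
carrier with free indices; as conditional rewrite rules their premises are then decided by
simplification.\<close>

lemma mat_mult_assoc:
  fixes A B C :: "'a :: semiring_0 mat"
  assumes "dim_col A = dim_row B" "dim_col B = dim_row C"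
  shows "(A * B) * C = A * (B * C)"
  by (rule assoc_mult_mat[of _ "dim_row A" "dim_col A" _ "dim_col B" _ "dim_col C"])
    (use assms in auto)

lemma mat_add_mult:
  fixes A B C :: "'a :: semiring_0 mat"
  assumes "dim_row A = dim_row B" "dim_col A = dim_col B" "dim_col B = dim_row C"
  shows "(A + B) * C = A * C + B * C"
  by (rule add_mult_distrib_mat[of _ "dim_row A" "dim_col A" _ _ "dim_col C"]) (use assms in auto)

lemma mat_mult_add:
  fixes A B C :: "'a :: semiring_0 mat"
  assumes "dim_row B = dim_row C" "dim_col B = dim_col C" "dim_col A = dim_row C"
  shows "A * (B + C) = A * B + A * C"
  by (rule mult_add_distrib_mat[of _ "dim_row A" "dim_col A" _ "dim_col C"]) (use assms in auto)

lemma mat_minus_mult: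
  fixes A B C :: "'a :: ring mat"
  assumes "dim_row A = dim_row B" "dim_col A = dim_col B" "dim_col B = dim_row C"
  shows "(A - B) * C = A * C - B * C"
  by (rule minus_mult_distrib_mat[of _ "dim_row A" "dim_col A" _ _ "dim_col C"]) (use assms in auto)

lemma mat_mult_minus:
  fixes A B C :: "'a :: ring mat"
  assumes "dim_row B = dim_row C" "dim_col B = dim_col C" "dim_col A = dim_row C"
  shows "A * (B - C) = A * B - A * C"
  by (rule mult_minus_distrib_mat[of _ "dim_row A" "dim_col A" _ "dim_col C"]) (use assms in auto)

lemma mat_smult_mult:
  fixes A B :: "'a :: comm_semiring_0 mat"
  assumes "dim_col A = dim_row B"
  shows "(k \<cdot>\<^sub>m A) * B = k \<cdot>\<^sub>m (A * B)" "A * (k \<cdot>\<^sub>m B) = k \<cdot>\<^sub>m (A * B)"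
  using assms by (auto intro!: eq_matI)

lemma mat_smult_add:
  fixes A B :: "'a :: comm_ring_1 mat"
  assumes "dim_row A = dim_row B" "dim_col A = dim_col B"
  shows "k \<cdot>\<^sub>m (A + B) = k \<cdot>\<^sub>m A + k \<cdot>\<^sub>m B" "k \<cdot>\<^sub>m (A - B) = k \<cdot>\<^sub>m A - k \<cdot>\<^sub>m B"
  using assms by (auto intro!: eq_matI simp: algebra_simps)

lemma mat_smult_smult: "k \<cdot>\<^sub>m (l \<cdot>\<^sub>m (A :: 'a :: comm_ring_1 mat)) = (k * l) \<cdot>\<^sub>m A"
  by (auto intro!: eq_matI simp: algebra_simps)

lemma mat_smult_uminus: "k \<cdot>\<^sub>m (- (A :: 'a :: comm_ring_1 mat)) = - (k \<cdot>\<^sub>m A)"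
  by (auto intro!: eq_matI)

lemma mat_one_smult [simp]: "1 \<cdot>\<^sub>m (A :: 'a :: comm_ring_1 mat) = A"
  by (auto intro!: eq_matI)

lemmas mat_ring = mat_mult_assoc mat_add_mult mat_mult_add mat_minus_mult mat_mult_minus
  mat_smult_mult mat_smult_add mat_smult_smult mat_smult_uminus

lemma mat_left_inverse_cancel:
  fixes M N :: "'a :: comm_ring_1 mat"
  assumes "M * N = 1\<^sub>m n" "M \<in> carrier_mat n n" "N \<in> carrier_mat n n" "dim_row Y = n"
  shows "M * (N * Y) = Y"
  using assms by (simp flip: mat_mult_assoc)

lemma mat_add_left_cancel:
  fixes K :: "complex mat"
  assumes "K + G = K + H" "dim_row G = dim_row K" "dim_col G = dim_col K"
    "dim_row H = dim_row K" "dim_col H = dim_col K"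
  shows "G = H"
proof (rule eq_matI)
  fix i j assume "i < dim_row H" "j < dim_col H"
  then show "G $$ (i, j) = H $$ (i, j)"
    using arg_cong[OF assms(1), of "\<lambda>M. M $$ (i, j)"] assms(2-) by simp
qed (use assms in auto)

lemma mat_mult_vec_assoc:
  fixes A B :: "'a :: semiring_0 mat"
  assumes "dim_col A = dim_row B" "dim_col B = dim_vec v"
  shows "(A * B) *\<^sub>v v = A *\<^sub>v (B *\<^sub>v v)"
  by (rule assoc_mult_mat_vec[of _ "dim_row A" "dim_col A" _ "dim_col B"]) (use assms in auto)

lemma mat_add_vec:
  fixes A B :: "'a :: ring mat"
  assumes "dim_row A = dim_row B" "dim_col A = dim_col B" "dim_col B = dim_vec v"
  shows "(A + B) *\<^sub>v v = A *\<^sub>v v + B *\<^sub>v v" "(A - B) *\<^sub>v v = A *\<^sub>v v - B *\<^sub>v v"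
  using assms by (auto intro!: eq_vecI simp: scalar_prod_def sum.distrib sum_subtractf algebra_simps)

lemma mat_mult_vec_add:
  fixes A :: "'a :: ring mat"
  assumes "dim_vec x = dim_vec y" "dim_col A = dim_vec y"
  shows "A *\<^sub>v (x + y) = A *\<^sub>v x + A *\<^sub>v y" "A *\<^sub>v (x - y) = A *\<^sub>v x - A *\<^sub>v y"
  using assms by (auto intro!: eq_vecI simp: scalar_prod_def sum.distrib sum_subtractf algebra_simps)

lemma mat_smult_vec:
  fixes A :: "'a :: comm_ring_1 mat"
  assumes "dim_col A = dim_vec v"
  shows "(k \<cdot>\<^sub>m A) *\<^sub>v v = k \<cdot>\<^sub>v (A *\<^sub>v v)" "A *\<^sub>v (k \<cdot>\<^sub>v v) = k \<cdot>\<^sub>v (A *\<^sub>v v)"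
  using assms by (auto intro!: eq_vecI simp: scalar_prod_def sum_distrib_left ac_simps)

lemma mat_one_dim_vec:
  fixes N :: "'a :: comm_ring_1 mat"
  assumes "N \<in> carrier_mat 1 1" "b \<in> carrier_vec 1"
  shows "(N *\<^sub>v b) $ 0 = N $$ (0, 0) * b $ 0"
  using assms by (simp add: scalar_prod_def)

lemma mat_zero_vec [simp]: "dim_col A = n \<Longrightarrow> (A :: 'a :: semiring_0 mat) *\<^sub>v 0\<^sub>v n = 0\<^sub>v (dim_row A)"
  by (auto intro!: eq_vecI)

lemma zero_mat_vec [simp]: "dim_vec v = n \<Longrightarrow> 0\<^sub>m m n *\<^sub>v (v :: 'a :: semiring_0 vec) = 0\<^sub>v m"
  by (auto intro!: eq_vecI simp: scalar_prod_def)

lemma mat_adjoint_dim [simp]: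
  "dim_row (mat_adjoint A) = dim_col A" "dim_col (mat_adjoint A) = dim_row A"
  by (simp_all add: mat_adjoint_def)

lemma mat_adjoint_carrier [simp]: "mat_adjoint A \<in> carrier_mat n m \<longleftrightarrow> A \<in> carrier_mat m n"
  unfolding carrier_mat_def by auto

lemma mat_adjoint_index [simp]:
  "i < dim_col A \<Longrightarrow> j < dim_row A \<Longrightarrow> mat_adjoint A $$ (i, j) = conjugate (A $$ (j, i))"
  by (simp add: mat_adjoint_def mat_of_rows_def)

lemma mat_adjoint_adjoint [simp]: "mat_adjoint (mat_adjoint A) = A"
  by (auto intro!: eq_matI)

lemma mat_adjoint_mult:
  fixes A B :: "complex mat"
  assumes "dim_col A = dim_row B"
  shows "mat_adjoint (A * B) = mat_adjoint B * mat_adjoint A"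
  using assms by (auto intro!: eq_matI sum.cong simp: scalar_prod_def)

lemma mat_adjoint_add:
  fixes A B :: "complex mat"
  assumes "dim_row A = dim_row B" "dim_col A = dim_col B"
  shows "mat_adjoint (A + B) = mat_adjoint A + mat_adjoint B"
    "mat_adjoint (A - B) = mat_adjoint A - mat_adjoint B"
  using assms by (auto intro!: eq_matI)

lemma mat_adjoint_smult [simp]:
  "mat_adjoint (k \<cdot>\<^sub>m A) = cnj k \<cdot>\<^sub>m mat_adjoint (A :: complex mat)"
  by (auto intro!: eq_matI)

lemma mat_adjoint_uminus [simp]: "mat_adjoint (- A) = - mat_adjoint (A :: complex mat)"
  by (auto intro!: eq_matI)

lemma mat_adjoint_one [simp]: "mat_adjoint (1\<^sub>m n) = (1\<^sub>m n :: complex mat)"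
  by (auto intro!: eq_matI)

lemma mat_adjoint_zero [simp]: "mat_adjoint (0\<^sub>m n m) = (0\<^sub>m m n :: complex mat)"
  by (auto intro!: eq_matI)

lemma mat_adjoint_four_block:
  fixes A :: "complex mat"
  assumes "A \<in> carrier_mat n n'" "B \<in> carrier_mat n m'" "C \<in> carrier_mat m n'" "D \<in> carrier_mat m m'"
  shows "mat_adjoint (four_block_mat A B C D) =
    four_block_mat (mat_adjoint A) (mat_adjoint C) (mat_adjoint B) (mat_adjoint D)"
  using assms by (auto intro!: eq_matI simp: four_block_mat_def Let_def)

lemma mat_adjoint_scalar_prod:
  fixes A :: "complex mat"
  assumes "dim_col A = dim_vec x" "dim_row A = dim_vec y"
  shows "(A *\<^sub>v x) \<bullet>c y = x \<bullet>c (mat_adjoint A *\<^sub>v y)"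
proof -
  have "(A *\<^sub>v x) \<bullet>c y = (\<Sum>i<dim_vec y. \<Sum>j<dim_vec x. A $$ (i, j) * x $ j * cnj (y $ i))"
    using assms by (simp add: scalar_prod_def sum_distrib_right sum_distrib_left atLeast0LessThan)
  also have "\<dots> = (\<Sum>j<dim_vec x. \<Sum>i<dim_vec y. A $$ (i, j) * x $ j * cnj (y $ i))"
    by (rule sum.swap)
  also have "\<dots> = x \<bullet>c (mat_adjoint A *\<^sub>v y)"
    using assms by (simp add: scalar_prod_def sum_distrib_right sum_distrib_left ac_simps atLeast0LessThan)
  finally show ?thesis .
qed

section \<open>Entrywise limits\<close>

text \<open>The dimensions are required to be constant along the whole family, not only eventually, so that
sums and products only ask the limits to have matching dimensions.\<close>

definition mat_tendsto :: "('b \<Rightarrow> complex mat) \<Rightarrow> complex mat \<Rightarrow> 'b filter \<Rightarrow> bool" where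
  "mat_tendsto f L F \<longleftrightarrow> (\<forall>z. dim_row (f z) = dim_row L \<and> dim_col (f z) = dim_col L) \<and>
     (\<forall>i < dim_row L. \<forall>j < dim_col L. ((\<lambda>z. f z $$ (i, j)) \<longlongrightarrow> L $$ (i, j)) F)"

lemma value_at_infinity_iff: "value_at_infinity S D \<longleftrightarrow> mat_tendsto (eval_mat S) D at_infinity"
  by (auto simp: value_at_infinity_def mat_tendsto_def)

lemma mat_tendsto_const: "mat_tendsto (\<lambda>z. L) L F"
  by (simp add: mat_tendsto_def)

lemma mat_tendsto_add:
  assumes "mat_tendsto f L F" "mat_tendsto g M F" "dim_row L = dim_row M" "dim_col L = dim_col M"
  shows "mat_tendsto (\<lambda>z. f z + g z) (L + M) F" "mat_tendsto (\<lambda>z. f z - g z) (L - M) F"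
  using assms by (auto simp: mat_tendsto_def intro!: tendsto_intros)

lemma mat_tendsto_mult:
  assumes "mat_tendsto f L F" "mat_tendsto g M F" "dim_col L = dim_row M"
  shows "mat_tendsto (\<lambda>z. f z * g z) (L * M) F"
  using assms by (auto simp: mat_tendsto_def scalar_prod_def intro!: tendsto_intros)

lemma mat_tendsto_adjoint:
  assumes "mat_tendsto f L F"
  shows "mat_tendsto (\<lambda>z. mat_adjoint (f z)) (mat_adjoint L) F"
  using assms by (auto simp: mat_tendsto_def intro!: tendsto_intros)

lemma mat_tendsto_cong:
  assumes "mat_tendsto f L F" "\<forall>\<^sub>F z in F. f z = g z"
    and "\<And>z. dim_row (g z) = dim_row L" "\<And>z. dim_col (g z) = dim_col L"
  shows "mat_tendsto g L F"
  unfolding mat_tendsto_def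
proof (intro conjI allI impI)
  fix i j assume "i < dim_row L" "j < dim_col L"
  then have "((\<lambda>z. f z $$ (i, j)) \<longlongrightarrow> L $$ (i, j)) F" using assms(1) by (simp add: mat_tendsto_def)
  then show "((\<lambda>z. g z $$ (i, j)) \<longlongrightarrow> L $$ (i, j)) F"
    by (rule Lim_transform_eventually) (use assms(2) in eventually_elim, simp)
qed (use assms in auto)

lemma mat_tendsto_unique:
  assumes "mat_tendsto f L F" "mat_tendsto f M F" "F \<noteq> bot"
  shows "L = M"
proof (rule eq_matI)
  have d: "dim_row L = dim_row M" "dim_col L = dim_col M" using assms by (auto simp: mat_tendsto_def)
  then show "dim_row L = dim_row M" "dim_col L = dim_col M" by auto
  fix i j assume "i < dim_row M" "j < dim_col M"
  then show "L $$ (i, j) = M $$ (i, j)"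
    using assms(1,2) d
    by (intro tendsto_unique[OF assms(3), of "\<lambda>z. f z $$ (i, j)"]) (auto simp: mat_tendsto_def)
qed

lemma mat_tendsto_eval_mat:
  assumes "analytic_mat_at S z" "(g \<longlongrightarrow> z) F"
  shows "mat_tendsto (\<lambda>k. eval_mat S (g k)) (eval_mat S z) F"
  using assms by (auto simp: mat_tendsto_def analytic_mat_at_def intro!: tendsto_rat_eval)

lemma complex_at_infinity_neq_bot: "(at_infinity :: complex filter) \<noteq> bot"
proof
  assume "(at_infinity :: complex filter) = bot"
  then obtain b where "\<And>z :: complex. \<not> b \<le> norm z"
    by (auto simp: trivial_limit_def eventually_at_infinity)
  from this[of "of_real b"] show False by auto
qed

section \<open>The resolvent\<close>

lemma mat_inv_mult:
  fixes M :: "'a :: field mat"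
  assumes M: "M \<in> carrier_mat n n" and "det M \<noteq> 0"
  shows "mat_inv M \<in> carrier_mat n n" "M * mat_inv M = 1\<^sub>m n" "mat_inv M * M = 1\<^sub>m n"
proof -
  have "M \<in> Units (ring_mat TYPE('a) n ())" using det_non_zero_imp_unit[OF M assms(2)] .
  then obtain B where B: "mat_inverse M = Some B" using mat_inverse(1)[OF M, of "()"] by (cases "mat_inverse M") auto
  from mat_inverse(2)[OF M this] show "mat_inv M \<in> carrier_mat n n" "M * mat_inv M = 1\<^sub>m n"
    "mat_inv M * M = 1\<^sub>m n" by (auto simp: mat_inv_def B)
qed

lemma const_mat_hom:
  "dim_col A = dim_row B \<Longrightarrow> const_mat (A * B) = const_mat A * const_mat B"
  "dim_row A = dim_row B \<Longrightarrow> dim_col A = dim_col B \<Longrightarrow> const_mat (A + B) = const_mat A + const_mat B"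
  "dim_row A = dim_row B \<Longrightarrow> dim_col A = dim_col B \<Longrightarrow> const_mat (A - B) = const_mat A - const_mat B"
  "const_mat (k \<cdot>\<^sub>m A) = rat_const k \<cdot>\<^sub>m const_mat A" "const_mat (- A) = - const_mat A"
  "const_mat (1\<^sub>m n) = 1\<^sub>m n" "const_mat (0\<^sub>m n m) = 0\<^sub>m n m"
  by (auto intro!: eq_matI simp: scalar_prod_def rat_const_sum)

text \<open>Up to the embedding of polynomials into their field of fractions, the determinant is the
characteristic polynomial, which is monic.\<close>

lemma det_rat_var_minus_const:
  assumes A: "A \<in> carrier_mat n n"
  shows "det (rat_var \<cdot>\<^sub>m 1\<^sub>m n - const_mat A) \<noteq> 0"
proof -
  interpret h: comm_ring_hom "to_fract :: complex poly \<Rightarrow> ratfun" by unfold_locales auto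
  have neg: "to_fract [:- a:] = - rat_const a" for a
    using rat_const_hom(5)[of a] by (simp only: rat_const_def)
  have diag: "to_fract (pCons (- a) 1) = to_fract [:0, 1:] - rat_const a" for a
  proof -
    have "pCons (- a) 1 = [:0, 1:] - [:a:]" by (simp add: one_pCons)
    then show ?thesis by (simp only: to_fract_diff rat_const_def)
  qed
  have "rat_var \<cdot>\<^sub>m 1\<^sub>m n - const_mat A = map_mat to_fract (char_poly_matrix A)"
    using A by (intro eq_matI) (auto simp: char_poly_matrix_def rat_var_def neg diag)
  then have "det (rat_var \<cdot>\<^sub>m 1\<^sub>m n - const_mat A) = to_fract (char_poly A)"
    by (simp add: h.hom_det char_poly_def)
  moreover have "char_poly A \<noteq> 0" using degree_monic_char_poly[OF A] by auto
  ultimately show ?thesis by simp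
qed

lemma resolvent:
  assumes "A \<in> carrier_mat n n"
  shows "resolvent n A \<in> carrier_mat n n"
    and "(rat_var \<cdot>\<^sub>m 1\<^sub>m n - const_mat A) * resolvent n A = 1\<^sub>m n"
    and "resolvent n A * (rat_var \<cdot>\<^sub>m 1\<^sub>m n - const_mat A) = 1\<^sub>m n"
proof -
  have "rat_var \<cdot>\<^sub>m 1\<^sub>m n - const_mat A \<in> carrier_mat n n"
    using assms by (simp add: minus_carrier_mat)
  from mat_inv_mult[OF this det_rat_var_minus_const[OF assms]]
  show "resolvent n A \<in> carrier_mat n n"
    "(rat_var \<cdot>\<^sub>m 1\<^sub>m n - const_mat A) * resolvent n A = 1\<^sub>m n"
    "resolvent n A * (rat_var \<cdot>\<^sub>m 1\<^sub>m n - const_mat A) = 1\<^sub>m n"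
    unfolding resolvent_def by blast+
qed

lemma eval_resolvent:
  assumes A: "A \<in> carrier_mat n n" and z: "analytic_mat_at (resolvent n A) z"
  shows "(z \<cdot>\<^sub>m 1\<^sub>m n - A) * eval_mat (resolvent n A) z = 1\<^sub>m n"
proof -
  let ?P = "rat_var \<cdot>\<^sub>m 1\<^sub>m n - const_mat A"
  have P: "analytic_mat_at ?P z" "eval_mat ?P z = z \<cdot>\<^sub>m 1\<^sub>m n - A"
    using A eval_minus_mat[of "rat_var \<cdot>\<^sub>m 1\<^sub>m n" z "const_mat A"]
      eval_smult_mat[of rat_var z "1\<^sub>m n"] by auto
  have "eval_mat (?P * resolvent n A) z = eval_mat ?P z * eval_mat (resolvent n A) z"
    using A resolvent(1)[OF A] P z by (intro eval_mult_mat) auto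
  then show ?thesis using P resolvent(2)[OF A] by simp
qed

lemma eval_state_space:
  assumes "A \<in> carrier_mat n n" "B \<in> carrier_mat n p" "C \<in> carrier_mat p n" "D \<in> carrier_mat p p"
    and "analytic_mat_at (resolvent n A) z"
  shows "eval_mat (const_mat D + const_mat C * resolvent n A * const_mat B) z =
    D + C * eval_mat (resolvent n A) z * B"
  using assms resolvent(1)[OF assms(1)] by (simp add: eval_add_mat eval_mult_mat)

text \<open>Let \<open>s\<close> be the sum of the absolute values in one column of the resolvent and \<open>a\<close> the sum over all
entries of \<open>A\<close>. From \<open>z R = I + A R\<close> one gets \<open>\<bar>z\<bar> s \<le> 1 + a s\<close>, that is \<open>s \<le> 1 / (\<bar>z\<bar> - a)\<close>.\<close>

lemma resolvent_tendsto_0: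
  assumes A: "A \<in> carrier_mat n n"
  shows "mat_tendsto (eval_mat (resolvent n A)) (0\<^sub>m n n) at_infinity"
proof -
  define R where "R = eval_mat (resolvent n A)"
  have Rc: "R z \<in> carrier_mat n n" for z using resolvent(1)[OF A] by (simp add: R_def)
  define a where "a = (\<Sum>i<n. \<Sum>k<n. norm (A $$ (i, k)))"
  have bound: "norm (R z $$ (i, j)) \<le> inverse (norm z - a)"
    if z: "analytic_mat_at (resolvent n A) z" "norm z > a" and ij: "i < n" "j < n" for z i j
  proof -
    define s where "s = (\<Sum>i<n. norm (R z $$ (i, j)))"
    have s_ge: "norm (R z $$ (k, j)) \<le> s" if "k < n" for k
      unfolding s_def using that by (intro member_le_sum) auto
    have ent: "z * R z $$ (i, j) = (if i = j then 1 else 0) + (\<Sum>k<n. A $$ (i, k) * R z $$ (k, j))"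
      if i: "i < n" for i
    proof -
      have "((z \<cdot>\<^sub>m 1\<^sub>m n - A) * R z) $$ (i, j) = 1\<^sub>m n $$ (i, j)"
        using eval_resolvent[OF A z(1)] by (simp add: R_def)
      moreover have "(z \<cdot>\<^sub>m 1\<^sub>m n - A) * R z = z \<cdot>\<^sub>m R z - A * R z"
        using A Rc[of z] by (simp add: mat_ring)
      ultimately show ?thesis using A Rc[of z] i ij
        by (simp add: scalar_prod_def atLeast0LessThan algebra_simps)
    qed
    have "norm z * s = (\<Sum>i<n. norm (z * R z $$ (i, j)))"
      by (simp add: s_def sum_distrib_left norm_mult)
    also have "\<dots> \<le> (\<Sum>i<n. (if i = j then 1 else 0) + (\<Sum>k<n. norm (A $$ (i, k)) * s))"
    proof (rule sum_mono)
      fix i assume i: "i \<in> {..<n}"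
      have "norm (z * R z $$ (i, j)) \<le> norm (if i = j then 1 else 0 :: complex) +
          norm (\<Sum>k<n. A $$ (i, k) * R z $$ (k, j))"
        using ent[of i] i by (simp only: lessThan_iff norm_triangle_ineq)
      also have "norm (\<Sum>k<n. A $$ (i, k) * R z $$ (k, j)) \<le> (\<Sum>k<n. norm (A $$ (i, k)) * s)"
        by (rule sum_norm_le) (auto simp: norm_mult s_ge intro!: mult_left_mono)
      finally show "norm (z * R z $$ (i, j)) \<le> (if i = j then 1 else 0) + (\<Sum>k<n. norm (A $$ (i, k)) * s)"
        by (simp split: if_splits)
    qed
    also have "\<dots> = 1 + a * s" using ij by (simp add: sum.distrib a_def sum_distrib_right)
    finally have "s \<le> inverse (norm z - a)" using z(2) by (simp add: field_simps)
    then show ?thesis using s_ge[OF ij(1)] by simp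
  qed
  have lim: "((\<lambda>z :: complex. inverse (norm z - a)) \<longlongrightarrow> 0) at_infinity"
    using filterlim_tendsto_add_at_top[OF tendsto_const[of "-a"] filterlim_norm_at_top]
    by (intro tendsto_inverse_0_at_top) simp
  have "((\<lambda>z. R z $$ (i, j)) \<longlongrightarrow> 0) at_infinity" if ij: "i < n" "j < n" for i j
  proof (rule tendsto_0_le[OF lim, of _ 1])
    have "\<forall>\<^sub>F z :: complex in at_infinity. norm z > a"
      using filterlim_norm_at_top[unfolded filterlim_at_top_dense] by blast
    with eventually_analytic_mat[of "resolvent n A"]
    show "\<forall>\<^sub>F z in at_infinity. norm (R z $$ (i, j)) \<le> norm (inverse (norm z - a)) * 1"
      by eventually_elim (use bound ij in force)
  qed
  then show ?thesis using Rc unfolding mat_tendsto_def R_def[symmetric] by auto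
qed

section \<open>Eigenvectors in unobservable subspaces\<close>

text \<open>Padding with zero rows gives a square matrix whose transpose kills a unit vector, so its determinant
vanishes.\<close>

lemma wide_matrix_kernel:
  fixes Q :: "complex mat"
  assumes Q: "Q \<in> carrier_mat m n" and mn: "m < n"
  obtains x where "x \<in> carrier_vec n" "x \<noteq> 0\<^sub>v n" "Q *\<^sub>v x = 0\<^sub>v m"
proof -
  define M where "M = mat n n (\<lambda>(i, j). if i < m then Q $$ (i, j) else 0)"
  have M: "M \<in> carrier_mat n n" by (simp add: M_def)
  have "transpose_mat M *\<^sub>v unit_vec n (n - 1) = 0\<^sub>v n"
    using mn by (intro eq_vecI) (auto simp: M_def)
  moreover have "unit_vec n (n - 1) \<noteq> (0\<^sub>v n :: complex vec)"
    using mn by (intro unit_vec_nonzero) auto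
  ultimately have "det (transpose_mat M) = 0"
    using M by (subst det_0_iff_vec_prod_zero[of _ n]) (auto intro!: exI[of _ "unit_vec n (n - 1)"])
  then have "det M = 0" using det_transpose[OF M] by simp
  then obtain x where x: "x \<in> carrier_vec n" "x \<noteq> 0\<^sub>v n" "M *\<^sub>v x = 0\<^sub>v n"
    using det_0_iff_vec_prod_zero[OF M] by auto
  have "Q *\<^sub>v x = 0\<^sub>v m"
  proof (intro eq_vecI)
    fix i assume i: "i < dim_vec (0\<^sub>v m :: complex vec)"
    then have "(M *\<^sub>v x) $ i = (Q *\<^sub>v x) $ i" using Q x(1) mn
      by (simp add: M_def scalar_prod_def)
    then show "(Q *\<^sub>v x) $ i = 0\<^sub>v m $ i" using x(3) i mn by simp
  qed (use Q in simp)
  then show thesis using that x by blast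
qed

text \<open>The \<open>n + 1\<close> vectors \<open>v, A v, \<dots>, A\<^sup>n v\<close> are dependent, so some nonzero polynomial of degree at most \<open>n\<close>
in \<open>A\<close> kills \<open>v\<close>. Take \<open>q\<close> of least degree and split off a root, \<open>q = (t - \<mu>) r\<close>. Then \<open>x = r(A) v\<close> is
nonzero by minimality and an eigenvector for \<open>\<mu>\<close>; since \<open>r\<close> has degree below \<open>n\<close>, \<open>C x\<close> involves only
the products \<open>C A\<^sup>k v\<close> with \<open>k < n\<close>, which vanish.\<close>

lemma unobservable_eigenvector:
  fixes A C :: "complex mat"
  assumes A: "A \<in> carrier_mat n n" and C: "C \<in> carrier_mat p n"
    and v: "v \<in> carrier_vec n" "v \<noteq> 0\<^sub>v n"
    and unobs: "\<And>k. k < n \<Longrightarrow> C *\<^sub>v (A ^\<^sub>m k *\<^sub>v v) = 0\<^sub>v p"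
  obtains x \<mu> where "x \<in> carrier_vec n" "x \<noteq> 0\<^sub>v n" "A *\<^sub>v x = \<mu> \<cdot>\<^sub>v x" "C *\<^sub>v x = 0\<^sub>v p"
proof -
  define w where "w k = A ^\<^sub>m k *\<^sub>v v" for k
  have Ak: "A ^\<^sub>m k \<in> carrier_mat n n" for k using A by (induction k) auto
  have pow_Suc: "A ^\<^sub>m Suc k = A * A ^\<^sub>m k" for k
  proof (induction k)
    case (Suc k)
    have "A ^\<^sub>m Suc (Suc k) = A ^\<^sub>m Suc k * A" by simp
    also have "\<dots> = A * A ^\<^sub>m k * A" by (simp only: Suc.IH)
    also have "\<dots> = A * (A ^\<^sub>m k * A)" using A Ak[of k] by (simp add: mat_ring)
    finally show ?case by simp
  qed (use A in simp)
  have w: "w k \<in> carrier_vec n" for k using Ak[of k] v by (simp add: w_def)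
  have w_Suc: "w (Suc k) = A *\<^sub>v w k" for k
    unfolding w_def pow_Suc using A Ak[of k] v by (intro mat_mult_vec_assoc) auto
  \<comment> \<open>\<open>P q\<close> is \<open>q(A) v\<close>.\<close>
  define P where "P q = vec n (\<lambda>i. \<Sum>k\<le>degree q. coeff q k * w k $ i)" for q
  have P_carrier: "P q \<in> carrier_vec n" for q by (simp add: P_def)
  have P_eq: "P q $ i = (\<Sum>k\<le>N. coeff q k * w k $ i)" if "degree q \<le> N" "i < n" for q N i
  proof -
    have "(\<Sum>k\<le>degree q. coeff q k * w k $ i) = (\<Sum>k\<le>N. coeff q k * w k $ i)"
      by (rule sum.mono_neutral_left) (use that in \<open>auto simp: coeff_eq_0\<close>)
    then show ?thesis using that by (simp add: P_def)
  qed
  have apply_P: "(M *\<^sub>v P q) $ i = (\<Sum>k\<le>N. coeff q k * (M *\<^sub>v w k) $ i)"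
    if M: "M \<in> carrier_mat m n" "i < m" "degree q \<le> N" for M m q i N
  proof -
    have "(M *\<^sub>v P q) $ i = (\<Sum>j<n. M $$ (i, j) * (\<Sum>k\<le>N. coeff q k * w k $ j))"
      using M P_carrier[of q] P_eq[OF M(3)] by (simp add: scalar_prod_def atLeast0LessThan)
    also have "\<dots> = (\<Sum>j<n. \<Sum>k\<le>N. coeff q k * (M $$ (i, j) * w k $ j))"
      by (simp add: sum_distrib_left ac_simps)
    also have "\<dots> = (\<Sum>k\<le>N. \<Sum>j<n. coeff q k * (M $$ (i, j) * w k $ j))" by (rule sum.swap)
    also have "\<dots> = (\<Sum>k\<le>N. coeff q k * (M *\<^sub>v w k) $ i)"
      using M by (simp add: carrier_vecD[OF w] scalar_prod_def atLeast0LessThan sum_distrib_left)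
    finally show ?thesis .
  qed
  obtain q where q: "q \<noteq> 0" "degree q \<le> n" "P q = 0\<^sub>v n"
    and q_min: "\<And>r. r \<noteq> 0 \<Longrightarrow> P r = 0\<^sub>v n \<Longrightarrow> degree q \<le> degree r"
  proof -
    define K where "K = mat n (Suc n) (\<lambda>(i, k). w k $ i)"
    have K: "K \<in> carrier_mat n (Suc n)" by (simp add: K_def)
    obtain y where y: "y \<in> carrier_vec (Suc n)" "y \<noteq> 0\<^sub>v (Suc n)" "K *\<^sub>v y = 0\<^sub>v n"
      using wide_matrix_kernel[OF K lessI] .
    define q0 where "q0 = Poly (list_of_vec y)"
    have len: "length (list_of_vec y) = Suc n" using carrier_vecD[OF y(1)] by simp
    have co: "coeff q0 k = (if k \<le> n then y $ k else 0)" for k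
      using len by (auto simp: q0_def nth_default_def list_of_vec_index)
    have q00: "q0 \<noteq> 0"
    proof
      assume "q0 = 0"
      then have "y $ k = 0" if "k \<le> n" for k using co[of k] that by simp
      then have "y = 0\<^sub>v (Suc n)" using y(1) by (intro eq_vecI) auto
      then show False using y(2) by simp
    qed
    have deg: "degree q0 \<le> n" by (rule degree_le) (simp add: co)
    have P0: "P q0 = 0\<^sub>v n"
    proof (intro eq_vecI)
      fix i assume i: "i < dim_vec (0\<^sub>v n :: complex vec)"
      have "P q0 $ i = (\<Sum>k\<le>n. coeff q0 k * w k $ i)" using P_eq[OF deg] i by simp
      also have "\<dots> = (\<Sum>k<Suc n. K $$ (i, k) * y $ k)"
        using i by (intro sum.cong) (auto simp: co K_def)
      also have "\<dots> = (K *\<^sub>v y) $ i"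
        using i K y(1) by (simp add: scalar_prod_def atLeast0LessThan)
      finally show "P q0 $ i = 0\<^sub>v n $ i" using y(3) by simp
    qed (simp add: P_def)
    define Z where "Z q \<longleftrightarrow> q \<noteq> 0 \<and> P q = 0\<^sub>v n" for q
    have "Z q0" using q00 P0 by (simp add: Z_def)
    then obtain q where "Z q" and min: "\<And>r. Z r \<Longrightarrow> degree q \<le> degree r"
      using ex_has_least_nat[of Z q0 degree] by blast
    moreover have "degree q \<le> n" using min[OF \<open>Z q0\<close>] deg by simp
    ultimately show thesis using that[of q] by (auto simp: Z_def)
  qed
  have "degree q \<noteq> 0"
  proof
    assume "degree q = 0"
    then obtain a where a: "q = [:a:]" by (rule degree_eq_zeroE)
    then have "a \<noteq> 0" using q(1) by simp
    have "a * v $ i = 0" if "i < n" for i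
    proof -
      have "P q $ i = a * v $ i" using that v A by (simp add: P_def a w_def)
      then show ?thesis using q(3) that by simp
    qed
    then have "v = 0\<^sub>v n" using \<open>a \<noteq> 0\<close> v(1) by (intro eq_vecI) auto
    then show False using v(2) by simp
  qed
  then have "\<not> constant (poly q)" by (simp add: constant_degree)
  then obtain \<mu> where "poly q \<mu> = 0" using fundamental_theorem_of_algebra by blast
  then obtain r where r: "q = [:-\<mu>, 1:] * r" by (auto simp: poly_eq_0_iff_dvd dvd_def)
  have r0: "r \<noteq> 0" using q(1) r by auto
  have deg_q: "degree q = Suc (degree r)" using r r0 by (simp add: degree_mult_eq del: mult_pCons_left)
  have "P r \<noteq> 0\<^sub>v n" using q_min[OF r0] deg_q by auto
  moreover have "A *\<^sub>v P r = \<mu> \<cdot>\<^sub>v P r"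
  proof (intro eq_vecI)
    fix i assume "i < dim_vec (\<mu> \<cdot>\<^sub>v P r)"
    then have i: "i < n" by (simp add: P_def)
    let ?N = "degree r"
    have co: "coeff q k = coeff (pCons 0 r) k - \<mu> * coeff r k" for k
      by (simp add: r)
    have "0 = P q $ i" using q(3) i by simp
    also have "\<dots> = (\<Sum>k\<le>Suc ?N. coeff q k * w k $ i)" using P_eq[of q "Suc ?N"] deg_q i by simp
    also have "\<dots> = (\<Sum>k\<le>Suc ?N. coeff (pCons 0 r) k * w k $ i) - \<mu> * (\<Sum>k\<le>Suc ?N. coeff r k * w k $ i)"
      unfolding co by (simp only: left_diff_distrib sum_subtractf sum_distrib_left mult.assoc)
    also have "(\<Sum>k\<le>Suc ?N. coeff (pCons 0 r) k * w k $ i) = (\<Sum>k\<le>?N. coeff r k * w (Suc k) $ i)"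
      by (simp only: sum.atMost_Suc_shift coeff_pCons_0 coeff_pCons_Suc) simp
    also have "\<dots> = (A *\<^sub>v P r) $ i" unfolding w_Suc using apply_P[OF A i, of r ?N] by simp
    also have "(\<Sum>k\<le>Suc ?N. coeff r k * w k $ i) = P r $ i" using P_eq[of r "Suc ?N"] i by simp
    finally show "(A *\<^sub>v P r) $ i = (\<mu> \<cdot>\<^sub>v P r) $ i" using i by (simp add: P_def)
  qed (use A in \<open>simp add: P_def\<close>)
  moreover have "C *\<^sub>v P r = 0\<^sub>v p"
  proof (intro eq_vecI)
    fix i assume "i < dim_vec (0\<^sub>v p :: complex vec)"
    then have i: "i < p" by simp
    have "(C *\<^sub>v P r) $ i = (\<Sum>k\<le>degree r. coeff r k * (C *\<^sub>v w k) $ i)"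
      using apply_P[OF C i] by simp
    also have "\<dots> = 0"
      using unobs deg_q q(2) i by (intro sum.neutral) (auto simp: w_def)
    finally show "(C *\<^sub>v P r) $ i = 0\<^sub>v p $ i" using i by simp
  qed (use C in simp)
  ultimately show thesis using that P_carrier by blast
qed

section \<open>Markov parameters and the state dimension\<close>

text \<open>The block matrices with block rows \<open>C A\<^sup>k\<close> and block columns \<open>A\<^sup>k B\<close> for \<open>k < N\<close>, where \<open>N\<close> is the first
argument. Row \<open>a\<close> is row \<open>a mod p\<close> of block \<open>a div p\<close>, and likewise for columns.\<close>

definition obs_mat :: "nat \<Rightarrow> nat \<Rightarrow> complex mat \<Rightarrow> complex mat \<Rightarrow> complex mat" where
  "obs_mat n p A C = mat (n * p) (dim_row A) (\<lambda>(a, j). (C * A ^\<^sub>m (a div p)) $$ (a mod p, j))"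

definition ctrl_mat :: "nat \<Rightarrow> nat \<Rightarrow> complex mat \<Rightarrow> complex mat \<Rightarrow> complex mat" where
  "ctrl_mat n p A B = mat (dim_row A) (n * p) (\<lambda>(i, b). (A ^\<^sub>m (b div p) * B) $$ (i, b mod p))"

lemma obs_mat_kernel:
  assumes A: "A \<in> carrier_mat n n" and C: "C \<in> carrier_mat p n" and v: "v \<in> carrier_vec n"
    and z: "obs_mat N p A C *\<^sub>v v = 0\<^sub>v (N * p)" and k: "k < N"
  shows "C *\<^sub>v (A ^\<^sub>m k *\<^sub>v v) = 0\<^sub>v p"
proof (intro eq_vecI)
  fix i assume "i < dim_vec (0\<^sub>v p :: complex vec)"
  then have i: "i < p" by simp
  have Ak: "A ^\<^sub>m k \<in> carrier_mat n n" using A by (induction k) auto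
  have ki: "k * p + i < N * p"
  proof -
    have "k * p + i < Suc k * p" using i by simp
    also have "\<dots> \<le> N * p" using k by (intro mult_le_mono1) simp
    finally show ?thesis .
  qed
  have "(obs_mat N p A C *\<^sub>v v) $ (k * p + i) = ((C * A ^\<^sub>m k) *\<^sub>v v) $ i"
    using ki i A C Ak v by (simp add: obs_mat_def scalar_prod_def del: index_mult_mat(1))
  also have "\<dots> = (C *\<^sub>v (A ^\<^sub>m k *\<^sub>v v)) $ i"
    using C Ak v by (subst mat_mult_vec_assoc) auto
  finally show "(C *\<^sub>v (A ^\<^sub>m k *\<^sub>v v)) $ i = 0\<^sub>v p $ i" using z ki i by simp
qed (use C in simp)

lemma pow_mat_adjoint:
  fixes A :: "complex mat"
  assumes "A \<in> carrier_mat n n" shows "mat_adjoint (A ^\<^sub>m k) = mat_adjoint A ^\<^sub>m k"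
proof (induction k)
  case (Suc k)
  let ?H = "mat_adjoint A"
  have pw: "M ^\<^sub>m j \<in> carrier_mat n n" if "M \<in> carrier_mat n n" for M :: "complex mat" and j
    using that by (induction j) auto
  have comm: "M * M ^\<^sub>m j = M ^\<^sub>m j * M" if "M \<in> carrier_mat n n" for M :: "complex mat" and j
  proof (induction j)
    case (Suc j)
    have "M * M ^\<^sub>m Suc j = M * M ^\<^sub>m j * M"
      using that pw[OF that, of j] by (simp add: mat_ring)
    then show ?case by (simp add: Suc.IH)
  qed (use that in simp)
  have "mat_adjoint (A ^\<^sub>m Suc k) = ?H * ?H ^\<^sub>m k"
    using assms Suc.IH pw[OF assms, of k] by (simp add: mat_adjoint_mult)
  then show ?case using comm[of ?H k] assms by simp
qed (use assms in simp)

text \<open>The entries of the product depend only on the Markov parameters \<open>C A\<^sup>m B\<close>: it is a block Hankel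
matrix, the same for all realizations of one function.\<close>

lemma obs_ctrl_product:
  assumes A: "A \<in> carrier_mat n n" and B: "B \<in> carrier_mat n p" and C: "C \<in> carrier_mat p n"
    and i: "i < N * p" and j: "j < N * p"
  shows "(obs_mat N p A C * ctrl_mat N p A B) $$ (i, j) =
    (C * A ^\<^sub>m (i div p + j div p) * B) $$ (i mod p, j mod p)"
proof -
  have pw: "A ^\<^sub>m l \<in> carrier_mat n n" for l using A by (induction l) auto
  have pow_add: "A ^\<^sub>m (k + l) = A ^\<^sub>m k * A ^\<^sub>m l" for k l
  proof (induction l)
    case (Suc l)
    then show ?case using A pw[of k] pw[of l] by (simp add: mat_ring)
  qed (use A pw[of k] in simp)
  have p: "p > 0" using i by (cases p) auto
  let ?k = "i div p" and ?l = "j div p"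
  have "(obs_mat N p A C * ctrl_mat N p A B) $$ (i, j) =
      ((C * A ^\<^sub>m ?k) * (A ^\<^sub>m ?l * B)) $$ (i mod p, j mod p)"
    using i j p A B C pw[of ?k] pw[of ?l]
    by (simp add: obs_mat_def ctrl_mat_def scalar_prod_def del: index_mult_mat(1))
      (simp add: scalar_prod_def)
  also have "(C * A ^\<^sub>m ?k) * (A ^\<^sub>m ?l * B) = C * A ^\<^sub>m (?k + ?l) * B"
    using A B C by (simp add: mat_ring pow_add)
  finally show ?thesis .
qed

text \<open>Comparing the limits at infinity separates a constant from a remainder that vanishes there.\<close>

lemma constant_term_at_infinity_unique:
  assumes ev: "\<forall>\<^sub>F z in at_infinity. K + G z = K' + G' (z :: complex)"
    and "mat_tendsto G (0\<^sub>m p q) at_infinity" "mat_tendsto G' (0\<^sub>m p q) at_infinity"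
    and "K \<in> carrier_mat p q" "K' \<in> carrier_mat p q"
  shows "K = K' \<and> (\<forall>\<^sub>F z in at_infinity. G z = G' z)"
proof
  have G: "dim_row (G z) = p" "dim_col (G z) = q" "dim_row (G' z) = p" "dim_col (G' z) = q" for z
    using assms by (auto simp: mat_tendsto_def)
  have lims: "mat_tendsto (\<lambda>z. K + G z) K at_infinity" "mat_tendsto (\<lambda>z. K' + G' z) K' at_infinity"
    using mat_tendsto_add(1)[OF mat_tendsto_const[of K] assms(2)]
      mat_tendsto_add(1)[OF mat_tendsto_const[of K'] assms(3)] assms(4,5) by simp_all
  have "mat_tendsto (\<lambda>z. K' + G' z) K at_infinity"
    by (rule mat_tendsto_cong[OF lims(1) ev]) (use assms(4,5) G in auto)
  then show eq: "K = K'"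
    using lims(2) complex_at_infinity_neq_bot by (rule mat_tendsto_unique)
  show "\<forall>\<^sub>F z in at_infinity. G z = G' z"
    using ev
  proof eventually_elim
    case (elim z)
    show ?case by (rule mat_add_left_cancel[of K]) (use elim eq G assms(4) in auto)
  qed
qed

text \<open>The functions \<open>F\<^sub>k(z) = C A\<^sup>k (z - A)\<^sup>-\<^sup>1 B\<close> vanish at infinity and satisfy \<open>z F\<^sub>k = C A\<^sup>k B + F\<^sub>k\<^sub>+\<^sub>1\<close>. Two
realizations of one function share \<open>F\<^sub>0\<close> near infinity, so by induction they share all \<open>F\<^sub>k\<close> and all
limits \<open>C A\<^sup>k B\<close> of \<open>z F\<^sub>k\<close>.\<close>

lemma realization_markov_parameters:
  assumes "realization p S n A B C D" "realization p S m A' B' C' D'"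
  shows "C * A ^\<^sub>m k * B = C' * A' ^\<^sub>m k * B'"
proof -
  have c: "A \<in> carrier_mat n n" "B \<in> carrier_mat n p" "C \<in> carrier_mat p n" "D \<in> carrier_mat p p"
    and S: "S = const_mat D + const_mat C * resolvent n A * const_mat B"
    and c': "A' \<in> carrier_mat m m" "B' \<in> carrier_mat m p" "C' \<in> carrier_mat p m" "D' \<in> carrier_mat p p"
    and S': "S = const_mat D' + const_mat C' * resolvent m A' * const_mat B'"
    using assms by (auto simp: realization_def)
  define R R' where "R = eval_mat (resolvent n A)" and "R' = eval_mat (resolvent m A')"
  have F_lim: "mat_tendsto (\<lambda>z. C * A ^\<^sub>m k * eval_mat (resolvent n A) z * B) (0\<^sub>m p p) at_infinity"
    if "A \<in> carrier_mat n n" "B \<in> carrier_mat n p" "C \<in> carrier_mat p n" for A B C n k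
  proof -
    have "A ^\<^sub>m k \<in> carrier_mat n n" using that by (induction k) auto
    then have "mat_tendsto (\<lambda>z. C * A ^\<^sub>m k * eval_mat (resolvent n A) z * B)
        (C * A ^\<^sub>m k * 0\<^sub>m n n * B) at_infinity"
      using that resolvent_tendsto_0[OF that(1)] by (intro mat_tendsto_mult mat_tendsto_const) auto
    then show ?thesis using that \<open>A ^\<^sub>m k \<in> carrier_mat n n\<close> by simp
  qed
  have F_step: "\<forall>\<^sub>F z in at_infinity. z \<cdot>\<^sub>m (C * A ^\<^sub>m k * eval_mat (resolvent n A) z * B) =
      C * A ^\<^sub>m k * B + C * A ^\<^sub>m Suc k * eval_mat (resolvent n A) z * B"
    if "A \<in> carrier_mat n n" "B \<in> carrier_mat n p" "C \<in> carrier_mat p n" for A B C n k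
    using eventually_analytic_mat[of "resolvent n A"]
  proof eventually_elim
    case (elim z)
    let ?R = "eval_mat (resolvent n A) z" and ?P = "A ^\<^sub>m k"
    have P: "?P \<in> carrier_mat n n" using that by (induction k) auto
    have R: "?R \<in> carrier_mat n n" using resolvent(1)[OF that(1)] by simp
    have *: "(z \<cdot>\<^sub>m 1\<^sub>m n - A) * ?R = 1\<^sub>m n" using eval_resolvent[OF that(1) elim] .
    have "z \<cdot>\<^sub>m ?R = 1\<^sub>m n + A * ?R"
    proof (rule eq_matI)
      fix i j assume "i < dim_row (1\<^sub>m n + A * ?R)" "j < dim_col (1\<^sub>m n + A * ?R)"
      moreover have "(z \<cdot>\<^sub>m 1\<^sub>m n - A) * ?R = z \<cdot>\<^sub>m ?R - A * ?R"
        using R that by (simp add: mat_ring)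
      then have "(z \<cdot>\<^sub>m ?R - A * ?R) $$ (i, j) = 1\<^sub>m n $$ (i, j)" using * by simp
      ultimately show "(z \<cdot>\<^sub>m ?R) $$ (i, j) = (1\<^sub>m n + A * ?R) $$ (i, j)"
        using R that by (auto simp del: index_mult_mat(1) simp: algebra_simps)
    qed (use R that in auto)
    then have "C * ?P * (z \<cdot>\<^sub>m ?R) * B = C * ?P * (1\<^sub>m n + A * ?R) * B" by simp
    then show ?case using P R that by (simp add: mat_ring)
  qed
  have Mk: "C * A ^\<^sub>m k * B \<in> carrier_mat p p" "C' * A' ^\<^sub>m k * B' \<in> carrier_mat p p" for k
    using c c' unfolding carrier_mat_def by auto
  have F_eq: "\<forall>\<^sub>F z in at_infinity. C * A ^\<^sub>m k * R z * B = C' * A' ^\<^sub>m k * R' z * B'" for k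
  proof (induction k)
    case 0
    have "\<forall>\<^sub>F z in at_infinity. D + C * A ^\<^sub>m 0 * R z * B = D' + C' * A' ^\<^sub>m 0 * R' z * B'"
      using eventually_analytic_mat[of "resolvent n A"] eventually_analytic_mat[of "resolvent m A'"]
    proof eventually_elim
      case (elim z)
      have "eval_mat S z = D + C * R z * B"
        unfolding S R_def using eval_state_space c elim by blast
      moreover have "eval_mat S z = D' + C' * R' z * B'"
        unfolding S' R'_def using eval_state_space c' elim by blast
      ultimately show ?case using c c' by simp
    qed
    from constant_term_at_infinity_unique[OF this, of p p]
    show ?case using F_lim[OF c(1-3), of 0] F_lim[OF c'(1-3), of 0] c(4) c'(4)
      unfolding R_def R'_def by blast
  next
    case (Suc k)
    have "\<forall>\<^sub>F z in at_infinity. C * A ^\<^sub>m k * B + C * A ^\<^sub>m Suc k * R z * B =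
        C' * A' ^\<^sub>m k * B' + C' * A' ^\<^sub>m Suc k * R' z * B'"
      using Suc.IH F_step[OF c(1-3), of k] F_step[OF c'(1-3), of k]
      unfolding R_def R'_def by eventually_elim simp
    from constant_term_at_infinity_unique[OF this, of p p]
    show ?case using F_lim[OF c(1-3), of "Suc k"] F_lim[OF c'(1-3), of "Suc k"] Mk[of k]
      unfolding R_def R'_def by blast
  qed
  have "\<forall>\<^sub>F z in at_infinity. C * A ^\<^sub>m k * B + C * A ^\<^sub>m Suc k * R z * B =
        C' * A' ^\<^sub>m k * B' + C' * A' ^\<^sub>m Suc k * R' z * B'"
    using F_eq[of k] F_step[OF c(1-3), of k] F_step[OF c'(1-3), of k]
    unfolding R_def R'_def by eventually_elim simp
  from constant_term_at_infinity_unique[OF this, of p p]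
  show ?thesis using F_lim[OF c(1-3), of "Suc k"] F_lim[OF c'(1-3), of "Suc k"] Mk[of k]
    unfolding R_def R'_def by blast
qed

text \<open>Let \<open>W, R\<close> be the observability and controllability matrices and \<open>W', R'\<close> those of a realization of
size \<open>m\<close>, so that \<open>W R = W' R'\<close>. The hypotheses make \<open>W\<close> and \<open>R\<^sup>*\<close> injective, since a vector in either
kernel would produce an eigenvector that they exclude. If \<open>m < n\<close>, some nonzero \<open>x\<close> satisfies
\<open>R' R\<^sup>* x = 0\<close>; then \<open>W R R\<^sup>* x = 0\<close>, hence \<open>R R\<^sup>* x = 0\<close>, hence \<open>R\<^sup>* x = 0\<close>, a contradiction.\<close>

lemma controllable_observable_imp_minimal:
  assumes real: "realization p S n A B C D"
    and observable: "\<And>x \<mu>. x \<in> carrier_vec n \<Longrightarrow> A *\<^sub>v x = \<mu> \<cdot>\<^sub>v x \<Longrightarrow> C *\<^sub>v x = 0\<^sub>v p \<Longrightarrow> x = 0\<^sub>v n"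
    and controllable: "\<And>x \<mu>. x \<in> carrier_vec n \<Longrightarrow> mat_adjoint A *\<^sub>v x = \<mu> \<cdot>\<^sub>v x \<Longrightarrow>
      mat_adjoint B *\<^sub>v x = 0\<^sub>v p \<Longrightarrow> x = 0\<^sub>v n"
    and real': "realization p S m A' B' C' D'"
  shows "n \<le> m"
proof (rule ccontr)
  assume "\<not> n \<le> m"
  then have mn: "m < n" by simp
  have c: "A \<in> carrier_mat n n" "B \<in> carrier_mat n p" "C \<in> carrier_mat p n"
    and c': "A' \<in> carrier_mat m m" "B' \<in> carrier_mat m p" "C' \<in> carrier_mat p m"
    using real real' by (auto simp: realization_def)
  let ?W = "obs_mat n p A C" and ?R = "ctrl_mat n p A B"
  let ?W' = "obs_mat n p A' C'" and ?R' = "ctrl_mat n p A' B'"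
  have d: "?W \<in> carrier_mat (n * p) n" "?R \<in> carrier_mat n (n * p)"
    "?W' \<in> carrier_mat (n * p) m" "?R' \<in> carrier_mat m (n * p)"
    using c c' by (auto simp: obs_mat_def ctrl_mat_def)
  have W_inj: "x = 0\<^sub>v n" if x: "x \<in> carrier_vec n" "?W *\<^sub>v x = 0\<^sub>v (n * p)" for x
  proof (rule ccontr)
    assume "x \<noteq> 0\<^sub>v n"
    from unobservable_eigenvector[OF c(1,3) x(1) this obs_mat_kernel[OF c(1,3) x]] observable
    show False by blast
  qed
  have R_inj: "x = 0\<^sub>v n" if x: "x \<in> carrier_vec n" "mat_adjoint ?R *\<^sub>v x = 0\<^sub>v (n * p)" for x
  proof (rule ccontr)
    assume nz: "x \<noteq> 0\<^sub>v n"
    have pw: "A ^\<^sub>m k \<in> carrier_mat n n" for k using c by (induction k) auto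
    have "mat_adjoint ?R = obs_mat n p (mat_adjoint A) (mat_adjoint B)"
    proof (rule eq_matI)
      fix i j assume "i < dim_row (obs_mat n p (mat_adjoint A) (mat_adjoint B))"
        "j < dim_col (obs_mat n p (mat_adjoint A) (mat_adjoint B))"
      then have ij: "i < n * p" "j < n" using c by (auto simp: obs_mat_def)
      then have p: "p > 0" by (cases p) auto
      have "mat_adjoint B * mat_adjoint A ^\<^sub>m (i div p) = mat_adjoint (A ^\<^sub>m (i div p) * B)"
        using c pw[of "i div p"] by (simp add: mat_adjoint_mult pow_mat_adjoint)
      then show "mat_adjoint ?R $$ (i, j) = obs_mat n p (mat_adjoint A) (mat_adjoint B) $$ (i, j)"
        using ij c p pw[of "i div p"] by (simp add: obs_mat_def ctrl_mat_def del: index_mult_mat(1))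
    qed (use c in \<open>auto simp: obs_mat_def ctrl_mat_def\<close>)
    then have "obs_mat n p (mat_adjoint A) (mat_adjoint B) *\<^sub>v x = 0\<^sub>v (n * p)" using x by simp
    from unobservable_eigenvector[OF _ _ x(1) nz obs_mat_kernel[OF _ _ x(1) this]] controllable c
    show False by (metis mat_adjoint_carrier)
  qed
  have prod: "?W * ?R = ?W' * ?R'"
  proof (rule eq_matI)
    fix i j assume "i < dim_row (?W' * ?R')" "j < dim_col (?W' * ?R')"
    then have "i < n * p" "j < n * p" using d by auto
    then show "(?W * ?R) $$ (i, j) = (?W' * ?R') $$ (i, j)"
      using obs_ctrl_product[OF c] obs_ctrl_product[OF c'] realization_markov_parameters[OF real real']
      by simp
  qed (use d in auto)
  obtain x where x: "x \<in> carrier_vec n" "x \<noteq> 0\<^sub>v n" "(?R' * mat_adjoint ?R) *\<^sub>v x = 0\<^sub>v m"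
    using wide_matrix_kernel[of "?R' * mat_adjoint ?R" m n] d mn by auto
  let ?y = "mat_adjoint ?R *\<^sub>v x"
  have y: "?y \<in> carrier_vec (n * p)" using d x by (auto intro: mult_mat_vec_carrier)
  \<comment> \<open>From here \<open>?y\<close> is \<open>R\<^sup>* x\<close>; the product formula moves it through the smaller realization, which kills it.\<close>
  have "?W *\<^sub>v (?R *\<^sub>v ?y) = (?W * ?R) *\<^sub>v ?y" using d y by (subst mat_mult_vec_assoc) auto
  also have "\<dots> = ?W' *\<^sub>v (?R' *\<^sub>v ?y)" using d y by (simp only: prod) (subst mat_mult_vec_assoc; auto)
  also have "?R' *\<^sub>v ?y = 0\<^sub>v m" using x d by (subst (asm) mat_mult_vec_assoc) auto
  finally have "?W *\<^sub>v (?R *\<^sub>v ?y) = 0\<^sub>v (n * p)" using d by simp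
  then have "?R *\<^sub>v ?y = 0\<^sub>v n" using W_inj[of "?R *\<^sub>v ?y"] d y by (auto intro: mult_mat_vec_carrier)
  then have "?y \<bullet>c ?y = 0"
    using mat_adjoint_scalar_prod[of "mat_adjoint ?R" x ?y] d x y by simp
  then have "?y = 0\<^sub>v (n * p)" using conjugate_square_eq_0_vec[OF y] by simp
  then show False using R_inj x by blast
qed

text \<open>The hyperplane \<open>u\<^sup>* x = 0\<close> is invariant under \<open>A\<close> and contains the columns of \<open>B\<close>, so the state may be
confined to it. With \<open>u\<^sub>i \<noteq> 0\<close>, the matrix \<open>Q\<close> deletes the coordinate \<open>i\<close>, and \<open>P\<close> restores it from the
equation of the hyperplane. Thus \<open>Q P = I\<close>, and \<open>P Q = I - E U\<close> is the projection onto the hyperplane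
along the \<open>i\<close>-th axis, where \<open>U\<close> is the row \<open>u\<^sup>*\<close>.\<close>

lemma uncontrollable_mode_reduces_realization:
  assumes real: "realization p S n A B C D"
    and u: "u \<in> carrier_vec n" "u \<noteq> 0\<^sub>v n"
    and Au: "mat_adjoint A *\<^sub>v u = \<mu> \<cdot>\<^sub>v u" and Bu: "mat_adjoint B *\<^sub>v u = 0\<^sub>v p"
  obtains m A' B' C' where "m < n" "realization p S m A' B' C' D"
proof -
  have c: "A \<in> carrier_mat n n" "B \<in> carrier_mat n p" "C \<in> carrier_mat p n" "D \<in> carrier_mat p p"
    and S: "S = const_mat D + const_mat C * resolvent n A * const_mat B"
    using real by (auto simp: realization_def)
  obtain i where i: "i < n" "u $ i \<noteq> 0"
  proof -
    have "\<exists>i<n. u $ i \<noteq> 0" using u by (metis carrier_vecD eq_vecI index_zero_vec)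
    then show thesis using that by blast
  qed
  define m where "m = n - 1"
  have mn: "Suc m = n" using i by (simp add: m_def)
  define U where "U = mat 1 n (\<lambda>(_, j). cnj (u $ j))"
  define E where "E = mat n 1 (\<lambda>(a, _ :: nat). if a = i then 1 / cnj (u $ i) else 0)"
  define Q :: "complex mat" where "Q = mat m n (\<lambda>(a, b). if b = insert_index i a then 1 else 0)"
  define P where "P = mat n m (\<lambda>(a, b). if a = i then - cnj (u $ insert_index i b) / cnj (u $ i)
    else if a = insert_index i b then 1 else 0)"
  have d: "U \<in> carrier_mat 1 n" "E \<in> carrier_mat n 1" "Q \<in> carrier_mat m n" "P \<in> carrier_mat n m"
    by (auto simp: U_def E_def Q_def P_def)
  have UA: "U * A = cnj \<mu> \<cdot>\<^sub>m U"
  proof (rule eq_matI)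
    fix a j assume aj: "a < dim_row (cnj \<mu> \<cdot>\<^sub>m U)" "j < dim_col (cnj \<mu> \<cdot>\<^sub>m U)"
    then have "(mat_adjoint A *\<^sub>v u) $ j = \<mu> * u $ j" using Au d u by simp
    then have "cnj ((mat_adjoint A *\<^sub>v u) $ j) = cnj \<mu> * cnj (u $ j)" by simp
    then show "(U * A) $$ (a, j) = (cnj \<mu> \<cdot>\<^sub>m U) $$ (a, j)"
      using aj d c u by (simp add: U_def scalar_prod_def mult.commute)
  qed (use c d in auto)
  have UB: "U * B = 0\<^sub>m 1 p"
  proof (rule eq_matI)
    fix a j assume aj: "a < dim_row (0\<^sub>m 1 p :: complex mat)" "j < dim_col (0\<^sub>m 1 p :: complex mat)"
    then have "(U * B) $$ (a, j) = cnj ((mat_adjoint B *\<^sub>v u) $ j)"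
      using d c u by (simp add: U_def scalar_prod_def mult.commute)
    then show "(U * B) $$ (a, j) = 0\<^sub>m 1 p $$ (a, j)" using aj Bu by simp
  qed (use c d in auto)
  have UE: "U * E = 1\<^sub>m 1"
    using i by (intro eq_matI)
      (auto simp: U_def E_def scalar_prod_def if_distrib[of "\<lambda>x. _ * x"] sum.If_cases cong: if_cong)
  have ins: "insert_index i b < n" "insert_index i b \<noteq> i" if "b < m" for b
    using that mn by (auto simp: insert_index_def)
  have QP: "Q * P = 1\<^sub>m m"
    using d ins by (intro eq_matI)
      (auto simp: Q_def P_def scalar_prod_def if_distrib[of "\<lambda>x. x * _"] insert_index_def cong: if_cong)
  have PQ: "P * Q = 1\<^sub>m n - E * U"
  proof (rule eq_matI)
    fix a b assume "a < dim_row (1\<^sub>m n - E * U)" "b < dim_col (1\<^sub>m n - E * U)"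
    then have ab: "a < n" "b < n" using d by auto
    have EU: "(E * U) $$ (a, b) = (if a = i then cnj (u $ b) / cnj (u $ i) else 0)"
      using ab by (simp add: E_def U_def scalar_prod_def)
    have PQ_sum: "(P * Q) $$ (a, b) = (\<Sum>k<m. P $$ (a, k) * (if b = insert_index i k then 1 else 0))"
      using ab d by (simp add: Q_def scalar_prod_def atLeast0LessThan)
    show "(P * Q) $$ (a, b) = (1\<^sub>m n - E * U) $$ (a, b)"
    proof (cases "b = i")
      case True
      have "(P * Q) $$ (a, b) = 0" 
        unfolding PQ_sum using ins(2) by (intro sum.neutral) (simp add: True eq_commute[of i])
      then show ?thesis using ab d EU True i by (simp del: index_mult_mat(1))
    next
      case False
      let ?k = "delete_index i b"
      have k: "insert_index i ?k = b" using insert_delete_index[OF False] .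
      have km: "?k < m" using False ab mn i by (auto simp: delete_index_def)
      have "(P * Q) $$ (a, b) = (\<Sum>k<m. if k = ?k then P $$ (a, ?k) else 0)"
        unfolding PQ_sum using k by (intro sum.cong) auto
      also have "\<dots> = P $$ (a, ?k)" using km by simp
      finally show ?thesis using ab d EU False km k by (auto simp: P_def simp del: index_mult_mat(1))
    qed
  qed (use d in auto)
  have UP: "U * P = 0\<^sub>m 1 m"
  proof -
    have "U * (P * Q) * P = U * P"
    proof -
      have "U * (P * Q) * P = U * (P * (Q * P))" using d by (simp add: mat_ring)
      then show ?thesis using d by (simp add: QP)
    qed
    moreover have "U * (P * Q) = U - U * E * U" unfolding PQ using d by (simp add: mat_ring)
    then have "U * (P * Q) = 0\<^sub>m 1 n" using d by (auto simp: UE)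
    ultimately show ?thesis using d by simp
  qed
  define A' B' C' where "A' = Q * A * P" and "B' = Q * B" and "C' = C * P"
  have c': "A' \<in> carrier_mat m m" "B' \<in> carrier_mat m p" "C' \<in> carrier_mat p m"
    using c d by (auto simp: A'_def B'_def C'_def)
  have PA: "P * A' = A * P"
  proof -
    have "P * A' = (P * Q) * (A * P)" using c d by (simp add: A'_def mat_ring)
    also have "\<dots> = A * P - E * (U * A * P)" unfolding PQ using c d by (simp add: mat_ring)
    also have "U * A * P = 0\<^sub>m 1 m" unfolding UA using d by (simp add: mat_smult_mult UP)
    finally show ?thesis using c d by (auto intro!: eq_matI)
  qed
  have PB: "P * B' = B"
  proof -
    have "P * B' = (P * Q) * B" using c d by (simp add: B'_def mat_ring)
    also have "\<dots> = B - E * (U * B)" unfolding PQ using c d by (simp add: mat_ring)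
    finally show ?thesis using c d by (auto intro!: eq_matI simp: UB)
  qed
  let ?R = "resolvent n A" and ?R' = "resolvent m A'" and ?P = "const_mat P"
  let ?L = "rat_var \<cdot>\<^sub>m 1\<^sub>m n - const_mat A" and ?L' = "rat_var \<cdot>\<^sub>m 1\<^sub>m m - const_mat A'"
  have R: "?R \<in> carrier_mat n n" "?R' \<in> carrier_mat m m" using resolvent(1) c c' by auto
  have LP: "?L * ?P = ?P * ?L'"
  proof -
    have "?L * ?P = rat_var \<cdot>\<^sub>m ?P - const_mat (A * P)" using c d by (simp add: mat_ring const_mat_hom)
    also have "\<dots> = ?P * ?L'" using c c' d unfolding PA[symmetric]
      by (simp add: mat_ring const_mat_hom)
    finally show ?thesis .
  qed
  have "?P * ?R' = ?R * ?P"
  proof -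
    have "?P * ?R' = ?R * ?L * (?P * ?R')" using resolvent(3)[OF c(1)] d R by simp
    also have "\<dots> = ?R * (?L * ?P * ?R')" using c d R by (simp add: mat_mult_assoc)
    also have "\<dots> = ?R * (?P * (?L' * ?R'))" using c' d R unfolding LP by (simp add: mat_mult_assoc)
    finally show ?thesis using resolvent(2)[OF c'(1)] d by simp
  qed
  then have "?P * ?R' * const_mat B' = ?R * (?P * const_mat B')"
    using c' d R by (simp add: mat_mult_assoc)
  also have "?P * const_mat B' = const_mat B" using c' d by (simp add: PB flip: const_mat_hom(1))
  finally have "const_mat C' * ?R' * const_mat B' = const_mat C * ?R * const_mat B"
    using c c' d R by (simp add: C'_def const_mat_hom mat_mult_assoc)
  then have "realization p S m A' B' C' D" using c c' by (simp add: realization_def S)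
  then show thesis using that mn by auto
qed

section \<open>Positive definite matrices\<close>

text \<open>A form with real values on the diagonal is Hermitian: compare its values on \<open>x + y\<close> and \<open>x + i y\<close> for
unit vectors \<open>x, y\<close>.\<close>

lemma positive_definite_adjoint:
  assumes M: "M \<in> carrier_mat n n" and pd: "positive_definite M"
  shows "mat_adjoint M = M"
proof (rule eq_matI)
  have quad_real: "Im ((M *\<^sub>v v) \<bullet>c v) = 0" if v: "v \<in> carrier_vec n" for v
  proof (cases "v = 0\<^sub>v n")
    case False
    then have "0 < (M *\<^sub>v v) \<bullet>c v" using pd v M by (auto simp: positive_definite_def)
    then show ?thesis by (simp add: less_complex_def)
  qed (use M in simp)
  fix i j assume "i < dim_row M" "j < dim_col M"
  then have ij: "i < n" "j < n" using M by auto
  let ?x = "unit_vec n i :: complex vec" and ?y = "unit_vec n j :: complex vec"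
  have entry: "(M *\<^sub>v (unit_vec n b :: complex vec)) \<bullet>c unit_vec n a = M $$ (a, b)"
    if "a < n" "b < n" for a b
  proof -
    have cu: "conjugate (unit_vec n a :: complex vec) = unit_vec n a" by (auto intro!: eq_vecI simp: unit_vec_def)
    show ?thesis unfolding cu using that M by simp
  qed
  have exp: "(M *\<^sub>v (?x + k \<cdot>\<^sub>v ?y)) \<bullet>c (?x + k \<cdot>\<^sub>v ?y) =
      M $$ (i, i) + k * M $$ (i, j) + cnj k * M $$ (j, i) + k * cnj k * M $$ (j, j)" for k
  proof -
    have Mx: "M *\<^sub>v ?x \<in> carrier_vec n" "M *\<^sub>v ?y \<in> carrier_vec n"
      using M by (auto intro: mult_mat_vec_carrier)
    have "(M *\<^sub>v (?x + k \<cdot>\<^sub>v ?y)) \<bullet>c (?x + k \<cdot>\<^sub>v ?y) =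
        (M *\<^sub>v ?x + k \<cdot>\<^sub>v (M *\<^sub>v ?y)) \<bullet> (conjugate ?x + cnj k \<cdot>\<^sub>v conjugate ?y)"
      using M by (simp add: mat_mult_vec_add mat_smult_vec conjugate_add_vec[of _ n] conjugate_smult_vec)
    also have "\<dots> = (M *\<^sub>v ?x) \<bullet>c ?x + k * ((M *\<^sub>v ?y) \<bullet>c ?x) + cnj k * ((M *\<^sub>v ?x) \<bullet>c ?y)
        + k * cnj k * ((M *\<^sub>v ?y) \<bullet>c ?y)"
      using Mx by (simp add: add_scalar_prod_distrib[of _ n] scalar_prod_add_distrib[of _ n] algebra_simps)
    finally show ?thesis using ij by (simp add: entry)
  qed
  have "Im (M $$ (i, i)) = 0" "Im (M $$ (j, j)) = 0"
    using quad_real[of ?x] quad_real[of ?y] entry ij by auto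
  then have "Im (M $$ (i, j) + M $$ (j, i)) = 0" "Re (M $$ (i, j)) - Re (M $$ (j, i)) = 0"
    using quad_real[of "?x + 1 \<cdot>\<^sub>v ?y"] quad_real[of "?x + \<i> \<cdot>\<^sub>v ?y"] exp[of 1] exp[of \<i>] by auto
  then show "mat_adjoint M $$ (i, j) = M $$ (i, j)"
    using ij M by (simp add: complex_eq_iff)
qed (use M in auto)

text \<open>A kernel vector would have value \<open>0\<close>, so \<open>X\<close> is invertible. With \<open>y = X x\<close>, the form of the inverse at
\<open>y\<close> is the form of \<open>X\<close> at \<open>x\<close>.\<close>

lemma mat_inv_positive_definite:
  assumes X: "X \<in> carrier_mat n n" and pd: "positive_definite X"
  shows "mat_inv X \<in> carrier_mat n n" "X * mat_inv X = 1\<^sub>m n" "mat_inv X * X = 1\<^sub>m n"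
    "mat_adjoint (mat_inv X) = mat_inv X"
    "\<And>y. y \<in> carrier_vec n \<Longrightarrow> 0 \<le> (mat_inv X *\<^sub>v y) \<bullet>c y"
proof -
  have "det X \<noteq> 0"
  proof
    assume "det X = 0"
    then obtain v where v: "v \<in> carrier_vec n" "v \<noteq> 0\<^sub>v n" "X *\<^sub>v v = 0\<^sub>v n"
      using det_0_iff_vec_prod_zero[OF X] by auto
    then have "0 < (X *\<^sub>v v) \<bullet>c v" using pd X by (auto simp: positive_definite_def)
    then show False using v by simp
  qed
  from mat_inv_mult[OF X this]
  show Xi: "mat_inv X \<in> carrier_mat n n" "X * mat_inv X = 1\<^sub>m n" "mat_inv X * X = 1\<^sub>m n" by auto
  let ?Y = "mat_inv X"
  have sa: "mat_adjoint X = X" using positive_definite_adjoint[OF X pd] .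
  have "mat_adjoint ?Y * X = mat_adjoint (X * ?Y)" using X Xi(1) by (simp add: mat_adjoint_mult sa)
  then have "mat_adjoint ?Y * X = 1\<^sub>m n" by (simp add: Xi)
  then have "mat_adjoint ?Y * X * ?Y = ?Y" using Xi(1) by simp
  then show adj: "mat_adjoint ?Y = ?Y" using X Xi by (simp add: mat_mult_assoc)
  fix y :: "complex vec" assume y: "y \<in> carrier_vec n"
  let ?x = "?Y *\<^sub>v y"
  have x: "?x \<in> carrier_vec n" using Xi(1) y by (rule mult_mat_vec_carrier)
  have "X *\<^sub>v ?x = y" using Xi X y by (simp flip: mat_mult_vec_assoc)
  then have "?x \<bullet>c y = (X *\<^sub>v ?x) \<bullet>c ?x"
    using mat_adjoint_scalar_prod[of X ?x ?x] X Xi(1) x by (simp add: sa)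
  also have "0 \<le> \<dots>"
    using pd x X by (cases "?x = 0\<^sub>v n") (auto simp: positive_definite_def less_imp_le)
  finally show "0 \<le> ?x \<bullet>c y" .
qed

section \<open>Realizations with a positive Gram matrix define inner functions\<close>

lemma RS_realization_imp_realization:
  assumes "RS_realization p \<sigma> S n A B X" "\<sigma> \<in> carrier_mat p p"
  shows "realization p S n A (B * \<sigma>) (- (mat_adjoint B * mat_inv X)) (1\<^sub>m p)"
proof -
  have c: "A \<in> carrier_mat n n" "B \<in> carrier_mat n p" "X \<in> carrier_mat n n" "positive_definite X"
    and S: "S = 1\<^sub>m p - const_mat (mat_adjoint B * mat_inv X) * resolvent n A * const_mat (B * \<sigma>)"
    using assms by (auto simp: RS_realization_def)
  have Xi: "mat_inv X \<in> carrier_mat n n" using mat_inv_positive_definite(1)[OF c(3,4)] .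
  have R: "resolvent n A \<in> carrier_mat n n" using resolvent(1)[OF c(1)] .
  show ?thesis unfolding realization_def S
    using c(1,2) Xi R assms(2) by (auto simp: const_mat_hom intro!: eq_matI simp del: index_mult_mat(1))
qed

text \<open>Here \<open>G\<close> plays the part of \<open>(z - A)\<^sup>-\<^sup>1 B \<sigma>\<close> and \<open>T\<close> that of \<open>S(z)\<close>. Expanding \<open>T\<^sup>* \<sigma> T\<close> leaves two cross terms
and one quadratic term. The equation for \<open>G\<close> rewrites \<open>\<sigma> B\<^sup>*\<close> and \<open>B \<sigma>\<close> in the cross terms, and the
Lyapunov equation, multiplied by \<open>X\<^sup>-\<^sup>1\<close> on both sides, rewrites \<open>B \<sigma> B\<^sup>*\<close> in the quadratic one; all terms
in \<open>A\<close> cancel.\<close>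

lemma inner_defect_identity:
  fixes A B X \<sigma> G :: "complex mat"
  assumes A: "A \<in> carrier_mat n n" and B: "B \<in> carrier_mat n p" and X: "X \<in> carrier_mat n n"
    and \<sigma>: "\<sigma> \<in> carrier_mat p p" "mat_adjoint \<sigma> = \<sigma>"
    and pd: "positive_definite X"
    and lyap: "A * X + X * mat_adjoint A + B * \<sigma> * mat_adjoint B = 0\<^sub>m n n"
    and G: "G \<in> carrier_mat n p" "(z \<cdot>\<^sub>m 1\<^sub>m n - A) * G = B * \<sigma>"
  defines "T \<equiv> 1\<^sub>m p - mat_adjoint B * mat_inv X * G"
  shows "\<sigma> - mat_adjoint T * \<sigma> * T = (z + cnj z) \<cdot>\<^sub>m (mat_adjoint G * mat_inv X * G)"
proof -
  let ?Y = "mat_inv X" and ?Gt = "mat_adjoint G" and ?Bt = "mat_adjoint B" and ?At = "mat_adjoint A"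
  note Xi = mat_inv_positive_definite[OF X pd]
  have Bs: "B * \<sigma> = z \<cdot>\<^sub>m G - A * G" using G A by (simp add: mat_ring)
  have "mat_adjoint (B * \<sigma>) = cnj z \<cdot>\<^sub>m ?Gt - ?Gt * ?At"
    unfolding Bs using G(1) A by (simp add: mat_adjoint_add mat_adjoint_mult)
  then have sB: "\<sigma> * ?Bt = cnj z \<cdot>\<^sub>m ?Gt - ?Gt * ?At" using B \<sigma> by (simp add: mat_adjoint_mult)
  have h1: "\<sigma> * (?Bt * (?Y * G)) = cnj z \<cdot>\<^sub>m (?Gt * (?Y * G)) - ?Gt * (?At * (?Y * G))"
  proof -
    have "\<sigma> * (?Bt * (?Y * G)) = (\<sigma> * ?Bt) * (?Y * G)" using \<sigma> B G(1) Xi(1) by (simp add: mat_mult_assoc)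
    then show ?thesis unfolding sB using A G(1) Xi(1) by (simp add: mat_ring)
  qed
  have h2: "?Gt * (?Y * (B * \<sigma>)) = z \<cdot>\<^sub>m (?Gt * (?Y * G)) - ?Gt * (?Y * (A * G))"
    unfolding Bs using A G(1) Xi(1) by (simp add: mat_ring)
  have h3: "?Gt * (?Y * (A * G)) + ?Gt * (?At * (?Y * G)) + ?Gt * (?Y * (B * (\<sigma> * (?Bt * (?Y * G))))) = 0\<^sub>m p p"
  proof -
    have "?Gt * (?Y * ((A * X + X * ?At + B * \<sigma> * ?Bt) * (?Y * G))) = 0\<^sub>m p p"
      unfolding lyap using G(1) Xi(1) by simp
    then show ?thesis using A B X G(1) \<sigma>(1) Xi(1)
      by (simp add: mat_ring mat_left_inverse_cancel[OF Xi(2) X Xi(1)] mat_left_inverse_cancel[OF Xi(3) Xi(1) X])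
  qed
  have T: "T = 1\<^sub>m p - ?Bt * (?Y * G)" "mat_adjoint T = 1\<^sub>m p - ?Gt * (?Y * B)"
    using B G(1) Xi(1) by (simp_all add: T_def mat_ring mat_adjoint_add mat_adjoint_mult Xi(4))
  have prod: "mat_adjoint T * \<sigma> * T = \<sigma> - ?Gt * (?Y * (B * \<sigma>)) - (\<sigma> * (?Bt * (?Y * G))
      - ?Gt * (?Y * (B * (\<sigma> * (?Bt * (?Y * G))))))"
    unfolding T(2) unfolding T(1) using B G(1) \<sigma>(1) Xi(1) by (simp add: mat_ring)
  have solve: "c = - a - b" if "a + b + c = 0" for a b c :: complex
  proof -
    have "c = (a + b + c) - a - b" by simp
    then show ?thesis using that by simp
  qed
  show ?thesis
  proof (rule eq_matI)
    fix i j assume "i < dim_row ((z + cnj z) \<cdot>\<^sub>m (?Gt * ?Y * G))" "j < dim_col ((z + cnj z) \<cdot>\<^sub>m (?Gt * ?Y * G))"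
    then have ij: "i < p" "j < p" using G by auto
    have "(?Gt * (?Y * (A * G))) $$ (i, j) + (?Gt * (?At * (?Y * G))) $$ (i, j) +
        (?Gt * (?Y * (B * (\<sigma> * (?Bt * (?Y * G)))))) $$ (i, j) = 0"
      using arg_cong[OF h3, of "\<lambda>M. M $$ (i, j)"] ij G(1) by (simp del: index_mult_mat(1))
    then have e: "(?Gt * (?Y * (B * (\<sigma> * (?Bt * (?Y * G)))))) $$ (i, j) =
        - (?Gt * (?Y * (A * G))) $$ (i, j) - (?Gt * (?At * (?Y * G))) $$ (i, j)"
      by (rule solve)
    have l: "(\<sigma> - mat_adjoint T * \<sigma> * T) $$ (i, j) = (\<sigma> * (?Bt * (?Y * G))) $$ (i, j) +
        (?Gt * (?Y * (B * \<sigma>))) $$ (i, j) - (?Gt * (?Y * (B * (\<sigma> * (?Bt * (?Y * G)))))) $$ (i, j)"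
      unfolding prod using ij \<sigma>(1) G(1) by (simp del: index_mult_mat(1))
    have r: "?Gt * ?Y * G = ?Gt * (?Y * G)" using G(1) Xi(1) by (simp add: mat_mult_assoc)
    show "(\<sigma> - mat_adjoint T * \<sigma> * T) $$ (i, j) = ((z + cnj z) \<cdot>\<^sub>m (?Gt * ?Y * G)) $$ (i, j)"
      unfolding l unfolding e unfolding h1 h2 r using ij G(1) A by (simp del: index_mult_mat(1) add: algebra_simps)
  qed (use G \<sigma>(1) Xi(1) in \<open>auto simp: T_def\<close>)
qed

lemma mat_tendsto_quadratic_form:
  assumes "mat_tendsto f L F" "v \<in> carrier_vec (dim_col L)" "dim_row L = dim_col L"
  shows "((\<lambda>k. (f k *\<^sub>v v) \<bullet>c v) \<longlongrightarrow> (L *\<^sub>v v) \<bullet>c v) F"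
proof -
  have d: "dim_row (f k) = dim_col L" "dim_col (f k) = dim_col L" for k
    using assms by (auto simp: mat_tendsto_def)
  have lim: "((\<lambda>k. f k $$ (i, j)) \<longlongrightarrow> L $$ (i, j)) F" if "i < dim_col L" "j < dim_col L" for i j
    using assms that by (simp add: mat_tendsto_def)
  show ?thesis using assms(2,3) d
    by (auto simp: scalar_prod_def intro!: tendsto_sum tendsto_mult tendsto_const lim)
qed

text \<open>Approaching along a vertical line serves the open half plane and the imaginary axis alike.\<close>

lemma approach_along_vertical_line:
  fixes z :: complex
  assumes "finite P"
  obtains g :: "nat \<Rightarrow> complex" where "g \<longlonglongrightarrow> z" "\<And>k. Re (g k) = Re z" "\<forall>\<^sub>F k in sequentially. g k \<notin> P"
proof -
  define g where "g k = z + \<i> * of_real (inverse (real (Suc k)))" for k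
  have "(\<lambda>k. complex_of_real (inverse (real (Suc k)))) \<longlonglongrightarrow> of_real 0"
    by (intro tendsto_of_real LIMSEQ_inverse_real_of_nat)
  from tendsto_add[OF tendsto_const tendsto_mult[OF tendsto_const this], of z \<i>]
  have "g \<longlonglongrightarrow> z" unfolding g_def by simp
  moreover have "\<forall>\<^sub>F k in sequentially. g k \<notin> P"
  proof -
    have "inj g" by (auto simp: inj_def g_def)
    then have "finite (g -` P)" using assms by (intro finite_vimageI) auto
    then show ?thesis
      by (simp add: cofinite_eq_sequentially[symmetric] eventually_cofinite vimage_def)
  qed
  ultimately show thesis using that[of g] by (simp add: g_def)
qed

text \<open>The defect identity settles all points outside the finite set of poles of the resolvent. At a pole of
the resolvent where \<open>S\<close> itself is analytic, both conclusions follow by continuity along a vertical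
line, on which the real part keeps its sign.\<close>

lemma RS_realization_imp_RS:
  assumes \<sigma>: "\<sigma> \<in> carrier_mat p p" "mat_adjoint \<sigma> = \<sigma>"
    and real: "RS_realization p \<sigma> S n A B X"
  shows "S \<in> RS p \<sigma>"
proof -
  have c: "A \<in> carrier_mat n n" "B \<in> carrier_mat n p" "X \<in> carrier_mat n n" "positive_definite X"
    and lyap: "A * X + X * mat_adjoint A + B * \<sigma> * mat_adjoint B = 0\<^sub>m n n"
    using real by (auto simp: RS_realization_def)
  note Xi = mat_inv_positive_definite[OF c(3,4)]
  let ?C = "- (mat_adjoint B * mat_inv X)"
  have C: "?C \<in> carrier_mat p n" using c Xi(1) by auto
  have S: "S = const_mat (1\<^sub>m p) + const_mat ?C * resolvent n A * const_mat (B * \<sigma>)"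
    using RS_realization_imp_realization[OF real \<sigma>(1)] by (simp add: realization_def)
  define R where "R = eval_mat (resolvent n A)"
  have R: "R z \<in> carrier_mat n n" for z using resolvent(1)[OF c(1)] by (simp add: R_def)
  have Sc: "S \<in> carrier_mat p p" unfolding S using c \<sigma> by (intro carrier_matI) simp_all
  define P where "P = {z. \<not> analytic_mat_at (resolvent n A) z}"
  have finP: "finite P" unfolding P_def by (rule finite_mat_poles)
  have ev_S: "eval_mat S z = 1\<^sub>m p + ?C * R z * (B * \<sigma>)" if "z \<notin> P" for z
    unfolding S R_def using c C \<sigma> that by (intro eval_state_space) (auto simp: P_def)
  define G where "G z = R z * (B * \<sigma>)" for z
  have G: "G z \<in> carrier_mat n p" for z using R[of z] c \<sigma> by (auto simp: G_def)
  have defect: "\<sigma> - mat_adjoint (eval_mat S z) * \<sigma> * eval_mat S z =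
      (z + cnj z) \<cdot>\<^sub>m (mat_adjoint (G z) * mat_inv X * G z)" if z: "z \<notin> P" for z
  proof -
    have "(z \<cdot>\<^sub>m 1\<^sub>m n - A) * G z = B * \<sigma>"
    proof -
      have "(z \<cdot>\<^sub>m 1\<^sub>m n - A) * G z = ((z \<cdot>\<^sub>m 1\<^sub>m n - A) * R z) * (B * \<sigma>)"
        unfolding G_def using c \<sigma> R[of z] by (simp add: mat_mult_assoc)
      then show ?thesis using eval_resolvent[OF c(1)] z c by (simp add: R_def P_def)
    qed
    moreover have "eval_mat S z = 1\<^sub>m p - mat_adjoint B * mat_inv X * G z"
      unfolding ev_S[OF z] using c \<sigma> Xi(1) R[of z] by (auto simp: G_def mat_ring intro!: eq_matI simp del: index_mult_mat(1))
    ultimately show ?thesis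
      using inner_defect_identity[OF c(1-3) \<sigma> c(4) lyap G] by simp
  qed
  have inf: "value_at_infinity S (1\<^sub>m p)"
    unfolding value_at_infinity_iff
  proof (rule mat_tendsto_cong)
    have "mat_tendsto (\<lambda>z. 1\<^sub>m p + ?C * R z * (B * \<sigma>)) (1\<^sub>m p + ?C * 0\<^sub>m n n * (B * \<sigma>)) at_infinity"
      using resolvent_tendsto_0[OF c(1)] c C \<sigma> Xi(1) unfolding R_def
      by (intro mat_tendsto_add mat_tendsto_mult mat_tendsto_const) auto
    also have "1\<^sub>m p + ?C * 0\<^sub>m n n * (B * \<sigma>) = 1\<^sub>m p"
      unfolding right_mult_zero_mat[OF C] using c \<sigma> by simp
    finally show "mat_tendsto (\<lambda>z. 1\<^sub>m p + ?C * R z * (B * \<sigma>)) (1\<^sub>m p) at_infinity" .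
    show "\<forall>\<^sub>F z in at_infinity. 1\<^sub>m p + ?C * R z * (B * \<sigma>) = eval_mat S z"
      using eventually_analytic_mat[of "resolvent n A"]
      by eventually_elim (simp add: ev_S P_def)
  qed (use Sc in auto)
  have lim: "mat_tendsto (\<lambda>k. \<sigma> - mat_adjoint (eval_mat S (g k)) * \<sigma> * eval_mat S (g k))
      (\<sigma> - mat_adjoint (eval_mat S z) * \<sigma> * eval_mat S z) sequentially"
    if "analytic_mat_at S z" "g \<longlonglongrightarrow> z" for z g
    using that Sc \<sigma>(1)
    by (intro mat_tendsto_add mat_tendsto_mult mat_tendsto_adjoint mat_tendsto_const mat_tendsto_eval_mat) auto
  have contractive: "loewner_le (mat_adjoint (eval_mat S z) * \<sigma> * eval_mat S z) \<sigma>"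
    if z: "Re z > 0" "analytic_mat_at S z" for z
    unfolding loewner_le_def positive_semidefinite_def
  proof (intro conjI ballI)
    let ?L = "\<sigma> - mat_adjoint (eval_mat S z) * \<sigma> * eval_mat S z"
    have L: "?L \<in> carrier_mat p p" using Sc by (intro carrier_matI) simp_all
    show "square_mat ?L" using carrier_matD[OF L] by (simp only: square_mat.simps)
    fix v :: "complex vec" assume "v \<in> carrier_vec (dim_row ?L)"
    then have v: "v \<in> carrier_vec p" by (simp only: carrier_matD(1)[OF L])
    obtain g where g: "g \<longlonglongrightarrow> z" "\<And>k. Re (g k) = Re z" "\<forall>\<^sub>F k in sequentially. g k \<notin> P"
      using approach_along_vertical_line[OF finP, of z] by blast
    let ?q = "\<lambda>k. ((\<sigma> - mat_adjoint (eval_mat S (g k)) * \<sigma> * eval_mat S (g k)) *\<^sub>v v) \<bullet>c v"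
    have q: "?q \<longlonglongrightarrow> (?L *\<^sub>v v) \<bullet>c v"
      by (rule mat_tendsto_quadratic_form[OF lim[OF z(2) g(1)]]) (use v in \<open>simp_all only: carrier_matD[OF L]\<close>)
    have pos: "\<forall>\<^sub>F k in sequentially. 0 \<le> ?q k"
      using g(3)
    proof eventually_elim
      case (elim k)
      let ?y = "G (g k) *\<^sub>v v"
      have y: "?y \<in> carrier_vec n" using G v by (rule mult_mat_vec_carrier)
      have "?q k = (g k + cnj (g k)) * ((mat_adjoint (G (g k)) *\<^sub>v (mat_inv X *\<^sub>v ?y)) \<bullet>c v)"
        unfolding defect[OF elim] using G[of "g k"] Xi(1) v y
        by (simp add: mat_smult_vec mat_mult_vec_assoc)
      also have "\<dots> = (g k + cnj (g k)) * ((mat_inv X *\<^sub>v ?y) \<bullet>c ?y)"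
        using mat_adjoint_scalar_prod[of "mat_adjoint (G (g k))" "mat_inv X *\<^sub>v ?y" v] G[of "g k"] Xi(1) v y
        by simp
      also have "g k + cnj (g k) = of_real (2 * Re z)" using g(2)[of k] by (simp add: complex_eq_iff)
      finally show ?case using Xi(5)[OF y] z(1) by (simp add: less_eq_complex_def)
    qed
    have "0 \<le> Re ((?L *\<^sub>v v) \<bullet>c v)"
      by (rule tendsto_lowerbound[OF tendsto_Re[OF q]])
        (use pos in \<open>eventually_elim, auto simp: less_eq_complex_def\<close>)
    moreover have "Im ((?L *\<^sub>v v) \<bullet>c v) = 0"
    proof (rule tendsto_unique[OF _ tendsto_Im[OF q]])
      show "(\<lambda>k. Im (?q k)) \<longlonglongrightarrow> 0"
        by (rule tendsto_eventually) (use pos in \<open>eventually_elim, auto simp: less_eq_complex_def\<close>)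
    qed simp
    ultimately show "0 \<le> (?L *\<^sub>v v) \<bullet>c v" by (simp add: less_eq_complex_def)
  qed
  have isometric: "mat_adjoint (eval_mat S z) * \<sigma> * eval_mat S z = \<sigma>"
    if z: "Re z = 0" "analytic_mat_at S z" for z
  proof -
    let ?L = "\<sigma> - mat_adjoint (eval_mat S z) * \<sigma> * eval_mat S z"
    have L: "?L \<in> carrier_mat p p" using Sc by (intro carrier_matI) simp_all
    obtain g where g: "g \<longlonglongrightarrow> z" "\<And>k. Re (g k) = Re z" "\<forall>\<^sub>F k in sequentially. g k \<notin> P"
      using approach_along_vertical_line[OF finP, of z] by blast
    have "mat_tendsto (\<lambda>k. 0\<^sub>m p p) ?L sequentially"
    proof (rule mat_tendsto_cong[OF lim[OF z(2) g(1)]])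
      show "\<forall>\<^sub>F k in sequentially. \<sigma> - mat_adjoint (eval_mat S (g k)) * \<sigma> * eval_mat S (g k) = 0\<^sub>m p p"
        using g(3)
      proof eventually_elim
        case (elim k)
        have "g k + cnj (g k) = 0" using g(2)[of k] z(1) by (simp add: complex_eq_iff)
        then show ?case unfolding defect[OF elim] using G[of "g k"] by (auto intro!: eq_matI simp del: index_mult_mat(1))
      qed
    qed (simp_all only: carrier_matD[OF L], use Sc in simp_all)
    then have "?L = 0\<^sub>m p p" using mat_tendsto_const by (rule mat_tendsto_unique) simp
    then have "?L $$ (i, j) = 0" if "i < p" "j < p" for i j using that by simp
    then show ?thesis using \<sigma>(1) Sc by (intro eq_matI) (auto simp del: index_mult_mat(1))
  qed
  show ?thesis using Sc inf contractive isometric by (simp add: RS_def)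
qed

section \<open>Minimality of realizations with a positive Gram matrix\<close>

lemma minimal_RS_realization_controllable:
  assumes \<sigma>: "\<sigma> \<in> carrier_mat p p" and min: "minimal_RS_realization p \<sigma> S n A B X"
    and u: "u \<in> carrier_vec n" "mat_adjoint A *\<^sub>v u = \<mu> \<cdot>\<^sub>v u" "mat_adjoint B *\<^sub>v u = 0\<^sub>v p"
  shows "u = 0\<^sub>v n"
proof (rule ccontr)
  assume nz: "u \<noteq> 0\<^sub>v n"
  have real: "RS_realization p \<sigma> S n A B X"
    and least: "\<And>m A' B' C' D'. realization p S m A' B' C' D' \<Longrightarrow> n \<le> m"
    using min unfolding minimal_RS_realization_def by blast+
  have B: "B \<in> carrier_mat n p" using real by (simp add: RS_realization_def)
  have "mat_adjoint (B * \<sigma>) *\<^sub>v u = mat_adjoint \<sigma> *\<^sub>v (mat_adjoint B *\<^sub>v u)"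
    using B \<sigma> u(1) by (simp add: mat_adjoint_mult mat_mult_vec_assoc)
  then have "mat_adjoint (B * \<sigma>) *\<^sub>v u = 0\<^sub>v p" using \<sigma> u(3) by simp
  obtain m A' B' C' where m: "m < n" "realization p S m A' B' C' (1\<^sub>m p)"
    by (rule uncontrollable_mode_reduces_realization[OF
          RS_realization_imp_realization[OF real \<sigma>] u(1) nz u(2) \<open>mat_adjoint (B * \<sigma>) *\<^sub>v u = 0\<^sub>v p\<close>])
  show False using least[OF m(2)] m(1) by simp
qed

text \<open>Observability comes for free: if \<open>A x = \<mu> x\<close> and \<open>B\<^sup>* X\<^sup>-\<^sup>1 x = 0\<close>, then the Lyapunov equation applied to
\<open>u = X\<^sup>-\<^sup>1 x\<close> gives \<open>A\<^sup>* u = - \<mu> u\<close> and \<open>B\<^sup>* u = 0\<close>. The input matrix of the state space realization is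
\<open>B \<sigma>\<close> rather than \<open>B\<close>, which is where the inverse of \<open>\<sigma>\<close> enters.\<close>

lemma controllable_imp_minimal_RS_realization:
  assumes \<sigma>: "\<sigma> \<in> carrier_mat p p" "mat_adjoint \<sigma> = \<sigma>" "invertible_mat \<sigma>"
    and real: "RS_realization p \<sigma> S n A B X"
    and ctrl: "\<And>u \<mu>. u \<in> carrier_vec n \<Longrightarrow> mat_adjoint A *\<^sub>v u = \<mu> \<cdot>\<^sub>v u \<Longrightarrow>
      mat_adjoint B *\<^sub>v u = 0\<^sub>v p \<Longrightarrow> u = 0\<^sub>v n"
  shows "minimal_RS_realization p \<sigma> S n A B X"
proof -
  have c: "A \<in> carrier_mat n n" "B \<in> carrier_mat n p" "X \<in> carrier_mat n n" "positive_definite X"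
    and lyap: "A * X + X * mat_adjoint A + B * \<sigma> * mat_adjoint B = 0\<^sub>m n n"
    using real by (auto simp: RS_realization_def)
  note Xi = mat_inv_positive_definite[OF c(3,4)]
  obtain \<tau> where \<tau>: "\<tau> * \<sigma> = 1\<^sub>m p" "\<tau> \<in> carrier_mat p p"
  proof -
    obtain \<tau> where t: "\<tau> * \<sigma> = 1\<^sub>m (dim_row \<tau>)" "\<sigma> * \<tau> = 1\<^sub>m (dim_row \<sigma>)"
      using \<sigma>(3) by (auto simp: invertible_mat_def inverts_mat_def)
    have "dim_row \<tau> = p" using arg_cong[OF t(1), of dim_col] \<sigma>(1) by simp
    moreover have "dim_col \<tau> = p" using arg_cong[OF t(2), of dim_col] \<sigma>(1) by simp
    ultimately show thesis using that[of \<tau>] t(1) by auto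
  qed
  have "n \<le> m" if "realization p S m A' B' C' D'" for m A' B' C' D'
  proof (rule controllable_observable_imp_minimal[OF RS_realization_imp_realization[OF real \<sigma>(1)] _ _ that])
    fix x \<mu> assume x: "x \<in> carrier_vec n" and Ax: "A *\<^sub>v x = \<mu> \<cdot>\<^sub>v x"
      and Cx: "- (mat_adjoint B * mat_inv X) *\<^sub>v x = 0\<^sub>v p"
    let ?u = "mat_inv X *\<^sub>v x"
    have u: "?u \<in> carrier_vec n" using Xi(1) x by (rule mult_mat_vec_carrier)
    have Xu: "X *\<^sub>v ?u = x" using Xi(1,2) c(3) x by (simp flip: mat_mult_vec_assoc)
    have "- (mat_adjoint B *\<^sub>v ?u) = 0\<^sub>v p"
      using Cx c(2) Xi(1) x by (simp add: uminus_mult_mat_vec mat_mult_vec_assoc)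
    then have Bu: "mat_adjoint B *\<^sub>v ?u = 0\<^sub>v p"
      using uminus_zero_vec_eq[of "mat_adjoint B *\<^sub>v ?u" p] c(2) u by (auto intro: mult_mat_vec_carrier)
    let ?v = "mat_adjoint A *\<^sub>v ?u"
    have v: "?v \<in> carrier_vec n" using c(1) u by (auto intro: mult_mat_vec_carrier)
    have "(A * X + X * mat_adjoint A + B * \<sigma> * mat_adjoint B) *\<^sub>v ?u =
        A *\<^sub>v (X *\<^sub>v ?u) + X *\<^sub>v ?v + B *\<^sub>v (\<sigma> *\<^sub>v (mat_adjoint B *\<^sub>v ?u))"
      using c(1-3) \<sigma>(1) u Xi(1) by (simp add: mat_add_vec mat_mult_vec_assoc)
    also have "\<dots> = \<mu> \<cdot>\<^sub>v x + X *\<^sub>v ?v"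
      unfolding Xu Bu Ax using c(2,3) \<sigma>(1) x v by (simp add: mult_mat_vec_carrier[of X n n])
    finally have sum0: "\<mu> \<cdot>\<^sub>v x + X *\<^sub>v ?v = 0\<^sub>v n" using u Xi(1) by (simp add: lyap)
    have "mat_inv X *\<^sub>v (\<mu> \<cdot>\<^sub>v x + X *\<^sub>v ?v) = \<mu> \<cdot>\<^sub>v ?u + ?v"
      using c(1,3) Xi(1,3) x v by (simp add: mat_mult_vec_add mat_smult_vec flip: mat_mult_vec_assoc[of "mat_inv X" X])
    then have eq0: "\<mu> \<cdot>\<^sub>v ?u + ?v = 0\<^sub>v n" using sum0 Xi(1) by simp
    have "?v = (- \<mu>) \<cdot>\<^sub>v ?u"
    proof (rule eq_vecI)
      fix i assume i: "i < dim_vec ((- \<mu>) \<cdot>\<^sub>v ?u)"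
      then have "(\<mu> \<cdot>\<^sub>v ?u + ?v) $ i = 0" unfolding eq0 using Xi(1) by simp
      then show "?v $ i = ((- \<mu>) \<cdot>\<^sub>v ?u) $ i"
        using i u v Xi(1) c(1) by (simp add: add_eq_0_iff del: index_mult_mat_vec)
    qed (use c(1) Xi(1) in simp)
    from ctrl[OF u this Bu] have "x = X *\<^sub>v 0\<^sub>v n" using Xu by simp
    then show "x = 0\<^sub>v n" using c(3) by simp
  next
    fix x \<mu> assume x: "x \<in> carrier_vec n" "mat_adjoint A *\<^sub>v x = \<mu> \<cdot>\<^sub>v x"
      and Bx: "mat_adjoint (B * \<sigma>) *\<^sub>v x = 0\<^sub>v p"
    let ?y = "mat_adjoint B *\<^sub>v x"
    have "?y \<in> carrier_vec p" using c(2) x(1) by (auto intro: mult_mat_vec_carrier)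
    then have "?y = (\<tau> * \<sigma>) *\<^sub>v ?y" unfolding \<tau>(1) by (simp only: one_mult_mat_vec)
    also have "\<dots> = \<tau> *\<^sub>v (mat_adjoint (B * \<sigma>) *\<^sub>v x)"
      using \<tau>(2) c(2) \<sigma>(1,2) x(1) by (simp add: mat_adjoint_mult mat_mult_vec_assoc)
    also have "\<dots> = 0\<^sub>v p" unfolding Bx using \<tau>(2) by simp
    finally show "x = 0\<^sub>v n" using ctrl x by blast
  qed
  then show ?thesis using real unfolding minimal_RS_realization_def by blast
qed

text \<open>Pairing the Lyapunov equation with \<open>u\<close> on both sides leaves \<open>(\<mu> + \<mu>\<^sup>*) u\<^sup>* X u = 0\<close>.\<close>

lemma positive_gram_uncontrollable_mode_imaginary:
  assumes c: "A \<in> carrier_mat n n" "B \<in> carrier_mat n p" "X \<in> carrier_mat n n" "positive_definite X"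
    and \<sigma>: "\<sigma> \<in> carrier_mat p p"
    and lyap: "A * X + X * mat_adjoint A + B * \<sigma> * mat_adjoint B = 0\<^sub>m n n"
    and u: "u \<in> carrier_vec n" "u \<noteq> 0\<^sub>v n"
    and Au: "mat_adjoint A *\<^sub>v u = \<mu> \<cdot>\<^sub>v u" and Bu: "mat_adjoint B *\<^sub>v u = 0\<^sub>v p"
  shows "Re \<mu> = 0"
proof -
  let ?y = "X *\<^sub>v u"
  have y: "?y \<in> carrier_vec n" using c(3) u(1) by (rule mult_mat_vec_carrier)
  define q where "q = ?y \<bullet>c u"
  have q: "0 < q" using c(3,4) u by (auto simp: positive_definite_def q_def)
  have Ay: "A *\<^sub>v ?y \<in> carrier_vec n" using c(1) y by (rule mult_mat_vec_carrier)
  have "(A * X + X * mat_adjoint A + B * \<sigma> * mat_adjoint B) *\<^sub>v u =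
      A *\<^sub>v ?y + X *\<^sub>v (mat_adjoint A *\<^sub>v u) + B *\<^sub>v (\<sigma> *\<^sub>v (mat_adjoint B *\<^sub>v u))"
    using c(1-3) \<sigma> u(1) by (simp add: mat_add_vec mat_mult_vec_assoc)
  also have "\<dots> = A *\<^sub>v ?y + \<mu> \<cdot>\<^sub>v ?y"
    unfolding Au Bu using c(2,3) \<sigma> u(1) Ay y by (simp add: mat_smult_vec)
  finally have "A *\<^sub>v ?y + \<mu> \<cdot>\<^sub>v ?y = 0\<^sub>v n" using u(1) by (simp add: lyap)
  then have "(A *\<^sub>v ?y + \<mu> \<cdot>\<^sub>v ?y) \<bullet>c u = 0" using u(1) by simp
  then have "(A *\<^sub>v ?y) \<bullet>c u + \<mu> * q = 0"
    using Ay y u(1) by (simp add: add_scalar_prod_distrib[of _ n] q_def)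
  moreover have "(A *\<^sub>v ?y) \<bullet>c u = cnj \<mu> * q"
    using mat_adjoint_scalar_prod[of A ?y u] c(1,3) y u(1) by (simp add: Au q_def conjugate_smult_vec)
  ultimately have "(cnj \<mu> + \<mu>) * q = 0" by (simp add: algebra_simps)
  then have "cnj \<mu> + \<mu> = 0" using q by auto
  then show ?thesis by (simp add: complex_eq_iff)
qed

section \<open>Block matrices and rank one perturbations\<close>

abbreviation block_row :: "'a :: zero mat \<Rightarrow> 'a mat \<Rightarrow> 'a mat" where
  "block_row A B \<equiv> four_block_mat A B (0\<^sub>m 0 (dim_col A)) (0\<^sub>m 0 (dim_col B))"

lemma four_block_mat_sum3_eq_0:
  fixes A1 :: "'a :: comm_ring_1 mat"
  assumes "A1 \<in> carrier_mat n1 m1" "A2 \<in> carrier_mat n1 m1" "A3 \<in> carrier_mat n1 m1"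
    and "B1 \<in> carrier_mat n1 m2" "B2 \<in> carrier_mat n1 m2" "B3 \<in> carrier_mat n1 m2"
    and "C1 \<in> carrier_mat n2 m1" "C2 \<in> carrier_mat n2 m1" "C3 \<in> carrier_mat n2 m1"
    and "D1 \<in> carrier_mat n2 m2" "D2 \<in> carrier_mat n2 m2" "D3 \<in> carrier_mat n2 m2"
    and "A1 + A2 + A3 = 0\<^sub>m n1 m1" "B1 + B2 + B3 = 0\<^sub>m n1 m2"
    and "C1 + C2 + C3 = 0\<^sub>m n2 m1" "D1 + D2 + D3 = 0\<^sub>m n2 m2"
  shows "four_block_mat A1 B1 C1 D1 + four_block_mat A2 B2 C2 D2 + four_block_mat A3 B3 C3 D3 =
    0\<^sub>m (n1 + n2) (m1 + m2)"
  using assms by (simp add: add_four_block_mat[of _ n1 m1 _ m2 _ n2])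

lemma four_block_mat_no_second:
  "A \<in> carrier_mat n m \<Longrightarrow> four_block_mat A (0\<^sub>m n 0) (0\<^sub>m 0 m) (0\<^sub>m 0 0) = A"
  by (auto intro!: eq_matI)

lemma four_block_mat_mult_append_rows:
  fixes A :: "'a :: comm_ring_1 mat"
  assumes "A \<in> carrier_mat n1 m1" "B \<in> carrier_mat n1 m2" "C \<in> carrier_mat n2 m1" "D \<in> carrier_mat n2 m2"
    and "E \<in> carrier_mat m1 p" "F \<in> carrier_mat m2 p"
  shows "four_block_mat A B C D * (E @\<^sub>r F) = (A * E + B * F) @\<^sub>r (C * E + D * F)"
  unfolding append_rows_def
  using mult_four_block_mat[OF assms(1-4), of E p "0\<^sub>m m1 0" 0 F "0\<^sub>m m2 0"] assms by simp

lemma block_row_mult_append_rows: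
  fixes A :: "'a :: comm_ring_1 mat"
  assumes "A \<in> carrier_mat k m1" "B \<in> carrier_mat k m2"
    and "E \<in> carrier_mat m1 p" "F \<in> carrier_mat m2 p"
  shows "block_row A B * (E @\<^sub>r F) = A * E + B * F"
proof -
  have "block_row A B * (E @\<^sub>r F) = four_block_mat (A * E + B * F) (0\<^sub>m k 0) (0\<^sub>m 0 p) (0\<^sub>m 0 0)"
    unfolding append_rows_def
    using mult_four_block_mat[of A k m1 B m2 "0\<^sub>m 0 m1" 0 "0\<^sub>m 0 m2" E p "0\<^sub>m m1 0" 0 F "0\<^sub>m m2 0"] assms
    by simp
  then show ?thesis using assms by (simp add: four_block_mat_no_second[of _ k p])
qed

lemma append_rows_mult:
  fixes E :: "'a :: comm_ring_1 mat"
  assumes "E \<in> carrier_mat n p" "F \<in> carrier_mat m p" "N \<in> carrier_mat p q"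
  shows "(E @\<^sub>r F) * N = (E * N) @\<^sub>r (F * N)"
proof -
  have "(E @\<^sub>r F) * four_block_mat N (0\<^sub>m p 0) (0\<^sub>m 0 q) (0\<^sub>m 0 0) = (E * N) @\<^sub>r (F * N)"
    unfolding append_rows_def
    using mult_four_block_mat[of E n p "0\<^sub>m n 0" 0 F m "0\<^sub>m m 0" N q "0\<^sub>m p 0" 0 "0\<^sub>m 0 q" "0\<^sub>m 0 0"] assms
    by simp
  then show ?thesis using assms by (simp add: four_block_mat_no_second)
qed

lemma append_rows_mult_block_row:
  fixes E :: "'a :: comm_ring_1 mat"
  assumes "E \<in> carrier_mat n p" "F \<in> carrier_mat m p" "G \<in> carrier_mat p n'" "H \<in> carrier_mat p m'"
  shows "(E @\<^sub>r F) * block_row G H = four_block_mat (E * G) (E * H) (F * G) (F * H)"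
  unfolding append_rows_def
  using mult_four_block_mat[of E n p "0\<^sub>m n 0" 0 F m "0\<^sub>m m 0" G n' H m' "0\<^sub>m 0 n'" "0\<^sub>m 0 m'"] assms
  by simp

lemma mat_adjoint_append_rows:
  assumes "E \<in> carrier_mat n p" "F \<in> carrier_mat m p"
  shows "mat_adjoint (E @\<^sub>r F) = block_row (mat_adjoint E) (mat_adjoint (F :: complex mat))"
  unfolding append_rows_def
  using assms by (subst mat_adjoint_four_block[of _ n p _ 0 _ m]) auto

lemma append_rows_inject:
  assumes eq: "E @\<^sub>r F = G @\<^sub>r H"
    and d: "E \<in> carrier_mat n p" "F \<in> carrier_mat m p" "G \<in> carrier_mat n p" "H \<in> carrier_mat m p"
  shows "E = G" "F = H"
proof -
  have e: "(E @\<^sub>r F) $$ (i, j) = (G @\<^sub>r H) $$ (i, j)" for i j using eq by simp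
  show "E = G"
  proof (rule eq_matI)
    fix i j assume "i < dim_row G" "j < dim_col G"
    then show "E $$ (i, j) = G $$ (i, j)" using e[of i j] d by (simp add: append_rows_def)
  qed (use d in auto)
  show "F = H"
  proof (rule eq_matI)
    fix i j assume "i < dim_row H" "j < dim_col H"
    then show "F $$ (i, j) = H $$ (i, j)" using e[of "n + i" j] d by (simp add: append_rows_def)
  qed (use d in auto)
qed

lemma ex_append_rows:
  assumes "M \<in> carrier_mat (n + m) p"
  obtains E F where "E \<in> carrier_mat n p" "F \<in> carrier_mat m p" "M = E @\<^sub>r F"
proof
  let ?E = "mat n p (\<lambda>(i, j). M $$ (i, j))" and ?F = "mat m p (\<lambda>(i, j). M $$ (n + i, j))"
  show "?E \<in> carrier_mat n p" "?F \<in> carrier_mat m p" by auto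
  show "M = ?E @\<^sub>r ?F" using assms by (auto intro!: eq_matI simp: append_rows_def)
qed

lemma const_mat_four_block:
  assumes "A \<in> carrier_mat n1 m1" "B \<in> carrier_mat n1 m2" "C \<in> carrier_mat n2 m1" "D \<in> carrier_mat n2 m2"
  shows "const_mat (four_block_mat A B C D) =
    four_block_mat (const_mat A) (const_mat B) (const_mat C) (const_mat D)"
  unfolding const_mat_def using map_four_block_mat[OF assms] by auto

lemma const_mat_append_rows:
  assumes "A \<in> carrier_mat n p" "B \<in> carrier_mat m p"
  shows "const_mat (A @\<^sub>r B) = const_mat A @\<^sub>r const_mat B"
  unfolding append_rows_def
  using assms by (subst const_mat_four_block[of _ n p _ 0 _ m]) (auto simp: const_mat_hom)

lemma split_block_four_block_mat:
  assumes "A \<in> carrier_mat n m" "B \<in> carrier_mat n m'" "C \<in> carrier_mat n' m" "D \<in> carrier_mat n' m'"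
  shows "split_block (four_block_mat A B C D) n m = (A, B, C, D)"
  using assms by (auto simp: split_block_def Let_def intro!: eq_matI)

lemma mat_inv_eqI:
  fixes M N :: "'a :: field mat"
  assumes "M \<in> carrier_mat n n" "N \<in> carrier_mat n n" "M * N = 1\<^sub>m n"
  shows "mat_inv M = N"
proof -
  have "det M * det N = 1" using det_mult[OF assms(1,2)] assms(3) by simp
  then have "det M \<noteq> 0" by auto
  note i = mat_inv_mult[OF assms(1) this]
  have "mat_inv M = mat_inv M * (M * N)" using i(1) assms(3) by simp
  also have "\<dots> = mat_inv M * M * N" using assms i(1) by (simp add: mat_mult_assoc)
  finally show ?thesis using i(3) assms(2) by simp
qed

lemma mat_inv_block_diag:
  fixes X :: complex
  assumes X0: "X0 \<in> carrier_mat n n" "positive_definite X0" and X: "X \<noteq> 0"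
  shows "mat_inv (four_block_mat X0 (0\<^sub>m n 1) (0\<^sub>m 1 n) (X \<cdot>\<^sub>m 1\<^sub>m 1)) =
    four_block_mat (mat_inv X0) (0\<^sub>m n 1) (0\<^sub>m 1 n) ((1 / X) \<cdot>\<^sub>m 1\<^sub>m 1)"
proof (rule mat_inv_eqI)
  note Xi = mat_inv_positive_definite[OF X0]
  show "four_block_mat X0 (0\<^sub>m n 1) (0\<^sub>m 1 n) (X \<cdot>\<^sub>m 1\<^sub>m 1) *
    four_block_mat (mat_inv X0) (0\<^sub>m n 1) (0\<^sub>m 1 n) ((1 / X) \<cdot>\<^sub>m 1\<^sub>m 1) = 1\<^sub>m (n + 1)"
    using X0 X Xi(1) by (subst mult_four_block_mat[of _ n n _ 1 _ 1 _ _ n _ 1])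
      (auto simp: Xi(2) mat_ring four_block_one_mat)
qed (use X0 mat_inv_positive_definite(1)[OF X0] in auto)

lemma positive_definite_block_diag:
  fixes X :: complex
  assumes X0: "X0 \<in> carrier_mat n n" "positive_definite X0" and X: "0 < X"
  shows "positive_definite (four_block_mat X0 (0\<^sub>m n 1) (0\<^sub>m 1 n) (X \<cdot>\<^sub>m 1\<^sub>m 1))" (is "positive_definite ?M")
  unfolding positive_definite_def
proof (intro conjI ballI impI)
  have M: "?M \<in> carrier_mat (n + 1) (n + 1)" using X0 by auto
  show "square_mat ?M" using X0(1) by simp
  fix v :: "complex vec" assume v: "v \<in> carrier_vec (dim_row ?M)" "v \<noteq> 0\<^sub>v (dim_row ?M)"
  define a b where "a = vec_first v n" and "b = vec_last v 1"
  have v': "v \<in> carrier_vec (n + 1)" using v(1) X0(1) by simp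
  have ab: "a \<in> carrier_vec n" "b \<in> carrier_vec 1" "v = a @\<^sub>v b"
    using v' by (auto simp: a_def b_def)
  have conj: "conjugate v = conjugate a @\<^sub>v conjugate b"
    unfolding ab(3) by (auto intro!: eq_vecI simp: append_vec_def Let_def)
  have Mv: "?M *\<^sub>v v = (X0 *\<^sub>v a) @\<^sub>v (X \<cdot>\<^sub>v b)"
    unfolding ab(3) using X0 ab(1,2)
    by (subst four_block_mat_mult_vec[of _ n n _ 1 _ 1]) (auto simp: mat_smult_vec)
  have q: "(?M *\<^sub>v v) \<bullet>c v = (X0 *\<^sub>v a) \<bullet>c a + X * (b \<bullet>c b)"
    unfolding Mv conj using X0 ab(1,2)
    by (subst scalar_prod_append[of _ n _ 1]) (auto intro: mult_mat_vec_carrier)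
  have A: "0 \<le> (X0 *\<^sub>v a) \<bullet>c a"
    using X0 ab(1) by (cases "a = 0\<^sub>v n") (auto simp: positive_definite_def less_imp_le)
  have B: "0 \<le> X * (b \<bullet>c b)"
    using X conjugate_square_ge_0_vec[of b] by (simp add: less_complex_def less_eq_complex_def)
  show "0 < (?M *\<^sub>v v) \<bullet>c v"
  proof (cases "a = 0\<^sub>v n")
    case True
    then have "b \<noteq> 0\<^sub>v 1" using v(2) ab(3) X0(1) by (auto simp: append_vec_def)
    then have "0 < b \<bullet>c b" using ab(2) by (simp add: conjugate_square_greater_0_vec)
    then have "0 < X * (b \<bullet>c b)" using X by (simp add: less_complex_def)
    then show ?thesis unfolding q using A by (simp add: add_nonneg_pos)
  next
    case False
    then have "0 < (X0 *\<^sub>v a) \<bullet>c a" using X0 ab(1) by (auto simp: positive_definite_def)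
    then show ?thesis unfolding q using B by (simp add: add_pos_nonneg)
  qed
qed

lemma smult_one_minus_four_block:
  fixes A :: "'a :: comm_ring_1 mat"
  assumes "A \<in> carrier_mat n n" "B \<in> carrier_mat n m" "C \<in> carrier_mat m n" "D \<in> carrier_mat m m"
  shows "k \<cdot>\<^sub>m 1\<^sub>m (n + m) - four_block_mat A B C D =
    four_block_mat (k \<cdot>\<^sub>m 1\<^sub>m n - A) (- B) (- C) (k \<cdot>\<^sub>m 1\<^sub>m m - D)"
  using assms by (intro eq_matI) auto

text \<open>If \<open>v + d (f v) = 0\<close>, applying \<open>f\<close> gives \<open>(1 + f d) (f v) = 0\<close>, so \<open>f v = 0\<close> and then \<open>v = 0\<close>.\<close>

lemma invertible_one_plus_rank_one:
  fixes d f :: "'a :: field mat"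
  assumes d: "d \<in> carrier_mat p 1" and f: "f \<in> carrier_mat 1 p" and nz: "1 + (f * d) $$ (0, 0) \<noteq> 0"
  shows "invertible_mat (1\<^sub>m p + d * f)" "mat_inv (1\<^sub>m p + d * f) * (1\<^sub>m p + d * f) = 1\<^sub>m p"
    "mat_inv (1\<^sub>m p + d * f) \<in> carrier_mat p p"
proof -
  define s where "s = (f * d) $$ (0, 0)"
  let ?M = "1\<^sub>m p + d * f"
  have M: "?M \<in> carrier_mat p p" using d f by auto
  have fd: "f * d = s \<cdot>\<^sub>m 1\<^sub>m 1" using d f by (intro eq_matI) (auto simp: s_def simp del: index_mult_mat(1))
  have "det ?M \<noteq> 0"
  proof
    assume "det ?M = 0"
    then obtain v where v: "v \<in> carrier_vec p" "v \<noteq> 0\<^sub>v p" "?M *\<^sub>v v = 0\<^sub>v p"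
      using det_0_iff_vec_prod_zero[OF M] by auto
    have fv: "f *\<^sub>v v \<in> carrier_vec 1" using f v(1) by (rule mult_mat_vec_carrier)
    have sum0: "v + d *\<^sub>v (f *\<^sub>v v) = 0\<^sub>v p"
      using v d f by (simp add: mat_add_vec mat_mult_vec_assoc)
    have "f *\<^sub>v (v + d *\<^sub>v (f *\<^sub>v v)) = f *\<^sub>v v + s \<cdot>\<^sub>v (f *\<^sub>v v)"
      using v(1) d f fv
      by (simp add: mat_mult_vec_add mat_smult_vec fd flip: mat_mult_vec_assoc[of f d])
    then have "f *\<^sub>v v + s \<cdot>\<^sub>v (f *\<^sub>v v) = 0\<^sub>v 1" using sum0 f by simp
    then have "(f *\<^sub>v v + s \<cdot>\<^sub>v (f *\<^sub>v v)) $ 0 = 0" by simp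
    then have "(1 + s) * (f *\<^sub>v v) $ 0 = 0" using fv f by (simp add: algebra_simps del: index_mult_mat_vec)
    then have "(f *\<^sub>v v) $ 0 = 0" using nz by (simp add: s_def del: index_mult_mat_vec)
    then have "f *\<^sub>v v = 0\<^sub>v 1" using f by (intro eq_vecI) (auto simp del: index_mult_mat_vec)
    then have "v = 0\<^sub>v p" using sum0 v(1) d by simp
    then show False using v(2) by simp
  qed
  note i = mat_inv_mult[OF M this]
  show "mat_inv ?M * ?M = 1\<^sub>m p" "mat_inv ?M \<in> carrier_mat p p" using i by auto
  show "invertible_mat ?M" unfolding invertible_mat_def inverts_mat_def
    using M d f i by (intro conjI exI[of _ "mat_inv ?M"]) auto
qed

section \<open>The extended realization\<close>

text \<open>One interpolation step: a single state is added to a given realization of \<open>S0\<close>. Minimality of that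
realization enters below as controllability, in \<open>AS_controllable\<close>.\<close>

locale rank_one_extension =
  fixes p n :: nat and \<sigma> \<xi> \<eta> A0 B0 X0 :: "complex mat" and w X :: complex and S0 :: "ratfun mat"
  assumes \<sigma>: "\<sigma> \<in> carrier_mat p p" "mat_adjoint \<sigma> = \<sigma>"
    and w: "Re w > 0"
    and \<xi>: "\<xi> \<in> carrier_mat 1 p" and \<eta>: "\<eta> \<in> carrier_mat 1 p"
    and X: "X = (\<xi> * \<sigma> * mat_adjoint \<xi> - \<eta> * \<sigma> * mat_adjoint \<eta>) $$ (0, 0) / (w + cnj w)"
    and X_pos: "0 < X"
    and S0: "RS_realization p \<sigma> S0 n A0 B0 X0"
begin

abbreviation "BS \<equiv> B0 @\<^sub>r (\<eta> - \<xi>)"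

abbreviation "XS \<equiv> four_block_mat X0 (0\<^sub>m n 1) (0\<^sub>m 1 n) (X \<cdot>\<^sub>m 1\<^sub>m 1)"

abbreviation "AS \<equiv> four_block_mat
  A0
  ((1 / X) \<cdot>\<^sub>m (B0 * \<sigma> * mat_adjoint \<xi>))
  (- (\<eta> * \<sigma> * mat_adjoint B0 * mat_inv X0))
  ((- cnj w) \<cdot>\<^sub>m 1\<^sub>m 1 - (1 / X) \<cdot>\<^sub>m (\<eta> * \<sigma> * (mat_adjoint \<eta> - mat_adjoint \<xi>)))"

lemma base: "A0 \<in> carrier_mat n n" "B0 \<in> carrier_mat n p" "X0 \<in> carrier_mat n n" "positive_definite X0"
    "A0 * X0 + X0 * mat_adjoint A0 + B0 * \<sigma> * mat_adjoint B0 = 0\<^sub>m n n"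
    "S0 = 1\<^sub>m p - const_mat (mat_adjoint B0 * mat_inv X0) * resolvent n A0 * const_mat (B0 * \<sigma>)"
  using S0 by (auto simp: RS_realization_def)

lemmas X0_inv = mat_inv_positive_definite[OF base(3,4)]

lemma X0_adjoint: "mat_adjoint X0 = X0"
  by (rule positive_definite_adjoint[OF base(3,4)])

lemma X_scalar: "X \<noteq> 0" "cnj X = X"
  using X_pos by (auto simp: less_complex_def complex_eq_iff)

lemma carriers: "AS \<in> carrier_mat (n + 1) (n + 1)" "BS \<in> carrier_mat (n + 1) p" "XS \<in> carrier_mat (n + 1) (n + 1)"
proof -
  have "(- cnj w) \<cdot>\<^sub>m 1\<^sub>m 1 - (1 / X) \<cdot>\<^sub>m (\<eta> * \<sigma> * (mat_adjoint \<eta> - mat_adjoint \<xi>)) \<in> carrier_mat 1 1"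
    using \<eta> \<xi> \<sigma>(1) by (intro carrier_matI) simp_all
  from four_block_carrier_mat[OF base(1) this] show "AS \<in> carrier_mat (n + 1) (n + 1)" .
  have "\<eta> - \<xi> \<in> carrier_mat 1 p" using \<xi> by (rule minus_carrier_mat)
  with base(2) show "BS \<in> carrier_mat (n + 1) p" by (rule carrier_append_rows)
  show "XS \<in> carrier_mat (n + 1) (n + 1)" by (rule four_block_carrier_mat[OF base(3)]) simp
qed

text \<open>The definition of \<open>X\<close> with the denominator cleared, usable inside products of matrices.\<close>

lemma gram: "\<xi> * (\<sigma> * mat_adjoint \<xi>) - \<eta> * (\<sigma> * mat_adjoint \<eta>) = (X * (w + cnj w)) \<cdot>\<^sub>m 1\<^sub>m 1"
proof -
  have "w + cnj w \<noteq> 0" using w by (simp add: complex_eq_iff)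
  then have "X * (w + cnj w) = (\<xi> * (\<sigma> * mat_adjoint \<xi>) - \<eta> * (\<sigma> * mat_adjoint \<eta>)) $$ (0, 0)"
    unfolding X using \<xi> \<eta> \<sigma>(1) by (simp add: mat_ring)
  then show ?thesis using \<xi> \<eta> \<sigma>(1) by (intro eq_matI) (auto simp del: index_mult_mat(1) index_minus_mat(1))
qed

lemma gram_index:
  "(\<xi> * (\<sigma> * mat_adjoint \<xi>)) $$ (0, 0) - (\<eta> * (\<sigma> * mat_adjoint \<eta>)) $$ (0, 0) = X * (w + cnj w)"
  using arg_cong[OF gram, of "\<lambda>M. M $$ (0, 0)"] \<xi> \<eta> by (simp del: index_mult_mat(1))

lemma AS_mult_XS: "AS * XS = four_block_mat (A0 * X0) (B0 * (\<sigma> * mat_adjoint \<xi>))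
    (- (\<eta> * (\<sigma> * mat_adjoint B0))) (- (X * cnj w) \<cdot>\<^sub>m 1\<^sub>m 1 - \<eta> * (\<sigma> * (mat_adjoint \<eta> - mat_adjoint \<xi>)))"
proof -
  have "\<eta> * \<sigma> * mat_adjoint B0 * mat_inv X0 * X0 = \<eta> * (\<sigma> * mat_adjoint B0)"
    using base(2,3) \<eta> \<sigma>(1) X0_inv(1) by (simp add: mat_ring X0_inv(3))
  moreover have "((- cnj w) \<cdot>\<^sub>m 1\<^sub>m 1 - (1 / X) \<cdot>\<^sub>m (\<eta> * \<sigma> * (mat_adjoint \<eta> - mat_adjoint \<xi>))) * (X \<cdot>\<^sub>m 1\<^sub>m 1)
      = - (X * cnj w) \<cdot>\<^sub>m 1\<^sub>m 1 - \<eta> * (\<sigma> * (mat_adjoint \<eta> - mat_adjoint \<xi>))"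
    using \<eta> \<xi> \<sigma>(1) X_scalar(1)
    by (intro eq_matI) (auto simp: mat_ring algebra_simps simp del: index_mult_mat(1))
  moreover have "((1 / X) \<cdot>\<^sub>m (B0 * \<sigma> * mat_adjoint \<xi>)) * (X \<cdot>\<^sub>m 1\<^sub>m 1) = B0 * (\<sigma> * mat_adjoint \<xi>)"
    using \<xi> \<sigma>(1) base(2) X_scalar(1) by (simp add: mat_ring)
  ultimately show ?thesis using base(1-3) \<xi> \<eta> \<sigma>(1) X0_inv(1)
    by (subst mult_four_block_mat[of _ n n _ 1 _ 1 _ _ n _ 1]) auto
qed

text \<open>In the off-diagonal blocks the three contributions cancel outright; the upper left block is the
Lyapunov equation of the given realization, and the corner block vanishes by the definition of \<open>X\<close>.\<close>

lemma lyapunov: "AS * XS + XS * mat_adjoint AS + BS * \<sigma> * mat_adjoint BS = 0\<^sub>m (n + 1) (n + 1)"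
proof -
  have adjX: "mat_adjoint XS = XS"
    using base(3) by (simp add: mat_adjoint_four_block[of _ n n _ 1 _ 1] X0_adjoint X_scalar)
  have "XS * mat_adjoint AS = mat_adjoint (AS * XS)"
    using carriers by (subst mat_adjoint_mult) (simp_all only: adjX carrier_matD)
  also have "\<dots> = four_block_mat (X0 * mat_adjoint A0) (- (B0 * (\<sigma> * mat_adjoint \<eta>))) (\<xi> * (\<sigma> * mat_adjoint B0))
      (- (X * w) \<cdot>\<^sub>m 1\<^sub>m 1 - (\<eta> - \<xi>) * (\<sigma> * mat_adjoint \<eta>))"
    unfolding AS_mult_XS using base(1-3) \<xi> \<eta> \<sigma>
    by (subst mat_adjoint_four_block[of _ n n _ 1 _ 1])
      (auto simp: mat_adjoint_mult mat_adjoint_add X0_adjoint X_scalar mat_ring)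
  finally have XA: "XS * mat_adjoint AS = \<dots>" .
  have BB: "BS * \<sigma> * mat_adjoint BS = four_block_mat (B0 * (\<sigma> * mat_adjoint B0))
      (B0 * (\<sigma> * (mat_adjoint \<eta> - mat_adjoint \<xi>))) ((\<eta> - \<xi>) * (\<sigma> * mat_adjoint B0))
      ((\<eta> - \<xi>) * (\<sigma> * (mat_adjoint \<eta> - mat_adjoint \<xi>)))"
  proof -
    have ex: "\<eta> - \<xi> \<in> carrier_mat 1 p" using \<xi> by (rule minus_carrier_mat)
    have 1: "BS * \<sigma> = (B0 * \<sigma>) @\<^sub>r ((\<eta> - \<xi>) * \<sigma>)"
      by (rule append_rows_mult[OF base(2) ex \<sigma>(1)])
    have 2: "mat_adjoint BS = block_row (mat_adjoint B0) (mat_adjoint (\<eta> - \<xi>))"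
      by (rule mat_adjoint_append_rows[OF base(2) ex])
    have "((B0 * \<sigma>) @\<^sub>r ((\<eta> - \<xi>) * \<sigma>)) * block_row (mat_adjoint B0) (mat_adjoint (\<eta> - \<xi>)) =
      four_block_mat (B0 * \<sigma> * mat_adjoint B0) (B0 * \<sigma> * mat_adjoint (\<eta> - \<xi>))
        ((\<eta> - \<xi>) * \<sigma> * mat_adjoint B0) ((\<eta> - \<xi>) * \<sigma> * mat_adjoint (\<eta> - \<xi>))"
      using base(2) ex \<sigma>(1) by (intro append_rows_mult_block_row[of _ n p _ 1 _ n _ 1]) auto
    then show ?thesis unfolding 1 2 using base(2) \<xi> \<eta> \<sigma>(1)
      by (simp add: mat_mult_assoc mat_adjoint_add)
  qed
  have b11: "A0 * X0 + X0 * mat_adjoint A0 + B0 * (\<sigma> * mat_adjoint B0) = 0\<^sub>m n n"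
    using base(5) base(2) \<sigma>(1) by (simp add: mat_mult_assoc)
  have b12: "B0 * (\<sigma> * mat_adjoint \<xi>) + - (B0 * (\<sigma> * mat_adjoint \<eta>)) +
      B0 * (\<sigma> * (mat_adjoint \<eta> - mat_adjoint \<xi>)) = 0\<^sub>m n 1"
    using base(2) \<xi> \<eta> \<sigma>(1) by (intro eq_matI) (auto simp: mat_ring simp del: index_mult_mat(1))
  have b21: "- (\<eta> * (\<sigma> * mat_adjoint B0)) + \<xi> * (\<sigma> * mat_adjoint B0) +
      (\<eta> - \<xi>) * (\<sigma> * mat_adjoint B0) = 0\<^sub>m 1 n"
    using base(2) \<xi> \<eta> \<sigma>(1) by (intro eq_matI) (auto simp: mat_ring simp del: index_mult_mat(1))
  have b22: "(- (X * cnj w) \<cdot>\<^sub>m 1\<^sub>m 1 - \<eta> * (\<sigma> * (mat_adjoint \<eta> - mat_adjoint \<xi>))) +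
      (- (X * w) \<cdot>\<^sub>m 1\<^sub>m 1 - (\<eta> - \<xi>) * (\<sigma> * mat_adjoint \<eta>)) +
      (\<eta> - \<xi>) * (\<sigma> * (mat_adjoint \<eta> - mat_adjoint \<xi>)) = 0\<^sub>m 1 1"
  proof (rule eq_matI)
    have g: "(\<xi> * (\<sigma> * mat_adjoint \<xi>)) $$ (0, 0) = (\<eta> * (\<sigma> * mat_adjoint \<eta>)) $$ (0, 0) + X * (w + cnj w)"
      using gram_index by (simp add: algebra_simps)
    fix i j assume "i < dim_row (0\<^sub>m 1 1 :: complex mat)" "j < dim_col (0\<^sub>m 1 1 :: complex mat)"
    then have "i = 0" "j = 0" by auto
    then show "((- (X * cnj w) \<cdot>\<^sub>m 1\<^sub>m 1 - \<eta> * (\<sigma> * (mat_adjoint \<eta> - mat_adjoint \<xi>))) +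
      (- (X * w) \<cdot>\<^sub>m 1\<^sub>m 1 - (\<eta> - \<xi>) * (\<sigma> * mat_adjoint \<eta>)) +
      (\<eta> - \<xi>) * (\<sigma> * (mat_adjoint \<eta> - mat_adjoint \<xi>))) $$ (i, j) = 0\<^sub>m 1 1 $$ (i, j)"
      using \<xi> \<eta> \<sigma>(1) by (simp add: mat_ring g del: index_mult_mat(1)) (simp add: algebra_simps)
  qed (use \<xi> \<eta> \<sigma>(1) in auto)
  show ?thesis unfolding AS_mult_XS XA BB
    by (rule four_block_mat_sum3_eq_0[OF _ _ _ _ _ _ _ _ _ _ _ _ b11 b12 b21 b22];
        intro carrier_matI; use base(1-3) \<xi> \<eta> \<sigma>(1) in simp)
qed

lemma RS_realization_of_realization:
  assumes "S = 1\<^sub>m p - const_mat (mat_adjoint BS * mat_inv XS) * resolvent (n + 1) AS * const_mat (BS * \<sigma>)"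
  shows "RS_realization p \<sigma> S (n + 1) AS BS XS"
  unfolding RS_realization_def
  using assms carriers lyapunov positive_definite_block_diag[OF base(3,4) X_pos] by blast

text \<open>Split \<open>u\<close> into \<open>a\<close> and \<open>b\<close>. The condition \<open>B\<^sub>S\<^sup>* u = 0\<close> expresses \<open>B\<^sub>0\<^sup>* a\<close> through \<open>b\<close>; inserted in the last
row of \<open>A\<^sub>S\<^sup>* u = \<mu> u\<close>, it gives \<open>\<mu> b = w\<^sup>* b\<close>, because the mixed terms in \<open>\<xi>\<close> and \<open>\<eta>\<close> cancel and the
remaining ones add up to \<open>X (w + w\<^sup>*)\<close>. As \<open>Re \<mu> = 0\<close> by positivity of the
Gram matrix, while \<open>Re w > 0\<close>, this leaves \<open>b = 0\<close>; then \<open>a\<close> falls under the hypothesis on \<open>(A\<^sub>0, B\<^sub>0)\<close>.\<close>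

lemma AS_controllable:
  assumes ctrl: "\<And>a \<mu>. a \<in> carrier_vec n \<Longrightarrow> mat_adjoint A0 *\<^sub>v a = \<mu> \<cdot>\<^sub>v a \<Longrightarrow>
      mat_adjoint B0 *\<^sub>v a = 0\<^sub>v p \<Longrightarrow> a = 0\<^sub>v n"
    and u: "u \<in> carrier_vec (n + 1)"
    and Au: "mat_adjoint AS *\<^sub>v u = \<mu> \<cdot>\<^sub>v u" and Bu: "mat_adjoint BS *\<^sub>v u = 0\<^sub>v p"
  shows "u = 0\<^sub>v (n + 1)"
proof (rule ccontr)
  assume nz: "u \<noteq> 0\<^sub>v (n + 1)"
  have Re\<mu>: "Re \<mu> = 0"
    by (rule positive_gram_uncontrollable_mode_imaginary[OF carriers(1,2,3)
        positive_definite_block_diag[OF base(3,4) X_pos] \<sigma>(1) lyapunov u nz Au Bu])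
  define a b where "a = vec_first u n" and "b = vec_last u 1"
  have ab: "a \<in> carrier_vec n" "b \<in> carrier_vec 1" "u = a @\<^sub>v b"
    using u by (auto simp: a_def b_def)
  have ex: "\<eta> - \<xi> \<in> carrier_mat 1 p" using \<xi> by (rule minus_carrier_mat)
  let ?D = "(- w) \<cdot>\<^sub>m 1\<^sub>m 1 - (1 / X) \<cdot>\<^sub>m ((\<eta> - \<xi>) * (\<sigma> * mat_adjoint \<eta>))"
  let ?B = "(1 / X) \<cdot>\<^sub>m (\<xi> * (\<sigma> * mat_adjoint B0))"
  let ?C = "- (mat_inv X0 * (B0 * (\<sigma> * mat_adjoint \<eta>)))"
  have d: "?D \<in> carrier_mat 1 1" "?B \<in> carrier_mat 1 n" "?C \<in> carrier_mat n 1"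
    using \<xi> \<eta> \<sigma>(1) base(2) X0_inv(1) by (intro carrier_matI; simp)+
  have AS_adj: "mat_adjoint AS = four_block_mat (mat_adjoint A0) ?C ?B ?D"
    using base(1-3) \<xi> \<eta> \<sigma> X0_inv(1)
    by (subst mat_adjoint_four_block[of _ n n _ 1 _ 1])
      (auto simp: mat_adjoint_mult mat_adjoint_add X0_inv(4) X_scalar mat_ring)
  have "(mat_adjoint A0 *\<^sub>v a + ?C *\<^sub>v b) @\<^sub>v (?B *\<^sub>v a + ?D *\<^sub>v b) = (\<mu> \<cdot>\<^sub>v a) @\<^sub>v (\<mu> \<cdot>\<^sub>v b)"
  proof -
    have "mat_adjoint AS *\<^sub>v u = (mat_adjoint A0 *\<^sub>v a + ?C *\<^sub>v b) @\<^sub>v (?B *\<^sub>v a + ?D *\<^sub>v b)"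
      unfolding AS_adj ab(3) using base(1) d ab(1,2) by (intro four_block_mat_mult_vec) auto
    moreover have "\<mu> \<cdot>\<^sub>v u = (\<mu> \<cdot>\<^sub>v a) @\<^sub>v (\<mu> \<cdot>\<^sub>v b)"
      unfolding ab(3) by (intro eq_vecI) (auto simp: append_vec_def Let_def)
    ultimately show ?thesis using Au by simp
  qed
  then have r1: "mat_adjoint A0 *\<^sub>v a + ?C *\<^sub>v b = \<mu> \<cdot>\<^sub>v a" and r2: "?B *\<^sub>v a + ?D *\<^sub>v b = \<mu> \<cdot>\<^sub>v b"
    using base(1) ab d by (subst (asm) append_vec_eq[of _ n]; simp)+
  have r3: "mat_adjoint B0 *\<^sub>v a + (mat_adjoint \<eta> - mat_adjoint \<xi>) *\<^sub>v b = 0\<^sub>v p"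
  proof -
    have "mat_adjoint BS *\<^sub>v u =
        (mat_adjoint B0 *\<^sub>v a + (mat_adjoint \<eta> - mat_adjoint \<xi>) *\<^sub>v b) @\<^sub>v
          (0\<^sub>m 0 n *\<^sub>v a + 0\<^sub>m 0 1 *\<^sub>v b)"
      unfolding mat_adjoint_append_rows[OF base(2) ex] ab(3)
      using base(2) \<xi> \<eta> ab(1,2)
      by (subst four_block_mat_mult_vec[of _ p n _ 1 _ 0]) (auto simp: mat_adjoint_add)
    also have "\<dots> = mat_adjoint B0 *\<^sub>v a + (mat_adjoint \<eta> - mat_adjoint \<xi>) *\<^sub>v b"
      using base(2) \<xi> by (intro eq_vecI) (auto simp: append_vec_def Let_def)
    finally show ?thesis using Bu by simp
  qed
  define f where "f = \<xi> * (\<sigma> * mat_adjoint \<eta>) - \<xi> * (\<sigma> * mat_adjoint \<xi>)"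
  have f: "f \<in> carrier_mat 1 1" unfolding f_def using \<xi> by (intro carrier_matI) simp_all
  have Ba: "(\<xi> * (\<sigma> * mat_adjoint B0)) *\<^sub>v a + f *\<^sub>v b = 0\<^sub>v 1"
  proof -
    have "(\<xi> * \<sigma>) *\<^sub>v (mat_adjoint B0 *\<^sub>v a + (mat_adjoint \<eta> - mat_adjoint \<xi>) *\<^sub>v b) = 0\<^sub>v 1"
      unfolding r3 using \<xi> \<sigma>(1) by simp
    moreover have "(\<xi> * \<sigma>) *\<^sub>v (mat_adjoint B0 *\<^sub>v a + (mat_adjoint \<eta> - mat_adjoint \<xi>) *\<^sub>v b) =
        (\<xi> * (\<sigma> * mat_adjoint B0)) *\<^sub>v a + f *\<^sub>v b"
      using base(2) \<xi> \<eta> \<sigma>(1) ab(1,2) unfolding f_def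
      by (simp add: mat_mult_vec_add mat_add_vec mat_mult_vec_assoc)
    ultimately show ?thesis by simp
  qed
  have "\<mu> * b $ 0 = cnj w * b $ 0"
  proof -
    have B_index: "((\<xi> * (\<sigma> * mat_adjoint B0)) *\<^sub>v a) $ 0 = - (f $$ (0, 0) * b $ 0)"
    proof -
      have "((\<xi> * (\<sigma> * mat_adjoint B0)) *\<^sub>v a + f *\<^sub>v b) $ 0 = 0" unfolding Ba by simp
      then show ?thesis using mat_one_dim_vec[OF f ab(2)] f
        by (simp add: add_eq_0_iff2 del: index_mult_mat_vec)
    qed
    have "\<mu> * b $ 0 = (?B *\<^sub>v a + ?D *\<^sub>v b) $ 0" unfolding r2 using ab(2) by simp
    also have "\<dots> = (1 / X) * ((\<xi> * (\<sigma> * mat_adjoint B0)) *\<^sub>v a) $ 0 + ?D $$ (0, 0) * b $ 0"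
      using mat_one_dim_vec[OF d(1) ab(2)] d(1,2) ab(1) base(2) \<xi>
      by (simp add: mat_smult_vec del: index_mult_mat_vec index_minus_mat)
    also have "?D $$ (0, 0) = - w - (1 / X) * ((\<eta> * (\<sigma> * mat_adjoint \<eta>)) $$ (0, 0)
        - (\<xi> * (\<sigma> * mat_adjoint \<eta>)) $$ (0, 0))"
      using \<xi> \<eta> \<sigma>(1) by (simp add: mat_ring diff_divide_distrib del: index_mult_mat(1))
    also have "(1 / X) * ((\<xi> * (\<sigma> * mat_adjoint B0)) *\<^sub>v a) $ 0 + \<dots> * b $ 0 =
        (1 / X * ((\<xi> * (\<sigma> * mat_adjoint \<xi>)) $$ (0, 0) - (\<eta> * (\<sigma> * mat_adjoint \<eta>)) $$ (0, 0)) - w) * b $ 0"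
      unfolding B_index f_def using \<xi> \<eta> by (simp add: algebra_simps diff_divide_distrib del: index_mult_mat(1))
    also have "\<dots> = cnj w * b $ 0" unfolding gram_index using X_scalar(1) by simp
    finally show ?thesis .
  qed
  moreover have "\<mu> \<noteq> cnj w" using Re\<mu> w by auto
  ultimately have "b $ 0 = 0" by simp
  then have b0: "b = 0\<^sub>v 1" using ab(2) by (intro eq_vecI) auto
  have "mat_adjoint A0 *\<^sub>v a = \<mu> \<cdot>\<^sub>v a"
  proof -
    have "?C *\<^sub>v 0\<^sub>v 1 = 0\<^sub>v n"
      using mat_zero_vec[of ?C 1] by (simp only: carrier_matD[OF d(3)])
    then have "mat_adjoint A0 *\<^sub>v a + 0\<^sub>v n = \<mu> \<cdot>\<^sub>v a" using r1 unfolding b0 by simp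
    moreover have "mat_adjoint A0 *\<^sub>v a \<in> carrier_vec n"
      using base(1) ab(1) by (auto intro: mult_mat_vec_carrier)
    ultimately show ?thesis by simp
  qed
  moreover have "mat_adjoint B0 *\<^sub>v a = 0\<^sub>v p"
    using r3 base(2) ab(1) \<xi> \<eta> unfolding b0 by (simp add: mult_mat_vec_carrier[of _ p n])
  ultimately have "a = 0\<^sub>v n" using ctrl ab(1) by blast
  then show False using nz ab(3) b0 by auto
qed

lemma BS_adjoint_mult_XS_inv:
  "mat_adjoint BS * mat_inv XS =
    block_row (mat_adjoint B0 * mat_inv X0) ((1 / X) \<cdot>\<^sub>m (mat_adjoint \<eta> - mat_adjoint \<xi>))"
proof -
  have ex: "\<eta> - \<xi> \<in> carrier_mat 1 p" using \<xi> by (rule minus_carrier_mat)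
  let ?E = "mat_adjoint \<eta> - mat_adjoint \<xi>"
  have E: "?E \<in> carrier_mat p 1" using \<xi> by (intro minus_carrier_mat) simp
  have adj: "mat_adjoint BS = four_block_mat (mat_adjoint B0) ?E (0\<^sub>m 0 n) (0\<^sub>m 0 1)"
    unfolding mat_adjoint_append_rows[OF base(2) ex] using base(2) \<xi> \<eta> by (simp add: mat_adjoint_add)
  have "mat_adjoint BS * mat_inv XS = four_block_mat
      (mat_adjoint B0 * mat_inv X0 + ?E * 0\<^sub>m 1 n) (mat_adjoint B0 * 0\<^sub>m n 1 + ?E * ((1 / X) \<cdot>\<^sub>m 1\<^sub>m 1))
      (0\<^sub>m 0 n * mat_inv X0 + 0\<^sub>m 0 1 * 0\<^sub>m 1 n) (0\<^sub>m 0 n * 0\<^sub>m n 1 + 0\<^sub>m 0 1 * ((1 / X) \<cdot>\<^sub>m 1\<^sub>m 1))"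
    unfolding adj mat_inv_block_diag[OF base(3,4) X_scalar(1)]
    by (rule mult_four_block_mat[OF _ E _ _ X0_inv(1)]) (use base(2) in auto)
  moreover have "0\<^sub>m p 1 + (1 / X) \<cdot>\<^sub>m ?E = (1 / X) \<cdot>\<^sub>m ?E"
    using E by (intro left_add_zero_mat) auto
  ultimately show ?thesis using base(2) X0_inv(1) \<xi> \<eta> by (simp add: mat_smult_mult)
qed

text \<open>With \<open>f = \<eta> \<sigma>\<close>, \<open>g = \<xi> \<sigma>\<close> and \<open>d = c (\<eta>\<^sup>* - S\<^sub>0 \<xi>\<^sup>*)\<close>, the denominator of the transformation is \<open>I + d f\<close> and
its numerator is \<open>S\<^sub>0 + d g\<close>. The state equations of the extended system reduce to
\<open>T = S\<^sub>0 - (\<eta>\<^sup>* - S\<^sub>0 \<xi>\<^sup>*) Y\<close> and \<open>Y = c (f T - g)\<close>, which together say \<open>(I + d f) T = S\<^sub>0 + d g\<close>.\<close>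

lemma lft_state_space:
  assumes c: "c = 1 / (rat_const X * (rat_var + rat_const (cnj w)))"
    and \<Theta>: "\<Theta> = four_block_mat
        (1\<^sub>m p + c \<cdot>\<^sub>m const_mat (mat_adjoint \<eta> * \<eta> * \<sigma>))
        (c \<cdot>\<^sub>m const_mat (mat_adjoint \<eta> * \<xi> * \<sigma>))
        (- (c \<cdot>\<^sub>m const_mat (mat_adjoint \<xi> * \<eta> * \<sigma>)))
        (1\<^sub>m p - c \<cdot>\<^sub>m const_mat (mat_adjoint \<xi> * \<xi> * \<sigma>))"
  shows "lft_defined p \<Theta> S0"
    and "lft p \<Theta> S0 = 1\<^sub>m p - const_mat (mat_adjoint BS * mat_inv XS) * resolvent (n + 1) AS * const_mat (BS * \<sigma>)"
proof -
  let ?l = "rat_var + rat_const (cnj w) :: ratfun"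
  have l0: "?l \<noteq> 0"
  proof
    assume "?l = 0"
    then have "rat_eval ?l (1 - cnj w) = 0" by simp
    then show False by (simp add: rat_eval_add)
  qed
  have X0n: "rat_const X \<noteq> 0" using X_scalar by simp
  have inv_const: "rat_const (1 / X) = 1 / rat_const X"
  proof -
    have "rat_const (1 / X) * rat_const X = 1"
      using X_scalar(1) rat_const_hom(6)[of "1 / X" X] by simp
    then show ?thesis using X0n by (simp add: field_simps)
  qed
  have cl: "c * ?l = rat_const (1 / X)" 
  proof -
    have "1 / (a * l) * l = 1 / a" if "l \<noteq> 0" for a l :: ratfun using that by simp
    from this[OF l0] show ?thesis unfolding c inv_const .
  qed
  define xt et bt where "xt = const_mat (mat_adjoint \<xi>)" and "et = const_mat (mat_adjoint \<eta>)"
    and "bt = const_mat (mat_adjoint B0 * mat_inv X0)"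
  define f g b where "f = const_mat (\<eta> * \<sigma>)" and "g = const_mat (\<xi> * \<sigma>)" and "b = const_mat (B0 * \<sigma>)"
  define R0 where "R0 = resolvent n A0"
  have car: "xt \<in> carrier_mat p 1" "et \<in> carrier_mat p 1" "bt \<in> carrier_mat p n"
    "f \<in> carrier_mat 1 p" "g \<in> carrier_mat 1 p" "b \<in> carrier_mat n p" "R0 \<in> carrier_mat n n"
    using \<xi> \<eta> \<sigma>(1) base X0_inv(1) resolvent(1)[OF base(1)]
    by (auto simp: xt_def et_def bt_def f_def g_def b_def R0_def)
  have S0_eq: "S0 = 1\<^sub>m p - bt * (R0 * b)"
    using base(6) car by (simp add: bt_def[symmetric] b_def[symmetric] R0_def[symmetric] mat_mult_assoc)
  have S0c: "S0 \<in> carrier_mat p p" unfolding S0_eq using car by (intro carrier_matI) auto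
  define d where "d = c \<cdot>\<^sub>m (et - S0 * xt)"
  have dc: "d \<in> carrier_mat p 1" using car S0c by (auto simp: d_def)
  have blocks: "split_block \<Theta> p p = (1\<^sub>m p + c \<cdot>\<^sub>m const_mat (mat_adjoint \<eta> * \<eta> * \<sigma>),
      c \<cdot>\<^sub>m const_mat (mat_adjoint \<eta> * \<xi> * \<sigma>), - (c \<cdot>\<^sub>m const_mat (mat_adjoint \<xi> * \<eta> * \<sigma>)),
      1\<^sub>m p - c \<cdot>\<^sub>m const_mat (mat_adjoint \<xi> * \<xi> * \<sigma>))"
    unfolding \<Theta> using \<xi> \<eta> \<sigma>(1)
    by (intro split_block_four_block_mat[of _ p p _ p _ p]; intro carrier_matI; simp)
  have factors: "const_mat (mat_adjoint \<eta> * \<eta> * \<sigma>) = et * f" "const_mat (mat_adjoint \<eta> * \<xi> * \<sigma>) = et * g"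
    "const_mat (mat_adjoint \<xi> * \<eta> * \<sigma>) = xt * f" "const_mat (mat_adjoint \<xi> * \<xi> * \<sigma>) = xt * g"
    using \<xi> \<eta> \<sigma>(1) by (simp_all add: et_def xt_def f_def g_def const_mat_hom mat_mult_assoc)
  have denom: "lft_denom p \<Theta> S0 = 1\<^sub>m p + d * f"
    unfolding lft_denom_def blocks split factors d_def using car S0c
    by (intro eq_matI) (auto simp: mat_ring algebra_simps simp del: index_mult_mat(1))
  have numer: "lft_numer p \<Theta> S0 = S0 + d * g"
    unfolding lft_numer_def blocks split factors d_def using car S0c
    by (intro eq_matI) (auto simp: mat_ring algebra_simps simp del: index_mult_mat(1))
  \<comment> \<open>If \<open>f d = -1\<close>, then \<open>t = f (\<eta>\<^sup>* - S\<^sub>0 \<xi>\<^sup>*)\<close> equals \<open>-(\<lambda> + w\<^sup>*) X\<close>, which is unbounded, although \<open>S\<^sub>0\<close> and hence \<open>t\<close> converge at infinity.\<close>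
  have nz: "1 + (f * d) $$ (0, 0) \<noteq> 0"
  proof
    define t where "t = (f * (et - S0 * xt)) $$ (0, 0)"
    have "f * d = c \<cdot>\<^sub>m (f * (et - S0 * xt))" unfolding d_def using car S0c by (simp add: mat_smult_mult)
    then have fd: "(f * d) $$ (0, 0) = c * t" using car by (simp add: t_def del: index_mult_mat(1))
    assume "1 + (f * d) $$ (0, 0) = 0"
    then have "1 + c * t = 0" unfolding fd .
    then have "?l * rat_const X + c * (?l * rat_const X) * t = 0"
    proof -
      have "k + c * k * t = k * (1 + c * t)" for k by (simp add: algebra_simps)
      then show ?thesis using \<open>1 + c * t = 0\<close> by simp
    qed
    moreover have "c * (?l * rat_const X) = 1"
    proof -
      have "1 / (a * l) * (l * a) = 1" if "l \<noteq> 0" "a \<noteq> 0" for a l :: ratfun using that by simp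
      from this[OF l0 X0n] show ?thesis unfolding c .
    qed
    ultimately have t: "t = - (?l * rat_const X)" by (simp add: add_eq_0_iff)
    have t_eval: "rat_eval t = (\<lambda>z. - ((z + cnj w) * X))"
      unfolding t by (intro ext) (simp add: rat_eval_uminus rat_eval_mult rat_eval_add)
    have S0_lim: "mat_tendsto (eval_mat S0) (1\<^sub>m p) at_infinity"
      using RS_realization_imp_RS[OF \<sigma> S0] by (simp add: RS_def value_at_infinity_iff)
    have "mat_tendsto (\<lambda>z. (\<eta> * \<sigma>) * (mat_adjoint \<eta> - eval_mat S0 z * mat_adjoint \<xi>))
        ((\<eta> * \<sigma>) * (mat_adjoint \<eta> - 1\<^sub>m p * mat_adjoint \<xi>)) at_infinity"
      using S0_lim \<xi> \<eta> \<sigma>(1)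
      by (intro mat_tendsto_mult mat_tendsto_add mat_tendsto_const) auto
    then have "((\<lambda>z. ((\<eta> * \<sigma>) * (mat_adjoint \<eta> - eval_mat S0 z * mat_adjoint \<xi>)) $$ (0, 0)) \<longlongrightarrow>
        ((\<eta> * \<sigma>) * (mat_adjoint \<eta> - 1\<^sub>m p * mat_adjoint \<xi>)) $$ (0, 0)) at_infinity"
      using \<xi> \<eta> by (simp add: mat_tendsto_def del: index_mult_mat(1))
    moreover have "\<forall>\<^sub>F z in at_infinity.
        ((\<eta> * \<sigma>) * (mat_adjoint \<eta> - eval_mat S0 z * mat_adjoint \<xi>)) $$ (0, 0) = rat_eval t z"
      using eventually_analytic_mat[of S0]
    proof eventually_elim
      case (elim z)
      have an: "analytic_mat_at (et - S0 * xt) z"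
        "eval_mat (et - S0 * xt) z = mat_adjoint \<eta> - eval_mat S0 z * mat_adjoint \<xi>"
        using elim car S0c by (simp_all add: eval_minus_mat eval_mult_mat et_def xt_def)
      have ev: "eval_mat (f * (et - S0 * xt)) z = (\<eta> * \<sigma>) * (mat_adjoint \<eta> - eval_mat S0 z * mat_adjoint \<xi>)"
        using an eval_mult_mat[of f z "et - S0 * xt"] car S0c \<sigma>(1) by (simp add: f_def)
      have "eval_mat (f * (et - S0 * xt)) z $$ (0, 0) = rat_eval t z"
        using car by (simp add: t_def del: index_mult_mat(1))
      then show ?case unfolding ev .
    qed
    ultimately obtain L where "(rat_eval t \<longlongrightarrow> L) at_infinity"
      using Lim_transform_eventually by blast
    then have "((\<lambda>z. - ((z + cnj w) * X)) \<longlongrightarrow> L) at_infinity" unfolding t_eval .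
    then have "((\<lambda>z. - (- ((z + cnj w) * X)) / X - cnj w) \<longlongrightarrow> - L / X - cnj w) at_infinity"
      using X_scalar(1) by (intro tendsto_intros) auto
    moreover have "(\<lambda>z. - (- ((z + cnj w) * X)) / X - cnj w) = (\<lambda>z. z)"
      using X_scalar(1) by auto
    ultimately have "((\<lambda>z. z) \<longlongrightarrow> - L / X - cnj w) at_infinity" by simp
    then show False
      using not_tendsto_and_filterlim_at_infinity[OF complex_at_infinity_neq_bot] filterlim_ident by blast
  qed
  note inv = invertible_one_plus_rank_one[OF dc car(4) nz]
  show "lft_defined p \<Theta> S0" unfolding lft_defined_def denom by (rule inv(1))
  define y where "y = resolvent (n + 1) AS * const_mat (BS * \<sigma>)"
  have Rc: "resolvent (n + 1) AS \<in> carrier_mat (n + 1) (n + 1)" by (rule resolvent(1)[OF carriers(1)])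
  have BSs: "BS * \<sigma> \<in> carrier_mat (n + 1) p" using carriers(2) \<sigma>(1) by (rule mult_carrier_mat)
  have yc: "y \<in> carrier_mat (n + 1) p" unfolding y_def
    by (rule mult_carrier_mat[OF Rc]) (simp only: const_mat_dim BSs)
  obtain y0 y1 where y: "y0 \<in> carrier_mat n p" "y1 \<in> carrier_mat 1 p" "y = y0 @\<^sub>r y1"
    using ex_append_rows[OF yc] .
  define Y where "Y = rat_const (1 / X) \<cdot>\<^sub>m y1"
  have Yc: "Y \<in> carrier_mat 1 p" using y(2) by (simp add: Y_def)
  define V where "V = bt * y0"
  define T where "T = 1\<^sub>m p - (V + (et - xt) * Y)"
  have Vc: "V \<in> carrier_mat p p" and Tc: "T \<in> carrier_mat p p"
    using car y Yc by (auto simp: V_def T_def)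
  have ex: "\<eta> - \<xi> \<in> carrier_mat 1 p" using \<xi> by (rule minus_carrier_mat)
  have transfer: "1\<^sub>m p - const_mat (mat_adjoint BS * mat_inv XS) * resolvent (n + 1) AS * const_mat (BS * \<sigma>) = T"
  proof -
    let ?K = "const_mat (mat_adjoint BS * mat_inv XS)"
    have Kdim: "dim_col ?K = n + 1"
      unfolding BS_adjoint_mult_XS_inv using X0_inv(1) \<xi> by simp
    have K: "?K = block_row bt (rat_const (1 / X) \<cdot>\<^sub>m (et - xt))"
      unfolding BS_adjoint_mult_XS_inv using base(2) X0_inv(1) \<xi> \<eta>
      by (subst const_mat_four_block[of _ p n _ 1 _ 0]) (auto simp: const_mat_hom bt_def et_def xt_def)
    have "?K * resolvent (n + 1) AS * const_mat (BS * \<sigma>) = ?K * y"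
      unfolding y_def by (rule mat_mult_assoc) (use Kdim Rc BSs in \<open>simp_all only: const_mat_dim carrier_matD\<close>)
    also have "\<dots> = bt * y0 + (rat_const (1 / X) \<cdot>\<^sub>m (et - xt)) * y1"
      unfolding K y(3) using car y by (intro block_row_mult_append_rows[of _ p n _ 1]) auto
    also have "\<dots> = V + (et - xt) * Y"
      using car y by (simp add: V_def Y_def mat_ring)
    finally show ?thesis by (simp add: T_def)
  qed
  let ?L = "rat_var \<cdot>\<^sub>m 1\<^sub>m (n + 1) - const_mat AS"
  let ?D = "(- rat_const (cnj w)) \<cdot>\<^sub>m 1\<^sub>m 1 - rat_const (1 / X) \<cdot>\<^sub>m (f * (et - xt))"
  have L_blocks: "?L = four_block_mat (rat_var \<cdot>\<^sub>m 1\<^sub>m n - const_mat A0) (- (rat_const (1 / X) \<cdot>\<^sub>m (b * xt)))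
      (f * bt) (rat_var \<cdot>\<^sub>m 1\<^sub>m 1 - ?D)"
  proof -
    have "const_mat AS = four_block_mat (const_mat A0) (rat_const (1 / X) \<cdot>\<^sub>m (b * xt)) (- (f * bt)) ?D"
      using base(1,2) X0_inv(1) \<xi> \<eta> \<sigma>(1)
      by (subst const_mat_four_block[of _ n n _ 1 _ 1])
        (auto simp: const_mat_hom b_def xt_def f_def bt_def et_def mat_mult_assoc)
    moreover have "rat_var \<cdot>\<^sub>m 1\<^sub>m (n + 1) - four_block_mat (const_mat A0) (rat_const (1 / X) \<cdot>\<^sub>m (b * xt)) (- (f * bt)) ?D =
      four_block_mat (rat_var \<cdot>\<^sub>m 1\<^sub>m n - const_mat A0) (- (rat_const (1 / X) \<cdot>\<^sub>m (b * xt)))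
        (- (- (f * bt))) (rat_var \<cdot>\<^sub>m 1\<^sub>m 1 - ?D)"
      by (rule smult_one_minus_four_block; intro carrier_matI; use car base(1) in simp)
    ultimately show ?thesis by simp
  qed
  have "?L * y = const_mat (BS * \<sigma>)"
  proof -
    have "?L * y = (?L * resolvent (n + 1) AS) * const_mat (BS * \<sigma>)" unfolding y_def
      by (rule mat_mult_assoc[symmetric])
        (use carriers(1) Rc BSs in \<open>simp_all only: const_mat_dim carrier_matD index_minus_mat\<close>)
    then show ?thesis unfolding resolvent(2)[OF carriers(1)]
      using BSs by (simp only: const_mat_dim left_mult_one_mat' carrier_matD)
  qed
  also have "const_mat (BS * \<sigma>) = b @\<^sub>r (f - g)"
  proof -
    have "BS * \<sigma> = (B0 * \<sigma>) @\<^sub>r ((\<eta> - \<xi>) * \<sigma>)" by (rule append_rows_mult[OF base(2) ex \<sigma>(1)])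
    moreover have "const_mat ((B0 * \<sigma>) @\<^sub>r ((\<eta> - \<xi>) * \<sigma>)) =
        const_mat (B0 * \<sigma>) @\<^sub>r const_mat ((\<eta> - \<xi>) * \<sigma>)"
      using base(2) ex \<sigma>(1) by (intro const_mat_append_rows[of _ n p _ 1]) auto
    ultimately show ?thesis using \<xi> \<eta> \<sigma>(1)
      by (simp add: b_def f_def g_def const_mat_hom mat_minus_mult)
  qed
  finally have state: "?L * (y0 @\<^sub>r y1) = b @\<^sub>r (f - g)" unfolding y(3) .
  have "?L * (y0 @\<^sub>r y1) =
      ((rat_var \<cdot>\<^sub>m 1\<^sub>m n - const_mat A0) * y0 + (- (rat_const (1 / X) \<cdot>\<^sub>m (b * xt))) * y1) @\<^sub>r
      ((f * bt) * y0 + (rat_var \<cdot>\<^sub>m 1\<^sub>m 1 - ?D) * y1)"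
    unfolding L_blocks
    by (rule four_block_mat_mult_append_rows[of _ n n _ 1 _ 1]; (rule y)?; intro carrier_matI; use car base(1) in simp)
  with state have state': "((rat_var \<cdot>\<^sub>m 1\<^sub>m n - const_mat A0) * y0 + (- (rat_const (1 / X) \<cdot>\<^sub>m (b * xt))) * y1) @\<^sub>r
      ((f * bt) * y0 + (rat_var \<cdot>\<^sub>m 1\<^sub>m 1 - ?D) * y1) = b @\<^sub>r (f - g)" by simp
  have state1: "(rat_var \<cdot>\<^sub>m 1\<^sub>m n - const_mat A0) * y0 + (- (rat_const (1 / X) \<cdot>\<^sub>m (b * xt))) * y1 = b"
    and state2: "(f * bt) * y0 + (rat_var \<cdot>\<^sub>m 1\<^sub>m 1 - ?D) * y1 = f - g"
    by (rule append_rows_inject[OF state', of n p 1]; intro carrier_matI; use car y base(1) in simp)+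
  \<comment> \<open>The first block row, solved for \<open>y0\<close> by the resolvent of \<open>A0\<close>.\<close>
  have y0_eq: "y0 = R0 * b + R0 * (b * (xt * Y))"
  proof -
    have "R0 * ((rat_var \<cdot>\<^sub>m 1\<^sub>m n - const_mat A0) * y0) = y0"
      using resolvent(3)[OF base(1)] y(1) car base(1) by (simp add: R0_def flip: mat_mult_assoc)
    moreover have "(rat_var \<cdot>\<^sub>m 1\<^sub>m n - const_mat A0) * y0 = b + b * (xt * Y)"
    proof (rule eq_matI)
      have e: "(- (rat_const (1 / X) \<cdot>\<^sub>m (b * xt))) * y1 = - (b * (xt * Y))"
        using car y by (simp add: Y_def mat_ring)
      fix i j assume ij: "i < dim_row (b + b * (xt * Y))" "j < dim_col (b + b * (xt * Y))"
      then have "((rat_var \<cdot>\<^sub>m 1\<^sub>m n - const_mat A0) * y0 + - (b * (xt * Y))) $$ (i, j) = b $$ (i, j)"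
        using state1 unfolding e by simp
      then show "((rat_var \<cdot>\<^sub>m 1\<^sub>m n - const_mat A0) * y0) $$ (i, j) = (b + b * (xt * Y)) $$ (i, j)"
        using ij car Yc by (simp del: index_mult_mat(1) add: algebra_simps)
    qed (use car y Yc base(1) in auto)
    ultimately show ?thesis using car Yc by (simp add: mat_mult_add)
  qed
  have bR: "bt * (R0 * (b * Z)) = Z - S0 * Z" if "Z \<in> carrier_mat p q" for Z q
  proof -
    have "S0 * Z = Z - bt * (R0 * (b * Z))" unfolding S0_eq using car that by (simp add: mat_ring)
    then show ?thesis using car that by (intro eq_matI) (auto simp del: index_mult_mat(1))
  qed
  have T_eq: "T = S0 + S0 * (xt * Y) - et * Y"
  proof -
    have V: "V = 1\<^sub>m p - S0 + (xt * Y - S0 * (xt * Y))"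
    proof -
      have "V = bt * (R0 * (b * 1\<^sub>m p)) + bt * (R0 * (b * (xt * Y)))"
        unfolding V_def y0_eq using car Yc by (simp add: mat_mult_add)
      then show ?thesis using bR[of "1\<^sub>m p" p] bR[of "xt * Y" p] car Yc S0c by simp
    qed
    show ?thesis unfolding T_def V using car Yc S0c
      by (intro eq_matI) (auto simp: mat_minus_mult simp del: index_mult_mat(1))
  qed
  \<comment> \<open>The last row: its terms in \<open>y0\<close> and \<open>Y\<close> are \<open>f\<close> times the terms subtracted from \<open>I\<close> in \<open>T\<close>.\<close>
  have Y_eq: "Y = c \<cdot>\<^sub>m (f * T - g)"
  proof -
    have "?l \<cdot>\<^sub>m y1 = f * T - g"
    proof (rule eq_matI)
      have e: "(rat_var \<cdot>\<^sub>m 1\<^sub>m 1 - ?D) * y1 = ?l \<cdot>\<^sub>m y1 + f * ((et - xt) * Y)"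
        using car y by (intro eq_matI) (auto simp: Y_def mat_ring algebra_simps simp del: index_mult_mat(1))
      have fT: "f * T = f - (f * V + f * ((et - xt) * Y))"
        unfolding T_def using car Vc Yc by (simp add: mat_mult_minus mat_mult_add)
      have fV: "f * bt * y0 = f * V" unfolding V_def using car y by (simp add: mat_mult_assoc)
      fix i j assume "i < dim_row (f * T - g)" "j < dim_col (f * T - g)"
      then have ij: "i < 1" "j < p" using car by auto
      have "(f * V + (?l \<cdot>\<^sub>m y1 + f * ((et - xt) * Y))) $$ (i, j) = (f - g) $$ (i, j)"
        using state2 unfolding e fV by simp
      then show "(?l \<cdot>\<^sub>m y1) $$ (i, j) = (f * T - g) $$ (i, j)"
        unfolding fT using ij car Vc Yc y by (simp del: index_mult_mat(1) add: algebra_simps)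
    qed (use car y in auto)
    moreover have "Y = c \<cdot>\<^sub>m (?l \<cdot>\<^sub>m y1)" unfolding Y_def mat_smult_smult cl ..
    ultimately show ?thesis by simp
  qed
  have "(1\<^sub>m p + d * f) * T = S0 + d * g"
  proof -
    have dY: "d * (f * T - g) = et * Y - S0 * (xt * Y)"
    proof -
      have "d * Z = et * (c \<cdot>\<^sub>m Z) - S0 * (xt * (c \<cdot>\<^sub>m Z))" if "Z \<in> carrier_mat 1 p" for Z
        unfolding d_def using car S0c that
        by (simp add: mat_smult_mult mat_smult_add mat_minus_mult mat_mult_assoc)
      then show ?thesis unfolding Y_eq using minus_carrier_mat[OF car(5)] by blast
    qed
    have dT: "d * (f * T - g) = d * (f * T) - d * g" using dc car Tc by (simp add: mat_mult_minus)
    have 1: "(1\<^sub>m p + d * f) * T = T + d * (f * T)" using dc car Tc by (simp add: mat_ring)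
    show ?thesis unfolding 1
    proof (rule eq_matI)
      fix i j assume "i < dim_row (S0 + d * g)" "j < dim_col (S0 + d * g)"
      then have ij: "i < p" "j < p" using dc car by auto
      have "(d * (f * T) - d * g) $$ (i, j) = (et * Y - S0 * (xt * Y)) $$ (i, j)"
        using dY dT by simp
      then have 2: "(d * (f * T)) $$ (i, j) - (d * g) $$ (i, j) = (et * Y) $$ (i, j) - (S0 * (xt * Y)) $$ (i, j)"
        using ij car Yc S0c dc Tc by (simp del: index_mult_mat(1))
      have "T $$ (i, j) = (S0 + S0 * (xt * Y) - et * Y) $$ (i, j)" using T_eq by simp
      then have 3: "T $$ (i, j) = S0 $$ (i, j) + (S0 * (xt * Y)) $$ (i, j) - (et * Y) $$ (i, j)"
        using ij car Yc S0c by (simp del: index_mult_mat(1))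
      have "T $$ (i, j) + (d * (f * T)) $$ (i, j) = S0 $$ (i, j) + (d * g) $$ (i, j)"
        unfolding 3 using 2 by (simp add: diff_eq_eq)
      then show "(T + d * (f * T)) $$ (i, j) = (S0 + d * g) $$ (i, j)"
        using ij car dc Tc S0c by (simp del: index_mult_mat(1))
    qed (use dc car Tc S0c in auto)
  qed
  then have "lft p \<Theta> S0 = mat_inv (1\<^sub>m p + d * f) * ((1\<^sub>m p + d * f) * T)"
    unfolding lft_def denom numer by simp
  also have "\<dots> = (mat_inv (1\<^sub>m p + d * f) * (1\<^sub>m p + d * f)) * T"
    using inv(3) dc car Tc by (intro mat_mult_assoc[symmetric]) auto
  also have "\<dots> = T" unfolding inv(2) using Tc by simp
  finally show "lft p \<Theta> S0 = 1\<^sub>m p - const_mat (mat_adjoint BS * mat_inv XS) * resolvent (n + 1) AS * const_mat (BS * \<sigma>)"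
    unfolding transfer .
qed

end

theorem theorem3p5:
  fixes p n0 :: nat
    and \<sigma>1 \<xi> \<eta> A0 B0 X0 BS XS AS :: "complex mat"
    and w X :: complex
    and c :: ratfun
    and \<Theta> S0 S :: "ratfun mat"
  assumes \<sigma>1: "\<sigma>1 \<in> carrier_mat p p" "mat_adjoint \<sigma>1 = \<sigma>1" "invertible_mat \<sigma>1"
    and w: "Re w > 0"
    and \<xi>: "\<xi> \<in> carrier_mat 1 p"
    and \<eta>: "\<eta> \<in> carrier_mat 1 p"
    and X: "X = (\<xi> * \<sigma>1 * mat_adjoint \<xi> - \<eta> * \<sigma>1 * mat_adjoint \<eta>) $$ (0, 0) / (w + cnj w)"
    and X_pos: "0 < X"
    and c: "c = 1 / (rat_const X * (rat_var + rat_const (cnj w)))"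
    and \<Theta>: "\<Theta> = four_block_mat
        (1\<^sub>m p + c \<cdot>\<^sub>m const_mat (mat_adjoint \<eta> * \<eta> * \<sigma>1))
        (c \<cdot>\<^sub>m const_mat (mat_adjoint \<eta> * \<xi> * \<sigma>1))
        (- (c \<cdot>\<^sub>m const_mat (mat_adjoint \<xi> * \<eta> * \<sigma>1)))
        (1\<^sub>m p - c \<cdot>\<^sub>m const_mat (mat_adjoint \<xi> * \<xi> * \<sigma>1))"
    and S0: "S0 \<in> RS p \<sigma>1"
    and S0_min: "minimal_RS_realization p \<sigma>1 S0 n0 A0 B0 X0"
    and S: "S = lft p \<Theta> S0"
    and BS: "BS = B0 @\<^sub>r (\<eta> - \<xi>)"
    and XS: "XS = four_block_mat X0 (0\<^sub>m n0 1) (0\<^sub>m 1 n0) (X \<cdot>\<^sub>m 1\<^sub>m 1)"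
    and AS: "AS = four_block_mat
        A0
        ((1 / X) \<cdot>\<^sub>m (B0 * \<sigma>1 * mat_adjoint \<xi>))
        (- (\<eta> * \<sigma>1 * mat_adjoint B0 * mat_inv X0))
        ((- cnj w) \<cdot>\<^sub>m 1\<^sub>m 1 - (1 / X) \<cdot>\<^sub>m (\<eta> * \<sigma>1 * (mat_adjoint \<eta> - mat_adjoint \<xi>)))"
  shows "lft_defined p \<Theta> S0 \<and>
    S \<in> RS p \<sigma>1 \<and>
    minimal_RS_realization p \<sigma>1 S (n0 + 1) AS BS XS"
proof -
  have real0: "RS_realization p \<sigma>1 S0 n0 A0 B0 X0" using S0_min by (simp add: minimal_RS_realization_def)
  interpret ext: rank_one_extension p n0 \<sigma>1 \<xi> \<eta> A0 B0 X0 w X S0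
    by (rule rank_one_extension.intro) (fact \<sigma>1 w \<xi> \<eta> X X_pos real0)+
  note lft = ext.lft_state_space[OF c \<Theta>, folded BS XS AS S]
  have real: "RS_realization p \<sigma>1 S (n0 + 1) AS BS XS"
    using ext.RS_realization_of_realization[of S, folded BS XS AS] lft(2) by blast
  have "minimal_RS_realization p \<sigma>1 S (n0 + 1) AS BS XS"
  proof (rule controllable_imp_minimal_RS_realization[OF \<sigma>1 real])
    fix u \<mu>
    assume u: "u \<in> carrier_vec (n0 + 1)" "mat_adjoint AS *\<^sub>v u = \<mu> \<cdot>\<^sub>v u"
      "mat_adjoint BS *\<^sub>v u = 0\<^sub>v p"
    show "u = 0\<^sub>v (n0 + 1)"
      by (rule ext.AS_controllable[OF _ u[unfolded AS BS]])
        (rule minimal_RS_realization_controllable[OF \<sigma>1(1) S0_min])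
  qed
  then show ?thesis using lft(1) RS_realization_imp_RS[OF \<sigma>1(1,2) real] by blast
qed

end
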